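(* Let $\alpha$ be a non-degenerate probability measure on $(0,1)$ for which there is $\mathfrak{c}>0$ with $\alpha([\mathfrak{c},1-\mathfrak{c}])=1$, let $\mu=\alpha^{\mathbb{Z}}$, let $\tau$ be a resampling map, and let $X=(X_n)_{n}$ be the random walk in cooling random environment started at $0$ under its annealed law $P_0^{\mu,\tau}$. For each $n\in\mathbb{N}$ let $\mu_n$ be the probability measure on $\mathbb{R}$ defined by $\mu_n(A)=P_0^{\mu,\tau}(X_n/n\in A)$ for Borel $A\subseteq\mathbb{R}$. Let $Z=(Z_T)_{T}$ be the random walk in random environment started at $0$ under its annealed law $P_0^\mu$. Suppose there is a strictly convex function $\Lambda:\mathbb{R}\to\mathbb{R}$ such that for all $\theta\in\mathbb{R}$ $$\lim_{n\to\infty}\frac1n\log E_0^{\mu,\tau}\big[e^{\theta X_n}\big]=\lim_{n\to\infty}\sum_{k\ge1}\frac{T_{k,n}}{n}\,\frac{1}{T_{k,n}}\log E_0^{\mu}\big[e^{\theta Z_{T_{k,n}}}\big]=\Lambda(\theta),$$ where $T_{k,n}=(\tau(k)\wedge n)-(\tau(k-1)\wedge n)$ and terms with $T_{k,n}=0$ are read as $0$. Then $(\mu_n)_{n\in\mathbb{N}}$ satisfies the large deviation principle with rate $n$ and rate function $$I(x)=\sup_{\theta\in\mathbb{R}}\{x\theta-\Lambda(\theta)\},\qquad x\in\mathbb{R}.$$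
   Context: Notation: $\mathbb{N}=\{1,2,\dots\}$, $\mathbb{N}_0=\{0,1,2,\dots\}$, $a\wedge b=\min(a,b)$. Environments. An environment is $\omega=(\omega(x))_{x\in\mathbb{Z}}\in(0,1)^{\mathbb{Z}}$. Under $\mu=\alpha^{\mathbb{Z}}$ its coordinates are i.i.d. with law $\alpha$. Random walk in random environment (RWRE). Given $\omega$, $Z=(Z_n)_{n\in\mathbb{N}_0}$ is the Markov chain on $\mathbb{Z}$ which jumps from $x$ to $x+1$ with probability $\omega(x)$ and from $x$ to $x-1$ with probability $1-\omega(x)$. Its (quenched) law started at $x$ is $P_x^\omega$. The annealed law is $P_x^\mu(\cdot)=\int P_x^\omega(\cdot)\,\mu(d\omega)$, with expectation $E_x^\mu$. Resampling map. A function $\tau:\mathbb{N}_0\to\mathbb{N}_0\cup\{\infty\}$ with $\tau(0)=0$, $\tau(n)\le\tau(n+1)$ for all $n$, and $\lim_{n\to\infty}\tau(n)=\infty$. Random walk in cooling random environment (RWCRE). Let $\bar\omega=(\omega_k)_{k\in\mathbb{N}}$ be an i.i.d. sequence of environments, each with law $\mu$, and put $\ell_n=\inf\{k\in\mathbb{N}:\tau(k)>n\}$. Given $\bar\omega$, $X=(X_n)_{n\in\mathbb{N}_0}$ is the time-inhomogeneous nearest-neighbour Markov chain on $\mathbb{Z}$ which at time $n$ jumps from $x$ to $x+1$ with probability $\omega_{\ell_n}(x)$ and to $x-1$ with probability $1-\omega_{\ell_n}(x)$. Its quenched law started at $x$ is $P_x^{\bar\omega,\tau}$. The annealed law is $P_x^{\mu,\tau}(\cdot)=\int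 P_x^{\bar\omega,\tau}(\cdot)\,\mu^{\mathbb{N}}(d\bar\omega)$, with expectation $E_x^{\mu,\tau}$. Large deviation principle. A sequence of probability measures $(\mu_n)$ on $\mathbb{R}$ satisfies the large deviation principle with rate $n$ and rate function $I:\mathbb{R}\to[0,\infty]$ if: $I\not\equiv\infty$, $I$ is lower semicontinuous and has compact level sets; for every closed $C\subseteq\mathbb{R}$, $\limsup_{n\to\infty}\frac1n\log\mu_n(C)\le-\inf_{x\in C}I(x)$; and for every open $O\subseteq\mathbb{R}$, $\liminf_{n\to\infty}\frac1n\log\mu_n(O)\ge-\inf_{x\in O}I(x)$. *)

theory Defs
  imports "HOL-Probability.Probability"
begin

section \<open>Nearest-neighbour chains on the integers\<close>

text \<open>\<open>bernoulli_pmf\<close> truncates its parameter to \<open>[0, 1]\<close>; for environments in \<open>(0, 1)\<close> this has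
  no effect.\<close>
definition step_pmf :: "real \<Rightarrow> int \<Rightarrow> int pmf" where
  "step_pmf q y = map_pmf (\<lambda>up. if up then y + 1 else y - 1) (bernoulli_pmf q)"

lemma pmf_step_pmf:
  assumes "0 \<le> q" "q \<le> 1"
  shows "pmf (step_pmf q y) z = (if z = y + 1 then q else if z = y - 1 then 1 - q else 0)"
proof -
  have "pmf (step_pmf q y) z = measure (bernoulli_pmf q) {up. (if up then y + 1 else y - 1) = z}"
    by (simp add: step_pmf_def pmf_map vimage_def)
  also have "{up. (if up then y + 1 else y - 1) = z} =
      (if z = y + 1 then {True} else if z = y - 1 then {False} else {})"
    by (auto split: if_splits)
  finally show ?thesis
    using assms by (simp add: measure_pmf_single)
qed

definition chain_kernel :: "(nat \<Rightarrow> int \<Rightarrow> real) \<Rightarrow> int \<Rightarrow> nat \<Rightarrow> (nat \<Rightarrow> int) \<Rightarrow> int measure" where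
  "chain_kernel p x i h =
     measure_pmf (case i of 0 \<Rightarrow> return_pmf x | Suc n \<Rightarrow> step_pmf (p n (h n)) (h n))"

abbreviation path_space :: "(nat \<Rightarrow> int) measure" where
  "path_space \<equiv> \<Pi>\<^sub>M i\<in>UNIV. count_space UNIV"

text \<open>The law on path space of the Markov chain started at \<open>x\<close> that at time \<open>n\<close> jumps from
  \<open>y\<close> to \<open>y + 1\<close> with probability \<open>p n y\<close> and to \<open>y - 1\<close> otherwise. It is the Ionescu-Tulcea
  measure of the conditional laws \<open>chain_kernel p x i h\<close> of the position at time \<open>i\<close> given the
  history \<open>h\<close> before \<open>i\<close>; lemma \<open>nn_chain_cylinder\<close> below gives its cylinder probabilities.\<close>
definition nn_chain :: "(nat \<Rightarrow> int \<Rightarrow> real) \<Rightarrow> int \<Rightarrow> (nat \<Rightarrow> int) measure" where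
  "nn_chain p x = projective_family.lim UNIV
     (Ionescu_Tulcea.CI (chain_kernel p x) (\<lambda>_. count_space UNIV)) (\<lambda>_. count_space UNIV)"

lemma measurable_step_pmf_aux:
  "(\<lambda>q. measure_pmf (step_pmf q y)) \<in> borel \<rightarrow>\<^sub>M subprob_algebra (count_space UNIV)"
proof (rule measurable_subprob_algebra)
  fix q show "subprob_space (measure_pmf (step_pmf q y))"
    by (rule measure_pmf.subprob_space_axioms)
next
  fix A :: "int set"
  have "emeasure (step_pmf q y) A = ennreal (max 0 (min 1 q)) * indicator A (y + 1)
      + ennreal (1 - max 0 (min 1 q)) * indicator A (y - 1)" for q
  proof -
    let ?r = "max 0 (min 1 q)"
    have r: "0 \<le> ?r" "?r \<le> 1" by auto
    have "bernoulli_pmf q = bernoulli_pmf ?r"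
      by (rule pmf_eqI) (simp add: bernoulli_pmf.rep_eq)
    then have "emeasure (step_pmf q y) A = (\<integral>\<^sup>+up. indicator A (if up then y + 1 else y - 1) \<partial>bernoulli_pmf ?r)"
      unfolding step_pmf_def by (simp flip: nn_integral_indicator add: indicator_def vimage_def)
    also have "\<dots> = ennreal ?r * indicator A (y + 1) + ennreal (1 - ?r) * indicator A (y - 1)"
      using r by (subst nn_integral_bernoulli_pmf) (simp_all del: max.bounded_iff add: mult.commute)
    finally show ?thesis .
  qed
  then show "(\<lambda>q. emeasure (step_pmf q y) A) \<in> borel_measurable borel"
    by simp
qed simp

lemma measurable_chain_kernel:
  assumes p: "\<And>n y. (\<lambda>\<omega>. p \<omega> n y) \<in> borel_measurable N"
  shows "(\<lambda>(\<omega>, h). chain_kernel (p \<omega>) x i h)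
    \<in> (N \<Otimes>\<^sub>M (\<Pi>\<^sub>M i\<in>{0..<i}. count_space UNIV)) \<rightarrow>\<^sub>M subprob_algebra (count_space UNIV)"
proof (cases i)
  case 0
  have "measure_pmf (return_pmf x) \<in> space (subprob_algebra (count_space UNIV))"
    by (auto simp: space_subprob_algebra measure_pmf.subprob_space_axioms)
  then show ?thesis using 0 by (simp add: chain_kernel_def split_beta')
next
  case (Suc n)
  have 1: "(\<lambda>z. snd z n) \<in> (N \<Otimes>\<^sub>M (\<Pi>\<^sub>M i\<in>{0..<Suc n}. count_space (UNIV :: int set))) \<rightarrow>\<^sub>M count_space UNIV"
    by (rule measurable_compose[OF measurable_snd measurable_component_singleton]) simp
  have "(\<lambda>z. measure_pmf (step_pmf (p (fst z) n (snd z n)) (snd z n)))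
     \<in> (N \<Otimes>\<^sub>M (\<Pi>\<^sub>M i\<in>{0..<Suc n}. count_space UNIV)) \<rightarrow>\<^sub>M subprob_algebra (count_space UNIV)"
  proof (rule measurable_compose_countable[OF _ 1])
    fix y :: int
    show "(\<lambda>z. measure_pmf (step_pmf (p (fst z) n y) y))
     \<in> (N \<Otimes>\<^sub>M (\<Pi>\<^sub>M i\<in>{0..<Suc n}. count_space (UNIV::int set))) \<rightarrow>\<^sub>M subprob_algebra (count_space UNIV)"
      by (rule measurable_compose[OF measurable_compose[OF measurable_fst p] measurable_step_pmf_aux])
  qed
  then show ?thesis using Suc by (simp add: chain_kernel_def split_beta')
qed

lemma Ionescu_Tulcea_chain_kernel: "Ionescu_Tulcea (chain_kernel p x) (\<lambda>_. count_space UNIV)"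
proof (rule Ionescu_Tulcea.intro)
  fix i
  have "(\<lambda>(\<omega>::unit, h). chain_kernel p x i h)
    \<in> (count_space UNIV \<Otimes>\<^sub>M (\<Pi>\<^sub>M i\<in>{0..<i}. count_space UNIV)) \<rightarrow>\<^sub>M subprob_algebra (count_space UNIV)"
    by (rule measurable_chain_kernel) simp
  from measurable_compose[OF measurable_Pair1'[of "()"] this]
  show "chain_kernel p x i \<in> (\<Pi>\<^sub>M i\<in>{0..<i}. count_space UNIV) \<rightarrow>\<^sub>M subprob_algebra (count_space UNIV)"
    by simp
next
  fix i h show "prob_space (chain_kernel p x i h)"
    by (simp add: chain_kernel_def measure_pmf.prob_space_axioms)
qed

lemma sets_nn_chain [measurable_cong, simp]: "sets (nn_chain p x) = sets path_space"
proof -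
  interpret Ionescu_Tulcea "chain_kernel p x" "\<lambda>_. count_space UNIV"
    by (rule Ionescu_Tulcea_chain_kernel)
  show ?thesis by (simp add: nn_chain_def)
qed

lemma space_nn_chain [simp]: "space (nn_chain p x) = UNIV"
  using sets_eq_imp_space_eq[OF sets_nn_chain, of p x] by (simp add: space_PiM PiE_UNIV_domain)

lemma prob_space_nn_chain: "prob_space (nn_chain p x)"
proof -
  interpret Ionescu_Tulcea "chain_kernel p x" "\<lambda>_. count_space UNIV"
    by (rule Ionescu_Tulcea_chain_kernel)
  have "prob_space (distr PF.lim (\<Pi>\<^sub>M i\<in>{}. count_space UNIV) (\<lambda>h. restrict h {}))"
    by (subst distr_lim) (auto intro: PF.prob_space_P)
  then show ?thesis
    unfolding nn_chain_def by (rule prob_space_distrD[rotated]) (simp add: PF.sets_lim measurable_cong_sets[OF PF.sets_lim refl] measurable_restrict)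
qed

lemma singleton_restrict_eq: "{restrict a J} = (\<Pi>\<^sub>E i\<in>J. {a i})"
  by (auto simp: PiE_iff extensional_def fun_eq_iff)

lemma emeasure_C_singleton:
  assumes "Ionescu_Tulcea P (\<lambda>_. count_space (UNIV::int set))"
    and dep: "\<And>i h h'. (\<And>j. j < i \<Longrightarrow> h j = h' j) \<Longrightarrow> P i h = P i h'"
  shows "emeasure (Ionescu_Tulcea.C P (\<lambda>_. count_space UNIV) 0 n (\<lambda>_. undefined)) {restrict a {0..<n}}
    = (\<Prod>i<n. emeasure (P i a) {a i})"
proof -
  interpret Ionescu_Tulcea P "\<lambda>_. count_space (UNIV::int set)" by fact
  have sing: "{restrict a {0..<m}} \<in> sets (\<Pi>\<^sub>M i\<in>{0..<m}. count_space UNIV)" for m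
  proof -
    have "{restrict a {0..<m}} = (\<Pi>\<^sub>E i\<in>{0..<m}. {a i})"
      by (rule singleton_restrict_eq)
    then show ?thesis by (auto intro!: sets_PiM_I_finite)
  qed
  show ?thesis
  proof (induction n)
    case 0
    show ?case by (simp add: emeasure_return PiM_empty space_PiM restrict_def)
  next
    case (Suc m)
    let ?C = "C 0 m (\<lambda>_. undefined)"
    have sp: "space ?C = space (\<Pi>\<^sub>M i\<in>{0..<m}. count_space UNIV)"
      by (subst space_C) (simp_all add: space_PiM)
    have st: "sets ?C = sets (\<Pi>\<^sub>M i\<in>{0..<m}. count_space UNIV)"
      by (subst sets_C) (simp_all add: space_PiM)
    have "emeasure (?C \<bind> eP m) {restrict a {0..<Suc m}} = (\<integral>\<^sup>+h. emeasure (eP m h) {restrict a {0..<Suc m}} \<partial>?C)"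
      using measurable_eP[of m] sing[of "Suc m"] by (intro emeasure_bind) (auto simp: sp space_PiM PiE_eq_empty_iff measurable_cong_sets[OF st refl])
    also have "\<dots> = (\<integral>\<^sup>+h. emeasure (P m a) {a m} * indicator {restrict a {0..<m}} h \<partial>?C)"
    proof (rule nn_integral_cong)
      fix h assume "h \<in> space ?C"
      then have h: "h \<in> space (\<Pi>\<^sub>M i\<in>{0..<m}. count_space (UNIV::int set))" by (simp add: sp)
      have eq: "(fun_upd h m y = restrict a {0..<Suc m}) \<longleftrightarrow> h = restrict a {0..<m} \<and> y = a m" for y
        using h by (auto simp: space_PiM PiE_iff extensional_def fun_eq_iff restrict_def less_Suc_eq)
      have "emeasure (eP m h) {restrict a {0..<Suc m}} = emeasure (P m h) {y. fun_upd h m y = restrict a {0..<Suc m}}"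
        using emeasure_eP[OF h sing[of "Suc m"]] by (simp add: vimage_def)
      also have "\<dots> = emeasure (P m a) {a m} * indicator {restrict a {0..<m}} h"
      proof (cases "h = restrict a {0..<m}")
        case True
        then have "P m h = P m a" by (intro dep) simp
        with True show ?thesis unfolding eq by simp
      qed (simp add: eq)
      finally show "emeasure (eP m h) {restrict a {0..<Suc m}} = emeasure (P m a) {a m} * indicator {restrict a {0..<m}} h" .
    qed
    also have "\<dots> = emeasure (P m a) {a m} * emeasure ?C {restrict a {0..<m}}"
      using sing[of m] by (subst nn_integral_cmult_indicator) (simp_all add: st)
    finally show ?case using Suc by (simp add: mult.commute del: restrict_apply)
  qed
qed

lemma nn_chain_cylinder:
  "emeasure (nn_chain p x) {h. \<forall>i\<le>n. h i = a i} =
     (if a 0 = x then \<Prod>i<n. ennreal (pmf (step_pmf (p i (a i)) (a i)) (a (Suc i))) else 0)"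
proof -
  interpret Ionescu_Tulcea "chain_kernel p x" "\<lambda>_. count_space UNIV"
    by (rule Ionescu_Tulcea_chain_kernel)
  have eq: "{restrict a {0..<Suc n}} = (\<Pi>\<^sub>E i\<in>{0..<Suc n}. {a i})"
    by (rule singleton_restrict_eq)
  have X: "{restrict a {0..<Suc n}} \<in> sets (\<Pi>\<^sub>M i\<in>{0..<Suc n}. count_space UNIV)"
    unfolding eq by (auto intro!: sets_PiM_I_finite)
  have "{h. \<forall>i\<le>n. h i = a i} = PF.emb UNIV {0..<Suc n} {restrict a {0..<Suc n}}"
    by (auto simp: prod_emb_def PiE_UNIV_domain fun_eq_iff restrict_def less_Suc_eq_le split: if_splits)
  then have "emeasure (nn_chain p x) {h. \<forall>i\<le>n. h i = a i} = emeasure (CI {0..<Suc n}) {restrict a {0..<Suc n}}"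
    unfolding nn_chain_def using lim[OF _ X] by simp
  also have "\<dots> = emeasure (C 0 (Suc n) (\<lambda>_. undefined)) {restrict a {0..<Suc n}}"
    using emeasure_CI[OF order_refl X] prod_emb_id[of "{restrict a {0..<Suc n}}" "{0..<Suc n}" "\<lambda>_. count_space UNIV"]
    by (simp del: C.simps restrict_apply)
  also have "\<dots> = (\<Prod>i<Suc n. emeasure (chain_kernel p x i a) {a i})"
    by (rule emeasure_C_singleton[OF Ionescu_Tulcea_chain_kernel]) (auto simp: chain_kernel_def split: nat.split)
  also have "\<dots> = (if a 0 = x then \<Prod>i<n. ennreal (pmf (step_pmf (p i (a i)) (a i)) (a (Suc i))) else 0)"
    by (subst prod.lessThan_Suc_shift) (auto simp: chain_kernel_def emeasure_pmf_single)
  finally show ?thesis .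
qed

lemma measurable_C_chain:
  assumes p: "\<And>n y. (\<lambda>\<omega>. p \<omega> n y) \<in> borel_measurable N"
  shows "(\<lambda>\<omega>. Ionescu_Tulcea.C (chain_kernel (p \<omega>) x) (\<lambda>_. count_space UNIV) 0 n (\<lambda>_. undefined))
    \<in> N \<rightarrow>\<^sub>M subprob_algebra (\<Pi>\<^sub>M i\<in>{0..<n}. count_space UNIV)"
proof (induction n)
  case 0
  have "return (\<Pi>\<^sub>M i\<in>{0..<0::nat}. count_space (UNIV::int set)) (\<lambda>_. undefined)
      \<in> space (subprob_algebra (\<Pi>\<^sub>M i\<in>{0..<0}. count_space UNIV))"
    by (rule return_measurable[THEN measurable_space]) (simp add: space_PiM)
  then show ?case
    by (simp add: Ionescu_Tulcea.C.simps[OF Ionescu_Tulcea_chain_kernel])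
next
  case (Suc n)
  have "(\<lambda>z. distr (chain_kernel (p (fst z)) x n (snd z)) (\<Pi>\<^sub>M i\<in>{0..<Suc n}. count_space UNIV) (fun_upd (snd z) n))
    \<in> (N \<Otimes>\<^sub>M (\<Pi>\<^sub>M i\<in>{0..<n}. count_space UNIV)) \<rightarrow>\<^sub>M subprob_algebra (\<Pi>\<^sub>M i\<in>{0..<Suc n}. count_space UNIV)"
    by (rule measurable_distr2[where M="count_space UNIV"])
      (use measurable_chain_kernel[of p N x n, OF p] in \<open>auto simp: split_beta' intro!: measurable_fun_upd[where J="{0..<n}"]\<close>)
  from measurable_bind[OF Suc this] show ?case
    by (simp add: Ionescu_Tulcea.C.simps[OF Ionescu_Tulcea_chain_kernel]
        Ionescu_Tulcea.eP_def[OF Ionescu_Tulcea_chain_kernel, abs_def] fun_upd_def[abs_def])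
qed

lemma measurable_nn_chain:
  assumes p: "\<And>n y. (\<lambda>\<omega>. p \<omega> n y) \<in> borel_measurable N"
  shows "(\<lambda>\<omega>. nn_chain (p \<omega>) x) \<in> N \<rightarrow>\<^sub>M prob_algebra path_space"
proof (rule measurable_prob_algebra_generated[OF sets_PiM Int_stable_prod_algebra prod_algebra_sets_into_space])
  fix A assume "A \<in> prod_algebra UNIV (\<lambda>_::nat. count_space (UNIV::int set))"
  then obtain J E where J: "finite J" and A: "A = prod_emb UNIV (\<lambda>_. count_space UNIV) J (\<Pi>\<^sub>E j\<in>J. E j)"
    by (blast elim: prod_algebraE)
  obtain n where n: "J \<subseteq> {0..<n}"
    using J by (metis finite_nat_set_iff_bounded atLeast0LessThan lessThan_iff subsetI)
  have X: "(\<Pi>\<^sub>E j\<in>J. E j) \<in> sets (\<Pi>\<^sub>M j\<in>J. count_space (UNIV::int set))"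
    using J by (auto intro!: sets_PiM_I_finite)
  let ?B = "prod_emb {0..<n} (\<lambda>_. count_space UNIV) J (\<Pi>\<^sub>E j\<in>J. E j)"
  have B: "?B \<in> sets (\<Pi>\<^sub>M j\<in>{0..<n}. count_space (UNIV::int set))"
    using n X by (rule measurable_prod_emb)
  have "emeasure (nn_chain (p \<omega>) x) A =
     emeasure (Ionescu_Tulcea.C (chain_kernel (p \<omega>) x) (\<lambda>_. count_space UNIV) 0 n (\<lambda>_. undefined)) ?B" for \<omega>
    unfolding A nn_chain_def
    using Ionescu_Tulcea.lim[OF Ionescu_Tulcea_chain_kernel J X, of "p \<omega>" x]
      Ionescu_Tulcea.emeasure_CI[OF Ionescu_Tulcea_chain_kernel n X, of "p \<omega>" x] by simp
  then show "(\<lambda>\<omega>. emeasure (nn_chain (p \<omega>) x) A) \<in> borel_measurable N"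
    using measurable_compose[OF measurable_C_chain[OF p] measurable_emeasure_subprob_algebra[OF B]] by simp
qed (simp_all add: prob_space_nn_chain)


section \<open>Random walks in static and in cooling random environment\<close>

type_synonym environment = "int \<Rightarrow> real"

abbreviation env_space :: "environment measure" where
  "env_space \<equiv> \<Pi>\<^sub>M x\<in>UNIV. borel"

definition env_law :: "real measure \<Rightarrow> environment measure" where
  "env_law \<alpha> = (\<Pi>\<^sub>M x\<in>UNIV. \<alpha>)"

definition rwre_quenched :: "environment \<Rightarrow> int \<Rightarrow> (nat \<Rightarrow> int) measure" where
  "rwre_quenched \<omega> x = nn_chain (\<lambda>n. \<omega>) x"

definition rwre_annealed :: "environment measure \<Rightarrow> int \<Rightarrow> (nat \<Rightarrow> int) measure" where
  "rwre_annealed \<mu> x = \<mu> \<bind> (\<lambda>\<omega>. rwre_quenched \<omega> x)"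

definition resampling_map :: "(nat \<Rightarrow> enat) \<Rightarrow> bool" where
  "resampling_map \<tau> \<longleftrightarrow> \<tau> 0 = 0 \<and> (\<forall>n. \<tau> n \<le> \<tau> (Suc n)) \<and> \<tau> \<longlonglongrightarrow> \<infinity>"

definition env_index :: "(nat \<Rightarrow> enat) \<Rightarrow> nat \<Rightarrow> nat" where
  "env_index \<tau> n = Inf {k. 1 \<le> k \<and> enat n < \<tau> k}"

definition rwcre_quenched ::
    "(nat \<Rightarrow> environment) \<Rightarrow> (nat \<Rightarrow> enat) \<Rightarrow> int \<Rightarrow> (nat \<Rightarrow> int) measure" where
  "rwcre_quenched \<omega>s \<tau> x = nn_chain (\<lambda>n. \<omega>s (env_index \<tau> n)) x"

text \<open>Environments are indexed by \<open>k \<ge> 1\<close>.\<close>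
definition rwcre_annealed :: "environment measure \<Rightarrow> (nat \<Rightarrow> enat) \<Rightarrow> int \<Rightarrow> (nat \<Rightarrow> int) measure" where
  "rwcre_annealed \<mu> \<tau> x = (\<Pi>\<^sub>M k\<in>{1..}. \<mu>) \<bind> (\<lambda>\<omega>s. rwcre_quenched \<omega>s \<tau> x)"

text \<open>\<open>T\<^sub>k\<^sub>,\<^sub>n\<close>: the number of steps before time \<open>n\<close> that use the \<open>k\<close>-th environment
  (\<open>k \<ge> 1\<close>).\<close>
definition block_length :: "(nat \<Rightarrow> enat) \<Rightarrow> nat \<Rightarrow> nat \<Rightarrow> nat" where
  "block_length \<tau> k n = the_enat (min (\<tau> k) (enat n)) - the_enat (min (\<tau> (k - 1)) (enat n))"

text \<open>The next lemmas show that the kernels in the two mixtures above are measurable, so that the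
  annealed laws are the intended integrals of the quenched laws.\<close>

lemma env_index_props:
  assumes "resampling_map \<tau>"
  shows "1 \<le> env_index \<tau> n" "enat n < \<tau> (env_index \<tau> n)"
proof -
  have "\<forall>\<^sub>F k in sequentially. enat n < \<tau> k"
    using assms unfolding resampling_map_def by (auto dest!: order_tendstoD(1)[where a="enat n"])
  then obtain K where "\<And>k. k \<ge> K \<Longrightarrow> enat n < \<tau> k" by (auto simp: eventually_sequentially)
  then have "max 1 K \<in> {k. 1 \<le> k \<and> enat n < \<tau> k}" by simp
  then have "Inf {k. 1 \<le> k \<and> enat n < \<tau> k} \<in> {k. 1 \<le> k \<and> enat n < \<tau> k}"
    by (intro Inf_nat_def1) blast
  then show "1 \<le> env_index \<tau> n" "enat n < \<tau> (env_index \<tau> n)"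
    unfolding env_index_def by auto
qed

lemma sets_env_law: "sets \<alpha> = sets borel \<Longrightarrow> sets (env_law \<alpha>) = sets env_space"
  unfolding env_law_def by (intro sets_PiM_cong) auto

lemma prob_space_env_law: "prob_space \<alpha> \<Longrightarrow> prob_space (env_law \<alpha>)"
  unfolding env_law_def by (intro prob_space_PiM)

lemma measurable_rwre_quenched:
  assumes "sets \<mu> = sets env_space"
  shows "(\<lambda>\<omega>. rwre_quenched \<omega> x) \<in> \<mu> \<rightarrow>\<^sub>M prob_algebra path_space"
  unfolding rwre_quenched_def
proof (rule measurable_nn_chain)
  show "(\<lambda>\<omega>. \<omega> y) \<in> borel_measurable \<mu>" for y
    unfolding measurable_cong_sets[OF assms refl] by (rule measurable_component_singleton) simp
qed

lemma measurable_rwcre_quenched: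
  assumes \<mu>: "sets \<mu> = sets env_space" and \<tau>: "resampling_map \<tau>"
  shows "(\<lambda>\<omega>s. rwcre_quenched \<omega>s \<tau> x) \<in> (\<Pi>\<^sub>M k\<in>{1..}. \<mu>) \<rightarrow>\<^sub>M prob_algebra path_space"
  unfolding rwcre_quenched_def
proof (rule measurable_nn_chain)
  fix n y
  have "(\<lambda>\<omega>s. \<omega>s (env_index \<tau> n)) \<in> (\<Pi>\<^sub>M k\<in>{1..}. \<mu>) \<rightarrow>\<^sub>M \<mu>"
    using env_index_props(1)[OF \<tau>] by (intro measurable_component_singleton) simp
  moreover have "(\<lambda>\<omega>. \<omega> y) \<in> borel_measurable \<mu>"
    unfolding measurable_cong_sets[OF \<mu> refl] by (rule measurable_component_singleton) simp
  ultimately show "(\<lambda>\<omega>s. \<omega>s (env_index \<tau> n) y) \<in> borel_measurable (\<Pi>\<^sub>M k\<in>{1..}. \<mu>)"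
    by (rule measurable_compose)
qed

lemma
  assumes \<mu>: "prob_space \<mu>" "sets \<mu> = sets env_space"
  shows sets_rwre_annealed: "sets (rwre_annealed \<mu> x) = sets path_space"
    and prob_space_rwre_annealed: "prob_space (rwre_annealed \<mu> x)"
    and emeasure_rwre_annealed: "A \<in> sets path_space \<Longrightarrow>
      emeasure (rwre_annealed \<mu> x) A = (\<integral>\<^sup>+\<omega>. emeasure (rwre_quenched \<omega> x) A \<partial>\<mu>)"
proof -
  interpret prob_space \<mu> by fact
  note m = measurable_prob_algebraD[OF measurable_rwre_quenched[OF \<mu>(2), of x]]
  show "sets (rwre_annealed \<mu> x) = sets path_space"
    unfolding rwre_annealed_def by (rule sets_bind) (simp_all add: rwre_quenched_def not_empty)
  show "prob_space (rwre_annealed \<mu> x)"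
    unfolding rwre_annealed_def
    by (rule prob_space_bind[OF _ m]) (simp add: rwre_quenched_def prob_space_nn_chain)
  show "A \<in> sets path_space \<Longrightarrow>
      emeasure (rwre_annealed \<mu> x) A = (\<integral>\<^sup>+\<omega>. emeasure (rwre_quenched \<omega> x) A \<partial>\<mu>)"
    unfolding rwre_annealed_def by (rule emeasure_bind[OF not_empty m])
qed

lemma
  assumes \<mu>: "prob_space \<mu>" "sets \<mu> = sets env_space" and \<tau>: "resampling_map \<tau>"
  shows sets_rwcre_annealed: "sets (rwcre_annealed \<mu> \<tau> x) = sets path_space"
    and prob_space_rwcre_annealed: "prob_space (rwcre_annealed \<mu> \<tau> x)"
    and emeasure_rwcre_annealed: "A \<in> sets path_space \<Longrightarrow>
      emeasure (rwcre_annealed \<mu> \<tau> x) A =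
        (\<integral>\<^sup>+\<omega>s. emeasure (rwcre_quenched \<omega>s \<tau> x) A \<partial>(\<Pi>\<^sub>M k\<in>{1..}. \<mu>))"
proof -
  interpret prob_space "\<Pi>\<^sub>M k\<in>{1::nat..}. \<mu>" by (intro prob_space_PiM \<mu>)
  note m = measurable_prob_algebraD[OF measurable_rwcre_quenched[OF \<mu>(2) \<tau>, of x]]
  show "sets (rwcre_annealed \<mu> \<tau> x) = sets path_space"
    unfolding rwcre_annealed_def
    by (rule sets_bind[OF _ not_empty]) (simp add: rwcre_quenched_def)
  show "prob_space (rwcre_annealed \<mu> \<tau> x)"
    unfolding rwcre_annealed_def
    by (rule prob_space_bind[OF _ m]) (simp add: rwcre_quenched_def prob_space_nn_chain)
  show "A \<in> sets path_space \<Longrightarrow>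
      emeasure (rwcre_annealed \<mu> \<tau> x) A =
        (\<integral>\<^sup>+\<omega>s. emeasure (rwcre_quenched \<omega>s \<tau> x) A \<partial>(\<Pi>\<^sub>M k\<in>{1..}. \<mu>))"
    unfolding rwcre_annealed_def by (rule emeasure_bind[OF not_empty m])
qed


section \<open>Large deviation principle\<close>

definition log_ereal :: "real \<Rightarrow> ereal" where
  "log_ereal p = (if p = 0 then -\<infinity> else ereal (ln p))"

definition good_rate_function :: "(real \<Rightarrow> ereal) \<Rightarrow> bool" where
  "good_rate_function I \<longleftrightarrow> (\<forall>x. 0 \<le> I x) \<and> (\<exists>x. I x \<noteq> \<infinity>)
     \<and> (\<forall>x. I x \<le> Liminf (at x) I)
     \<and> (\<forall>c::real. compact {x. I x \<le> ereal c})"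

text \<open>The sequence is indexed by \<open>n \<ge> 1\<close>; \<open>M 0\<close> is irrelevant.\<close>
definition satisfies_LDP :: "(nat \<Rightarrow> real measure) \<Rightarrow> (real \<Rightarrow> ereal) \<Rightarrow> bool" where
  "satisfies_LDP M I \<longleftrightarrow>
     (\<forall>n\<ge>1. prob_space (M n) \<and> sets (M n) = sets borel)
     \<and> good_rate_function I
     \<and> (\<forall>C. closed C \<longrightarrow>
           limsup (\<lambda>n. log_ereal (measure (M n) C) / ereal (real n)) \<le> - (INF x\<in>C. I x))
     \<and> (\<forall>U. open U \<longrightarrow>
           - (INF x\<in>U. I x) \<le> liminf (\<lambda>n. log_ereal (measure (M n) U) / ereal (real n)))"

definition strictly_convex :: "(real \<Rightarrow> real) \<Rightarrow> bool" where
  "strictly_convex f \<longleftrightarrow> (\<forall>x y t. x \<noteq> y \<and> 0 < t \<and> t < 1 \<longrightarrow>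
     f ((1 - t) * x + t * y) < (1 - t) * f x + t * f y)"

end

theory Submission
  imports Defs "HOL-Real_Asymp.Real_Asymp"
begin

text \<open>
  At time \<open>n\<close> the cooling walk is a sum of independent displacements of static walks, one for each
  block. The upper bound is Chernoff's inequality plus compactness. As \<open>\<Lambda>\<close> may have kinks, the lower
  bound is not a consequence of the Gaertner-Ellis theorem. If the longest block is \<open>o(n)\<close>, tilt by
  the minimiser of the logarithmic moment generating function at time \<open>n\<close> itself, which is smooth: the
  tilted variance is at most \<open>n\<close> times the longest block. Otherwise some block is macroscopic
  infinitely often, and then \<open>\<Lambda>\<close> equals the limit \<open>G\<close> of the static walk. It remains to
  prove the lower bound for the static walk at every speed, including the kinks of \<open>G\<close>.

  A bridge is a path that stays in \<open>[0, y)\<close> until it hits \<open>y\<close>. Bridges in adjacent intervals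
  are independent under the annealed law, so a long walk contains a sum of many independent bridges of
  bounded duration, to which the tilting argument applies. Splitting a path at its last visit to \<open>0\<close>
  and its first visit to the endpoint shows that bridges to the right and to the left, with exponential
  rates \<open>\<beta>(\<theta>)\<close> and \<open>\<beta>'(-\<theta>)\<close>, have the rate \<open>G(\<theta>)\<close> of the whole walk: the two
  remaining loops cost at most \<open>\<kappa>\<close> per step in every environment, and a bridge can realise
  this rate by waiting in a trap. At the saddle point \<open>ln r\<close> both rates are at most \<open>ln \<kappa>\<close>, hence
  only bridges to the right matter for speeds \<open>x \<ge> 0\<close>.
\<close>

section \<open>Sums of independent blocks\<close>

text \<open>At a kink of \<Lambda> one limiting tilt serves a whole interval of speeds, and laws
  tilted by it need not concentrate at the target. A tilt chosen at finite time makes the tilted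
  mean exactly right and leaves only fluctuations; for independent blocks of lengths T these are of
  order sqrt (sum T^2), which is o(n) as soon as the longest block is. The annealed static walk has
  no such product structure: it returns to sites and so remembers the environment. Consecutive
  bridges read disjoint sets of sites, and the danger is that the restriction to bridges lowers the
  exponential rate. It does not: loops decay at least at rate \<kappa> = 2 sqrt (q (1 - q)), with q
  the point of the convex hull of the support of \<alpha> closest to 1/2, and traps with rates
  arbitrarily close to \<kappa> occur with positive probability on sites that a bridge may use.
  Tilts must range over a compact interval, which requires 0 < |x| < 1, since bridge rates do not
  grow to the left. The speeds 0, 1 and -1 are recovered by moving x slightly, at a cost bounded
  through ellipticity.\<close>

definition conv_pmf :: "int pmf \<Rightarrow> int pmf \<Rightarrow> int pmf" where
  "conv_pmf p q = bind_pmf p (\<lambda>x. map_pmf ((+) x) q)"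

definition mgf :: "int pmf \<Rightarrow> real \<Rightarrow> real" where
  "mgf p \<theta> = measure_pmf.expectation p (\<lambda>y. exp (\<theta> * of_int y))"

text \<open>Lower bounds are stated for closed windows because these combine under convolution:
  centres and radii add.\<close>

abbreviation window :: "int pmf \<Rightarrow> real \<Rightarrow> real \<Rightarrow> real" where
  "window p a w \<equiv> measure (measure_pmf p) {y. \<bar>real_of_int y - a\<bar> \<le> w}"

definition conv_list :: "int pmf list \<Rightarrow> int pmf" where
  "conv_list ps = foldr conv_pmf ps (return_pmf 0)"

lemma conv_list_simps [simp]:
  "conv_list [] = return_pmf 0" "conv_list (p # ps) = conv_pmf p (conv_list ps)"
  by (simp_all add: conv_list_def)

lemma set_conv_pmf: "set_pmf (conv_pmf p q) = (\<Union>x\<in>set_pmf p. (\<lambda>y. x + y) ` set_pmf q)"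
  by (simp add: conv_pmf_def)

lemma plus_comp: "(+) (x + y) = (\<lambda>z. x + (y + z))" for x y :: int
  by (auto simp: add.assoc)

lemma conv_pmf_assoc: "conv_pmf (conv_pmf p q) r = conv_pmf p (conv_pmf q r)"
  by (simp add: conv_pmf_def bind_assoc_pmf bind_map_pmf map_bind_pmf map_pmf_comp add.assoc plus_comp)

lemma conv_pmf_comm: "conv_pmf p q = conv_pmf q p"
  unfolding conv_pmf_def map_pmf_def
  by (subst bind_commute_pmf) (simp add: add.commute)

lemma conv_pmf_left_comm: "conv_pmf p (conv_pmf q r) = conv_pmf q (conv_pmf p r)"
  by (subst conv_pmf_assoc[symmetric], subst conv_pmf_comm[of p q], rule conv_pmf_assoc)

lemma plus_0_id: "(+) (0::int) = (\<lambda>x. x)"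
  by auto

lemma conv_pmf_0 [simp]: "conv_pmf (return_pmf 0) p = p" "conv_pmf p (return_pmf 0) = p"
  by (simp_all add: conv_pmf_def bind_return_pmf pmf.map_ident bind_return_pmf' plus_0_id)

text \<open>Commutativity lets long and short blocks be regrouped, whatever their order in
  time.\<close>

lemma conv_list_partition:
  "conv_list (map f xs) = conv_pmf (conv_list (map f (filter P xs))) (conv_list (map f (filter (\<lambda>x. \<not> P x) xs)))"
proof (induction xs)
  case (Cons x xs)
  show ?case
  proof (cases "P x")
    case False
    then show ?thesis using Cons
      by (simp add: conv_pmf_left_comm)
  qed (simp add: Cons conv_pmf_assoc)
qed simp

text \<open>The bound is the number of steps of a nearest-neighbour walk, so a block length serves
  at once as duration and as range.\<close>

definition bounded_by :: "nat \<Rightarrow> int pmf \<Rightarrow> bool" where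
  "bounded_by n p \<longleftrightarrow> set_pmf p \<subseteq> {- int n..int n}"

lemma bounded_by_finite: "bounded_by n p \<Longrightarrow> finite (set_pmf p)"
  unfolding bounded_by_def by (rule finite_subset) auto

lemma bounded_byD:
  assumes "bounded_by n p" "y \<in> set_pmf p"
  shows "\<bar>real_of_int y\<bar> \<le> real n"
proof -
  have "- int n \<le> y \<and> y \<le> int n" using assms by (auto simp: bounded_by_def)
  then show ?thesis by linarith
qed

lemma bounded_by_conv: "bounded_by m p \<Longrightarrow> bounded_by n q \<Longrightarrow> bounded_by (m + n) (conv_pmf p q)"
  unfolding bounded_by_def set_conv_pmf by fastforce

section \<open>Moment generating functions of laws with bounded support\<close>

lemma mgf_sum: "finite (set_pmf p) \<Longrightarrow> mgf p \<theta> = (\<Sum>y\<in>set_pmf p. pmf p y * exp (\<theta> * of_int y))"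
  unfolding mgf_def by (subst integral_measure_pmf_real[where A="set_pmf p"]) (auto simp: mult.commute)

lemma mgf_conv:
  assumes "finite (set_pmf p)" "finite (set_pmf q)"
  shows "mgf (conv_pmf p q) \<theta> = mgf p \<theta> * mgf q \<theta>"
proof -
  have "mgf (conv_pmf p q) \<theta> = (\<Sum>x\<in>set_pmf p. pmf p x * measure_pmf.expectation (map_pmf ((+) x) q) (\<lambda>y. exp (\<theta> * of_int y)))"
    unfolding mgf_def conv_pmf_def using assms by (subst pmf_expectation_bind[where A="set_pmf p"]) auto
  also have "\<dots> = (\<Sum>x\<in>set_pmf p. pmf p x * exp (\<theta> * of_int x) * mgf q \<theta>)"
    by (intro sum.cong refl) (simp add: mgf_def distrib_left exp_add)
  finally show ?thesis by (simp add: mgf_sum[OF assms(1)] sum_distrib_right)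
qed

lemma mgf_return [simp]: "mgf (return_pmf x) \<theta> = exp (\<theta> * of_int x)"
  by (simp add: mgf_sum)

lemma mgf_pos: "finite (set_pmf p) \<Longrightarrow> mgf p \<theta> > 0"
  by (subst mgf_sum) (auto intro!: sum_pos mult_pos_pos simp: set_pmf_not_empty pmf_positive)

lemma mgf_0 [simp]: "mgf p 0 = 1"
  by (simp add: mgf_def)

lemma mgf_shift:
  assumes b: "bounded_by n p"
  shows "mgf p \<theta>' \<le> exp (\<bar>\<theta>' - \<theta>\<bar> * n) * mgf p \<theta>"
proof -
  note fin = bounded_by_finite[OF b]
  show ?thesis unfolding mgf_sum[OF fin] sum_distrib_left
  proof (rule sum_mono)
    fix y assume "y \<in> set_pmf p"
    then have y: "\<bar>real_of_int y\<bar> \<le> real n" by (rule bounded_byD[OF b])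
    have "(\<theta>' - \<theta>) * real_of_int y \<le> \<bar>\<theta>' - \<theta>\<bar> * \<bar>real_of_int y\<bar>" by (metis abs_le_D1 abs_mult order_refl)
    also have "\<dots> \<le> \<bar>\<theta>' - \<theta>\<bar> * n" using y by (intro mult_left_mono) auto
    finally have "\<theta>' * y \<le> \<bar>\<theta>' - \<theta>\<bar> * n + \<theta> * y" by (simp add: algebra_simps)
    then have "exp (\<theta>' * y) \<le> exp (\<bar>\<theta>' - \<theta>\<bar> * n) * exp (\<theta> * y)" by (simp flip: exp_add)
    then show "pmf p y * exp (\<theta>' * y) \<le> exp (\<bar>\<theta>' - \<theta>\<bar> * n) * (pmf p y * exp (\<theta> * y))"
      using mult_left_mono[OF _ pmf_nonneg[of p y]] by (simp add: mult.left_commute)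
  qed
qed

text \<open>Divided by \<open>n\<close> this is a Lipschitz bound with constant 1, the same for all
  times; it turns pointwise limits of scaled logarithmic moment generating functions into locally
  uniform ones.\<close>

lemma ln_mgf_lipschitz:
  assumes b: "bounded_by n p"
  shows "\<bar>ln (mgf p \<theta>') - ln (mgf p \<theta>)\<bar> \<le> n * \<bar>\<theta>' - \<theta>\<bar>"
proof -
  have *: "ln (mgf p a) \<le> ln (mgf p b) + n * \<bar>a - b\<bar>" for a b :: real
  proof -
    have "ln (mgf p a) \<le> ln (exp (\<bar>a - b\<bar> * n) * mgf p b)"
      using mgf_shift[OF b] mgf_pos[OF bounded_by_finite[OF b]] by (subst ln_le_cancel_iff) auto
    also have "\<dots> = ln (mgf p b) + n * \<bar>a - b\<bar>"
      using mgf_pos[OF bounded_by_finite[OF b], of b] by (subst ln_mult) (auto simp: mult.commute)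
    finally show ?thesis .
  qed
  show ?thesis using *[of \<theta>' \<theta>] *[of \<theta> \<theta>'] by (auto simp: abs_le_iff abs_minus_commute)
qed

lemma exp_le_quadratic: "\<bar>u\<bar> \<le> 1 \<Longrightarrow> exp u \<le> 1 + u + u\<^sup>2" for u :: real
proof (cases "u \<ge> 0")
  case True then show "\<bar>u\<bar> \<le> 1 \<Longrightarrow> exp u \<le> 1 + u + u\<^sup>2" using exp_bound[of u] by simp
next
  case False
  assume u: "\<bar>u\<bar> \<le> 1"
  \<comment> \<open>For negative \<open>u\<close> the upper bound comes from inverting a Taylor
    lower bound at the positive argument \<open>-u\<close>.\<close>
  have "exp (-u) \<ge> 1 - u + u\<^sup>2 / 2" using exp_lower_Taylor_quadratic[of "-u"] False by simp
  then have "exp u * (1 - u + u\<^sup>2 / 2) \<le> exp u * exp (- u)" by (intro mult_left_mono) auto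
  then have "exp u \<le> 1 / (1 - u + u\<^sup>2 / 2)"
    using False by (subst pos_le_divide_eq) (auto simp: add_pos_nonneg exp_minus)
  also have "\<dots> \<le> 1 + u + u\<^sup>2"
  proof -
    have pos: "1 - u + u\<^sup>2 / 2 > 0" using False by (simp add: add_pos_nonneg)
    have "(1 + u + u\<^sup>2) * (1 - u + u\<^sup>2 / 2) = 1 + u\<^sup>2 / 2 * (1 - u + u\<^sup>2)"
      by (simp add: field_simps power2_eq_square)
    moreover have "1 - u + u\<^sup>2 \<ge> 0" using False by (simp add: add_nonneg_nonneg)
    ultimately have "(1 + u + u\<^sup>2) * (1 - u + u\<^sup>2 / 2) \<ge> 1" by simp
    then show ?thesis using pos by (simp add: divide_le_eq)
  qed
  finally show ?thesis .
qed

text \<open>A second-order expansion without derivatives: \<open>m\<close> is the mean of the law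
  tilted by \<theta>, and the last term replaces the tilted second moment by the square of the
  range.\<close>

lemma mgf_quadratic:
  assumes b: "bounded_by n p"
  shows "\<exists>m::real. \<forall>h::real. \<bar>h\<bar> * n \<le> 1 \<longrightarrow> mgf p (\<theta> + h) \<le> mgf p \<theta> * exp (h * m + (h * n)\<^sup>2)"
proof -
  note fin = bounded_by_finite[OF b]
  let ?w = "\<lambda>y. pmf p y * exp (\<theta> * of_int y)"
  define m where "m = (\<Sum>y\<in>set_pmf p. ?w y * y) / mgf p \<theta>"
  have pos: "mgf p \<theta> > 0" by (rule mgf_pos[OF fin])
  have "mgf p (\<theta> + h) \<le> mgf p \<theta> * exp (h * m + (h * n)\<^sup>2)" if h: "\<bar>h\<bar> * n \<le> 1" for h :: real
  proof -
    have "mgf p (\<theta> + h) = (\<Sum>y\<in>set_pmf p. ?w y * exp (h * y))"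
      unfolding mgf_sum[OF fin] by (intro sum.cong refl) (simp add: distrib_right exp_add)
    also have "\<dots> \<le> (\<Sum>y\<in>set_pmf p. ?w y * (1 + h * y + (h * n)\<^sup>2))"
    proof (intro sum_mono mult_left_mono)
      fix y assume "y \<in> set_pmf p"
      then have y: "\<bar>real_of_int y\<bar> \<le> real n" by (rule bounded_byD[OF b])
      have le: "\<bar>h * y\<bar> \<le> \<bar>h * n\<bar>" using y by (simp add: abs_mult mult_left_mono)
      then have "\<bar>h * y\<bar> \<le> 1" using h by (simp add: abs_mult)
      from exp_le_quadratic[OF this] show "exp (h * y) \<le> 1 + h * y + (h * n)\<^sup>2"
        using abs_le_square_iff[THEN iffD1, OF le] by linarith
    qed simp
    also have "\<dots> = mgf p \<theta> * (1 + h * m + (h * n)\<^sup>2)"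
    proof -
      have "(\<Sum>y\<in>set_pmf p. ?w y * (1 + h * y + (h * n)\<^sup>2))
        = (\<Sum>y\<in>set_pmf p. ?w y * (1 + (h * n)\<^sup>2) + h * (?w y * y))"
        by (intro sum.cong refl) (simp add: algebra_simps)
      also have "\<dots> = mgf p \<theta> * (1 + (h * n)\<^sup>2) + h * (\<Sum>y\<in>set_pmf p. ?w y * y)"
        by (simp add: sum.distrib sum_distrib_left sum_distrib_right mgf_sum[OF fin])
      also have "(\<Sum>y\<in>set_pmf p. ?w y * y) = mgf p \<theta> * m" using pos by (simp add: m_def)
      finally show ?thesis by (simp add: algebra_simps)
    qed
    also have "\<dots> \<le> mgf p \<theta> * exp (h * m + (h * n)\<^sup>2)"
      using pos exp_ge_add_one_self[of "h * m + (h * n)\<^sup>2"] by (intro mult_left_mono) (auto simp: algebra_simps)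
    finally show ?thesis .
  qed
  then show ?thesis by blast
qed

section \<open>Tilting a sum of independent blocks\<close>

lemma bounded_by_conv_list:
  fixes rw :: "nat \<Rightarrow> int pmf"
  shows "(\<And>T. T \<in> set Ts \<Longrightarrow> bounded_by T (rw T)) \<Longrightarrow> bounded_by (sum_list Ts) (conv_list (map rw Ts))"
proof (induction Ts)
  case Nil then show ?case by (simp add: bounded_by_def)
next
  case (Cons T Ts)
  then show ?case using bounded_by_conv[of T "rw T"] by simp
qed

lemma mgf_conv_list:
  fixes rw :: "nat \<Rightarrow> int pmf"
  assumes "\<And>T. T \<in> set Ts \<Longrightarrow> bounded_by T (rw T)"
  shows "ln (mgf (conv_list (map rw Ts)) \<theta>) = (\<Sum>T\<leftarrow>Ts. ln (mgf (rw T) \<theta>))"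
  using assms
proof (induction Ts)
  case (Cons T Ts)
  have b: "bounded_by T (rw T)" "bounded_by (sum_list Ts) (conv_list (map rw Ts))"
    using Cons.prems by (auto intro!: bounded_by_conv_list)
  note f = b[THEN bounded_by_finite]
  show ?case using Cons mgf_pos[OF f(1), of \<theta>] mgf_pos[OF f(2), of \<theta>]
    by (simp add: mgf_conv f ln_mult)
qed simp

text \<open>Exponential Chebyshev bounds on both sides, with parameters \<open>h\<close> and
  \<open>-h\<close>, show that the tilted law gives the window all but a fraction
  \<open>2 * exp (v - h * w)\<close> of its mass. Inside the window \<theta> y differs from \<theta>
  a by at most |\<theta>| w, which bounds the price of undoing the tilt.\<close>

lemma tilting_concentration:
  assumes b: "bounded_by k p" and h: "0 < h" and w: "0 < w"
    and quad: "\<And>s. s \<in> {h, -h} \<Longrightarrow> mgf p (\<theta> + s) \<le> mgf p \<theta> * exp (s * a + v)"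
  shows "window p a w \<ge> mgf p \<theta> * exp (- \<theta> * a - \<bar>\<theta>\<bar> * w) * (1 - 2 * exp (v - h * w))"
proof -
  note fin = bounded_by_finite[OF b]
  let ?S = "set_pmf p"
  let ?W = "\<lambda>y. pmf p y * exp (\<theta> * of_int y)"
  let ?D = "{y \<in> ?S. \<bar>of_int y - a\<bar> \<le> w}"
  \<comment> \<open>Left or right of the window, one of the two exponential terms already dominates
    the tilted weight.\<close>
  have tail: "?W y \<le> (if y \<in> ?D then ?W y else 0) + pmf p y * exp ((\<theta> + h) * y) * exp (- h * (a + w))
      + pmf p y * exp ((\<theta> - h) * y) * exp (h * (a - w))" if y: "y \<in> ?S" for y
  proof -
    consider "y \<in> ?D" | "of_int y - a > w" | "of_int y - a < - w" using y by (force simp: abs_le_iff)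
    then show ?thesis
    proof cases
      case 2
      have "h * w \<le> h * (y - a)" using 2 h by (intro mult_left_mono) auto
      then have "exp (\<theta> * y) \<le> exp ((\<theta> + h) * y) * exp (- h * (a + w))" by (simp add: algebra_simps flip: exp_add)
      then have "?W y \<le> pmf p y * exp ((\<theta> + h) * y) * exp (- h * (a + w))"
        using mult_left_mono[OF _ pmf_nonneg[of p y]] by (simp add: mult.assoc)
      then show ?thesis using 2 w by (auto intro!: add_increasing2)
    next
      case 3
      have "h * w \<le> h * (a - y)" using 3 h by (intro mult_left_mono) auto
      then have "exp (\<theta> * y) \<le> exp ((\<theta> - h) * y) * exp (h * (a - w))" by (simp add: algebra_simps flip: exp_add)
      then have "?W y \<le> pmf p y * exp ((\<theta> - h) * y) * exp (h * (a - w))"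
        using mult_left_mono[OF _ pmf_nonneg[of p y]] by (simp add: mult.assoc)
      then show ?thesis using 3 w by (auto intro!: add_increasing)
    qed (auto intro!: add_nonneg_nonneg)
  qed
  have "mgf p \<theta> \<le> (\<Sum>y\<in>?S. (if y \<in> ?D then ?W y else 0) + pmf p y * exp ((\<theta> + h) * y) * exp (- h * (a + w))
      + pmf p y * exp ((\<theta> - h) * y) * exp (h * (a - w)))"
    unfolding mgf_sum[OF fin] by (intro sum_mono tail)
  also have "\<dots> = (\<Sum>y\<in>?D. ?W y) + mgf p (\<theta> + h) * exp (- h * (a + w)) + mgf p (\<theta> - h) * exp (h * (a - w))"
    unfolding sum.distrib mgf_sum[OF fin] sum_distrib_right by (simp add: sum.inter_filter fin)
  also have "mgf p (\<theta> + h) * exp (- h * (a + w)) \<le> mgf p \<theta> * exp (h * a + v) * exp (- h * (a + w))"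
    using quad[of h] by (intro mult_right_mono) auto
  also have "\<dots> = mgf p \<theta> * exp (v - h * w)" by (simp add: mult.assoc algebra_simps flip: exp_add)
  also have "mgf p (\<theta> - h) * exp (h * (a - w)) \<le> mgf p \<theta> * exp (- h * a + v) * exp (h * (a - w))"
    using quad[of "-h"] by (intro mult_right_mono) auto
  also have "\<dots> = mgf p \<theta> * exp (v - h * w)" by (simp add: mult.assoc algebra_simps flip: exp_add)
  also have "(\<Sum>y\<in>?D. ?W y) \<le> (\<Sum>y\<in>?D. pmf p y * exp (\<theta> * a + \<bar>\<theta>\<bar> * w))"
  proof (intro sum_mono mult_left_mono)
    fix y assume "y \<in> ?D"
    then have "\<bar>\<theta>\<bar> * \<bar>of_int y - a\<bar> \<le> \<bar>\<theta>\<bar> * w" by (intro mult_left_mono) auto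
    then have "\<theta> * (of_int y - a) \<le> \<bar>\<theta>\<bar> * w" by (metis abs_le_D1 abs_mult)
    then show "exp (\<theta> * y) \<le> exp (\<theta> * a + \<bar>\<theta>\<bar> * w)" by (simp add: algebra_simps)
  qed simp
  also have "\<dots> = window p a w * exp (\<theta> * a + \<bar>\<theta>\<bar> * w)"
  proof -
    have "window p a w = measure p ?D"
      by (subst measure_Int_set_pmf[symmetric]) (rule arg_cong[where f="measure p"], auto)
    also have "\<dots> = (\<Sum>y\<in>?D. pmf p y)" using fin by (intro measure_measure_pmf_finite) auto
    finally show ?thesis by (simp add: sum_distrib_right)
  qed
  finally have "mgf p \<theta> * (1 - 2 * exp (v - h * w)) \<le> window p a w * exp (\<theta> * a + \<bar>\<theta>\<bar> * w)"
    by (simp add: algebra_simps)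
  then have "mgf p \<theta> * (1 - 2 * exp (v - h * w)) * exp (- (\<theta> * a + \<bar>\<theta>\<bar> * w))
     \<le> window p a w * exp (\<theta> * a + \<bar>\<theta>\<bar> * w) * exp (- (\<theta> * a + \<bar>\<theta>\<bar> * w))"
    by (intro mult_right_mono) auto
  also have "\<dots> = window p a w" by (simp add: mult.assoc flip: exp_add)
  finally show ?thesis by (simp add: mult_ac)
qed

text \<open>The quadratic errors of independent blocks add up, and each T^2 is at most M T. Treating
  the sum as one bounded law would give the square of the total length instead.\<close>

lemma mgf_conv_list_quadratic:
  fixes rw :: "nat \<Rightarrow> int pmf" and M :: nat
  assumes "\<And>T. T \<in> set Ts \<Longrightarrow> bounded_by T (rw T)" "\<And>T. T \<in> set Ts \<Longrightarrow> T \<le> M" "M \<ge> 1"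
  shows "\<exists>m::real. \<forall>h::real. \<bar>h\<bar> * M \<le> 1 \<longrightarrow> ln (mgf (conv_list (map rw Ts)) (\<theta> + h))
     \<le> ln (mgf (conv_list (map rw Ts)) \<theta>) + h * m + h\<^sup>2 * M * real (sum_list Ts)"
  using assms(1,2)
proof (induction Ts)
  case (Cons T Ts)
  obtain m :: real where m: "\<And>h :: real. \<bar>h\<bar> * M \<le> 1 \<Longrightarrow> ln (mgf (conv_list (map rw Ts)) (\<theta> + h))
     \<le> ln (mgf (conv_list (map rw Ts)) \<theta>) + h * m + h\<^sup>2 * M * real (sum_list Ts)"
    using Cons.IH Cons.prems by (metis list.set_intros(2))
  have b: "bounded_by T (rw T)" "bounded_by (sum_list Ts) (conv_list (map rw Ts))"
    using Cons.prems by (auto intro!: bounded_by_conv_list)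
  note f = b[THEN bounded_by_finite]
  obtain m' :: real where m': "\<And>h :: real. \<bar>h\<bar> * T \<le> 1 \<Longrightarrow> mgf (rw T) (\<theta> + h) \<le> mgf (rw T) \<theta> * exp (h * m' + (h * T)\<^sup>2)"
    using mgf_quadratic[OF b(1)] by blast
  have ln_c: "ln (mgf (conv_list (map rw (T # Ts))) t) = ln (mgf (rw T) t) + ln (mgf (conv_list (map rw Ts)) t)" for t
    using mgf_pos[OF f(1), of t] mgf_pos[OF f(2), of t] by (simp add: mgf_conv f ln_mult)
  show ?case
  proof (intro exI[of _ "m' + m"] allI impI)
    fix h :: real assume h: "\<bar>h\<bar> * M \<le> 1"
    have TM: "T \<le> M" using Cons.prems by simp
    have "\<bar>h\<bar> * T \<le> \<bar>h\<bar> * M" using TM by (intro mult_left_mono) auto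
    then have "ln (mgf (rw T) (\<theta> + h)) \<le> ln (mgf (rw T) \<theta> * exp (h * m' + (h * T)\<^sup>2))"
      using m'[of h] h mgf_pos[OF f(1)] by (subst ln_le_cancel_iff) auto
    also have "\<dots> = ln (mgf (rw T) \<theta>) + h * m' + (h * T)\<^sup>2"
      using mgf_pos[OF f(1), of \<theta>] by (simp add: ln_mult)
    also have "(h * T)\<^sup>2 \<le> h\<^sup>2 * M * T"
    proof -
      have "h\<^sup>2 * T * T \<le> h\<^sup>2 * T * M" using TM by (intro mult_left_mono) auto
      then show ?thesis by (simp add: power_mult_distrib power2_eq_square mult_ac)
    qed
    finally show "ln (mgf (conv_list (map rw (T # Ts))) (\<theta> + h))
     \<le> ln (mgf (conv_list (map rw (T # Ts))) \<theta>) + h * (m' + m) + h\<^sup>2 * M * real (sum_list (T # Ts))"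
      using m[OF h] unfolding ln_c by (simp add: algebra_simps)
  qed
qed (auto intro!: exI[of _ 0])

text \<open>The tilt is a minimiser of the convex function \<open>\<Phi>(\<theta>) - a \<theta>\<close>, so the tilted mean is \<open>a\<close>; the
  quadratic bound on \<open>\<Phi>\<close> is of order \<open>M n\<close> instead of \<open>n\<^sup>2\<close> because the blocks are short.\<close>
lemma short_blocks_lower_bound:
  fixes rw :: "nat \<Rightarrow> int pmf" and Ts :: "nat list" and M n :: nat and a w R J :: real and \<Phi> :: "real \<Rightarrow> real"
  assumes rw: "\<And>T. T \<in> set Ts \<Longrightarrow> bounded_by T (rw T)" and M: "\<And>T. T \<in> set Ts \<Longrightarrow> T \<le> M" "M \<ge> 1"
    and n: "sum_list Ts \<le> n"
  defines "\<Phi> \<equiv> \<lambda>\<theta>::real. ln (mgf (conv_list (map rw Ts)) \<theta>)"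
  assumes R: "R > 0" "\<Phi> R - a * R > 0" "\<Phi> (- R) + a * R > 0"
    and J: "\<And>\<theta>. \<bar>\<theta>\<bar> \<le> R \<Longrightarrow> \<Phi> \<theta> - a * \<theta> \<ge> - J"
    and w: "0 < w" "w \<le> 2 * real n" "w\<^sup>2 \<ge> 8 * real M * real n"
  shows "window (conv_list (map rw Ts)) a w \<ge> exp (- J - R * w) / 2"
proof -
  let ?p = "conv_list (map rw Ts)"
  have b: "bounded_by (sum_list Ts) ?p" by (rule bounded_by_conv_list[OF rw])
  have pos: "mgf ?p \<theta> > 0" for \<theta> by (rule mgf_pos[OF bounded_by_finite[OF b]])
  have cont: "continuous_on {-R..R} (\<lambda>\<theta>::real. \<Phi> \<theta> - a * \<theta>)"
  proof -
    have "lipschitz_on (real (sum_list Ts)) {-R..R} \<Phi>"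
      unfolding \<Phi>_def using ln_mgf_lipschitz[OF b] by (intro lipschitz_onI) (auto simp: dist_real_def)
    then show ?thesis by (intro continuous_intros lipschitz_on_continuous_on)
  qed
  obtain \<theta> where \<theta>: "\<theta> \<in> {-R..R}" and min: "\<And>t. t \<in> {-R..R} \<Longrightarrow> \<Phi> \<theta> - a * \<theta> \<le> \<Phi> t - a * t"
    using continuous_attains_inf[OF _ _ cont] R(1) by fastforce
  \<comment> \<open>The value at 0 is 0 while both ends have positive values, so the minimiser is
    interior and can be perturbed in both directions.\<close>
  have "\<Phi> \<theta> - a * \<theta> \<le> 0" using min[of 0] R(1) by (simp add: \<Phi>_def)
  then have int: "-R < \<theta>" "\<theta> < R" using R \<theta> by (auto simp: less_le)
  obtain m :: real where m: "\<And>h :: real. \<bar>h\<bar> * M \<le> 1 \<Longrightarrow> \<Phi> (\<theta> + h) \<le> \<Phi> \<theta> + h * m + h\<^sup>2 * real M * real (sum_list Ts)"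
    using mgf_conv_list_quadratic[OF rw M, where \<theta>=\<theta>] unfolding \<Phi>_def by blast
  define V where "V = real M * real (sum_list Ts)"
  have V: "V \<ge> 0" "V \<le> M * n" using n unfolding V_def using mult_left_mono[OF of_nat_mono[OF n, where 'a=real], of "real M"] by auto
  \<comment> \<open>First-order condition at the minimiser: if \<open>m\<close> differed from
    \<open>a\<close>, a small step with sign opposite to \<open>m - a\<close> would lower the
    minimum.\<close>
  have "m = a"
  proof (rule ccontr)
    assume "m \<noteq> a"
    define d where "d = m - a"
    \<comment> \<open>The step stays in the interval and in the range of the quadratic bound, and by
      the last entry its linear gain e |d| exceeds its quadratic loss e^2 V.\<close>
    define e where "e = Min {1 / M, R - \<theta>, R + \<theta>, \<bar>d\<bar> / (2 * (V + 1))}"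
    have e: "e > 0" "e \<le> 1 / M" "e \<le> R - \<theta>" "e \<le> R + \<theta>" "e \<le> \<bar>d\<bar> / (2 * (V + 1))"
      using int M(2) V \<open>m \<noteq> a\<close> by (auto simp: e_def d_def)
    define h where "h = - sgn d * e"
    have hd: "h * d = - e * \<bar>d\<bar>" by (simp add: h_def abs_sgn mult_ac)
    have ah: "\<bar>h\<bar> = e" using \<open>m \<noteq> a\<close> e(1) by (simp add: h_def abs_mult d_def abs_sgn_eq)
    have "\<bar>h\<bar> * M \<le> 1" using e(2) M(2) ah by (simp add: field_simps)
    from m[OF this] have "\<Phi> (\<theta> + h) \<le> \<Phi> \<theta> + h * m + h\<^sup>2 * V" by (simp add: V_def mult.assoc)
    moreover have "\<theta> + h \<in> {-R..R}" using e ah by auto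
    ultimately have "0 \<le> h * d + h\<^sup>2 * V" using min[of "\<theta> + h"] by (simp add: d_def algebra_simps)
    also have "h\<^sup>2 = e\<^sup>2" by (metis ah power2_abs)
    finally have "e * \<bar>d\<bar> \<le> e * (e * V)" by (simp add: hd power2_eq_square)
    then have "\<bar>d\<bar> \<le> e * V" using e(1) by simp
    also have "\<dots> \<le> \<bar>d\<bar> / (2 * (V + 1)) * V" using e V by (intro mult_right_mono)
    also have "\<dots> < \<bar>d\<bar>" using V \<open>m \<noteq> a\<close> by (simp add: d_def divide_less_eq)
    finally show False by simp
  qed
  \<comment> \<open>This \<open>h\<close> minimises h^2 M n - h w, with value - w^2 / (4 M n) <= -2.
    The bound w <= 2 n keeps h M <= 1, and exp (-2) <= 1/4 leaves half of the tilted mass in the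
    window.\<close>
  define h where "h = w / (2 * M * n)"
  have n0: "n > 0" using w(1,2) by (cases n) auto
  have h: "h > 0" "h * M \<le> 1" using w n0 M(2) by (auto simp: h_def field_simps)
  have quad: "mgf ?p (\<theta> + s) \<le> mgf ?p \<theta> * exp (s * a + h\<^sup>2 * V)" if "s \<in> {h, -h}" for s
  proof -
    have "\<bar>s\<bar> * M \<le> 1" "s\<^sup>2 = h\<^sup>2" using that h by auto
    from m[OF this(1)] this(2) have "\<Phi> (\<theta> + s) \<le> \<Phi> \<theta> + (s * a + h\<^sup>2 * V)"
      by (simp add: V_def mult.assoc \<open>m = a\<close>)
    then have "exp (\<Phi> (\<theta> + s)) \<le> exp (\<Phi> \<theta>) * exp (s * a + h\<^sup>2 * V)" by (simp flip: exp_add)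
    then show ?thesis using pos by (simp add: \<Phi>_def)
  qed
  have "exp (h\<^sup>2 * V - h * w) \<le> 1 / 4"
  proof -
    have "h\<^sup>2 * V - h * w \<le> h\<^sup>2 * (M * n) - h * w" using V by (simp add: mult_left_mono)
    also have "\<dots> = - (w\<^sup>2 / (4 * M * n))" using n0 M(2) by (simp add: h_def field_simps power2_eq_square)
    also have "\<dots> \<le> - 2" using w(3) n0 M(2) by (simp add: field_simps)
    finally have "exp (h\<^sup>2 * V - h * w) \<le> exp (-2)" by simp
    also have "\<dots> \<le> 1 / 4"
    proof -
      have "exp (2::real) = exp 1 * exp 1" by (simp flip: exp_add)
      also have "\<dots> \<ge> 2 * 2" using exp_ge_add_one_self[of 1] by (intro mult_mono) auto
      finally show ?thesis by (simp add: exp_minus field_simps)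
    qed
    finally show ?thesis .
  qed
  then have "mgf ?p \<theta> * exp (- \<theta> * a - \<bar>\<theta>\<bar> * w) * (1 / 2)
     \<le> mgf ?p \<theta> * exp (- \<theta> * a - \<bar>\<theta>\<bar> * w) * (1 - 2 * exp (h\<^sup>2 * V - h * w))"
    using pos[of \<theta>] by (intro mult_left_mono) auto
  also have "\<dots> \<le> measure ?p {y. \<bar>of_int y - a\<bar> \<le> w}"
    by (rule tilting_concentration[OF b h(1) w(1) quad])
  also have "mgf ?p \<theta> * exp (- \<theta> * a - \<bar>\<theta>\<bar> * w) = exp (\<Phi> \<theta> - a * \<theta> - \<bar>\<theta>\<bar> * w)"
    using pos[of \<theta>] by (simp add: \<Phi>_def exp_diff exp_minus exp_add field_simps)
  finally have *: "exp (\<Phi> \<theta> - a * \<theta> - \<bar>\<theta>\<bar> * w) * (1 / 2) \<le> measure ?p {y. \<bar>of_int y - a\<bar> \<le> w}" .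
  have "- J - R * w \<le> \<Phi> \<theta> - a * \<theta> - \<bar>\<theta>\<bar> * w"
  proof -
    have "\<bar>\<theta>\<bar> \<le> R" using \<theta> by auto
    then show ?thesis using J[of \<theta>] w(1) mult_right_mono[of "\<bar>\<theta>\<bar>" R w] by linarith
  qed
  then have "exp (- J - R * w) \<le> exp (\<Phi> \<theta> - a * \<theta> - \<bar>\<theta>\<bar> * w)" by simp
  then show ?thesis using * by linarith
qed

section \<open>Combining long and short blocks\<close>

lemma conv_pmf_eq_pair: "conv_pmf p q = map_pmf (\<lambda>(x, y). x + y) (pair_pmf p q)"
  by (simp add: conv_pmf_def pair_pmf_def map_bind_pmf bind_map_pmf map_pmf_def bind_assoc_pmf bind_return_pmf)

lemma measure_conv_pmf_ge:
  "window p a v * window q b w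
    \<le> window (conv_pmf p q) (a + b) (v + w)" for a b v w :: real
proof -
  have "window p a v * window q b w
     = measure (measure_pmf (pair_pmf p q)) ({y. \<bar>of_int y - a\<bar> \<le> v} \<times> {y. \<bar>of_int y - b\<bar> \<le> w})"
    by (subst measure_pmf_prob_product) auto
  also have "\<dots> \<le> measure (measure_pmf (pair_pmf p q)) ((\<lambda>(x, y). x + y) -` {y. \<bar>of_int y - (a + b)\<bar> \<le> v + w})"
    by (intro measure_pmf.finite_measure_mono) (auto simp: abs_le_iff)
  finally show ?thesis by (simp add: conv_pmf_eq_pair)
qed

text \<open>Each long block is asked to keep speed \<open>x\<close> by itself; costs, centres and
  radii are all proportional to duration and therefore add.\<close>

lemma long_blocks_lower_bound:
  fixes rw :: "nat \<Rightarrow> int pmf" and x \<delta> K :: real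
  assumes "\<And>T. T \<in> set Ts \<Longrightarrow> exp (- K * real T) \<le> window (rw T) (x * real T) (\<delta> * real T)"
  shows "exp (- K * real (sum_list Ts))
    \<le> window (conv_list (map rw Ts)) (x * real (sum_list Ts)) (\<delta> * real (sum_list Ts))"
  using assms
proof (induction Ts)
  case (Cons T Ts)
  have "exp (- K * real (sum_list (T # Ts))) = exp (- K * real T) * exp (- K * real (sum_list Ts))"
    by (simp add: algebra_simps flip: exp_add)
  also have "\<dots> \<le> window (rw T) (x * real T) (\<delta> * real T) *
     window (conv_list (map rw Ts)) (x * real (sum_list Ts)) (\<delta> * real (sum_list Ts))"
    using Cons by (intro mult_mono) auto
  also have "\<dots> \<le> window (conv_pmf (rw T) (conv_list (map rw Ts))) (x * real T + x * real (sum_list Ts)) (\<delta> * real T + \<delta> * real (sum_list Ts))"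
    by (rule measure_conv_pmf_ge)
  finally show ?case by (simp add: distrib_left)
qed simp

text \<open>Uniformity is required because the tilting parameter is a minimiser that depends on n.
  The common Lipschitz constant reduces the interval to a finite net.\<close>

lemma lipschitz_pointwise_limit_uniform:
  fixes f :: "nat \<Rightarrow> real \<Rightarrow> real"
  assumes lip: "\<And>n a b. \<bar>f n a - f n b\<bar> \<le> \<bar>a - b\<bar>" and lim: "\<And>\<theta>. (\<lambda>n. f n \<theta>) \<longlonglongrightarrow> g \<theta>" and e: "e > 0"
  shows "\<forall>\<^sub>F n in sequentially. \<forall>\<theta>. \<bar>\<theta>\<bar> \<le> R \<longrightarrow> \<bar>f n \<theta> - g \<theta>\<bar> \<le> e"
proof -
  have lipg: "\<bar>g a - g b\<bar> \<le> \<bar>a - b\<bar>" for a b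
    using lip by (intro tendsto_upperbound[OF tendsto_rabs[OF tendsto_diff[OF lim lim]]]) auto
  obtain K where K: "finite K" "{-R..R} \<subseteq> (\<Union>x\<in>K. ball x (e / 3))"
    using compact_Icc[of "-R" R] e unfolding compact_eq_totally_bounded by (meson divide_pos_pos zero_less_numeral)
  have "\<forall>\<^sub>F n in sequentially. \<forall>k\<in>K. dist (f n k) (g k) < e / 3"
    by (rule eventually_ball_finite[OF K(1)], rule ballI, rule tendstoD[OF lim], use e in simp)
  then show ?thesis
  proof eventually_elim
    case (elim n)
    show ?case
    proof (intro allI impI)
      fix \<theta> :: real assume "\<bar>\<theta>\<bar> \<le> R"
      then have "\<theta> \<in> {-R..R}" by auto
      then have "\<theta> \<in> (\<Union>x\<in>K. ball x (e / 3))" using K(2) by blast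
      then obtain k where "k \<in> K" "\<bar>k - \<theta>\<bar> < e / 3" by (auto simp: dist_real_def)
      then have "\<bar>f n k - g k\<bar> < e / 3" using elim by (simp add: dist_real_def)
      then show "\<bar>f n \<theta> - g \<theta>\<bar> \<le> e"
        using \<open>\<bar>k - \<theta>\<bar> < e / 3\<close> lip[of n k \<theta>] lipg[of k \<theta>] by linarith
    qed
  qed
qed

lemma scaled_ln_mgf_lipschitz:
  assumes "bounded_by n p"
  shows "\<bar>ln (mgf p a) / n - ln (mgf p b) / n\<bar> \<le> \<bar>a - b\<bar>"
  using ln_mgf_lipschitz[OF assms, of a b] by (cases "n = 0") (simp_all add: field_simps flip: diff_divide_distrib)

text \<open>Blocks longer than \<open>M\<close> keep speed \<open>x\<close> individually, the others
  do so jointly by one tilt, and each group uses half of the window. The short group needs only a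
  lower bound on its logarithmic moment generating function, with an error 2 \<eta> n relative to
  the full time.\<close>

lemma mixed_blocks_lower_bound:
  fixes rw :: "nat \<Rightarrow> int pmf" and Ts :: "nat list" and M n :: nat and x R J \<delta> \<eta> c :: real and \<Lambda> :: "real \<Rightarrow> real"
  assumes rw: "\<And>T. bounded_by T (rw T)" and elliptic: "\<And>T \<theta>. ln (mgf (rw T) \<theta>) \<ge> T * (\<bar>\<theta>\<bar> + ln c)"
    and Ts: "sum_list Ts = n" "\<And>T. T \<in> set Ts \<Longrightarrow> T > 0"
    and M: "M \<ge> 1" "8 * real M * real n \<le> (\<delta> * real n)\<^sup>2" and n: "n > 0"
    and long: "\<And>T. T \<in> set Ts \<Longrightarrow> T > M \<Longrightarrow>
       exp (- (J + \<eta>) * real T) \<le> window (rw T) (x * real T) (\<delta> * real T)"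
    and short: "\<And>\<theta>. \<bar>\<theta>\<bar> \<le> R \<Longrightarrow>
       (\<Sum>T\<leftarrow>filter (\<lambda>T. \<not> T > M) Ts. ln (mgf (rw T) \<theta>)) \<ge> real (sum_list (filter (\<lambda>T. \<not> T > M) Ts)) * \<Lambda> \<theta> - 2 * \<eta> * real n"
    and J: "\<And>\<theta>. x * \<theta> - \<Lambda> \<theta> \<le> J" "J \<ge> 0" and R: "(1 - \<bar>x\<bar>) * R + ln c > 0" "R > 0"
    and \<delta>: "0 < \<delta>" "\<delta> \<le> 2" and \<eta>: "\<eta> > 0"
  shows "window (conv_list (map rw Ts)) (x * real n) (2 * \<delta> * real n)
     \<ge> exp (- (J + 3 * \<eta> + R * \<delta>) * real n) / 2"
proof -
  define L where "L = filter (\<lambda>T. T > M) Ts"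
  define S where "S = filter (\<lambda>T. \<not> T > M) Ts"
  define l where "l = real (sum_list L)"
  define s where "s = real (sum_list S)"
  have "sum_list L + sum_list S = sum_list Ts" unfolding L_def S_def by (induction Ts) auto
  then have ls: "l + s = n" unfolding l_def s_def Ts(1)[symmetric] by linarith
  have ls0: "l \<ge> 0" "s \<ge> 0" by (auto simp: l_def s_def)
  have 1: "exp (- (J + \<eta>) * l) \<le> window (conv_list (map rw L)) (x * l) (\<delta> * l)"
    unfolding l_def by (rule long_blocks_lower_bound, rule long) (auto simp: L_def)
  \<comment> \<open>The radius is proportional to n and not to s: the short blocks may have small
    total length, and then a radius \<delta> s could be too narrow for the fluctuations allowed by
    \<open>M\<close>. The tilting lemma needs s > 0, hence the separate empty case.\<close>
  have 2: "exp (- (s * J + 2 * \<eta> * n) - R * (\<delta> * n)) / 2 \<le> window (conv_list (map rw S)) (x * s) (\<delta> * n)"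
  proof (cases "S = []")
    case True
    then have "window (conv_list (map rw S)) (x * s) (\<delta> * n) = 1"
      using \<delta> by (simp add: s_def)
    moreover have "exp (- (s * J + 2 * \<eta> * n) - R * (\<delta> * n)) \<le> 1"
    proof -
      have "0 \<le> s * J" "0 \<le> \<eta> * n" "0 \<le> R * (\<delta> * n)" using R \<delta> \<eta> J(2) ls0 by auto
      then show ?thesis unfolding exp_le_one_iff by linarith
    qed
    ultimately show ?thesis by linarith
  next
    case False
    then obtain T where "T \<in> set S" by (cases S) auto
    then have "s > 0" using Ts(2)[of T] member_le_sum_list[of T S] by (auto simp: S_def s_def)
    have mgfS: "ln (mgf (conv_list (map rw S)) \<theta>) = (\<Sum>T\<leftarrow>S. ln (mgf (rw T) \<theta>))" for \<theta>
      by (rule mgf_conv_list[OF rw])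
    have ellS: "(\<Sum>T\<leftarrow>S. ln (mgf (rw T) \<theta>)) \<ge> s * (\<bar>\<theta>\<bar> + ln c)" for \<theta>
    proof -
      have "(\<Sum>T\<leftarrow>S. ln (mgf (rw T) \<theta>)) \<ge> (\<Sum>T\<leftarrow>S. real T * (\<bar>\<theta>\<bar> + ln c))"
        by (intro sum_list_mono elliptic)
      then show ?thesis by (simp add: s_def sum_list_mult_const sum_list_of_nat)
    qed
    have xR: "\<bar>x * R\<bar> = \<bar>x\<bar> * R" using R by (simp add: abs_mult)
    \<comment> \<open>Ellipticity makes the exponent positive at R and -R for every collection of
      short blocks, so the minimiser stays in a range independent of n.\<close>
    have pos: "R + ln c - \<bar>x\<bar> * R > 0" using R by (simp add: algebra_simps)
    show ?thesis
    proof (rule short_blocks_lower_bound[where M=M and n=n])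
      show "ln (mgf (conv_list (map rw S)) R) - x * s * R > 0"
      proof -
        have "0 < s * (R + ln c - \<bar>x\<bar> * R)" using pos \<open>s > 0\<close> by simp
        also have "\<dots> \<le> s * (R + ln c - x * R)" using xR ls0 by (intro mult_left_mono) auto
        finally show ?thesis using ellS[of R] R(2) by (simp add: mgfS algebra_simps)
      qed
      show "ln (mgf (conv_list (map rw S)) (-R)) + x * s * R > 0"
      proof -
        have "0 < s * (R + ln c - \<bar>x\<bar> * R)" using pos \<open>s > 0\<close> by simp
        also have "\<dots> \<le> s * (R + ln c + x * R)" using xR ls0 by (intro mult_left_mono) auto
        finally show ?thesis using ellS[of "-R"] R(2) by (simp add: mgfS algebra_simps)
      qed
      show "ln (mgf (conv_list (map rw S)) \<theta>) - x * s * \<theta> \<ge> - (s * J + 2 * \<eta> * n)" if "\<bar>\<theta>\<bar> \<le> R" for \<theta>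
      proof -
        have "s * (x * \<theta> - \<Lambda> \<theta>) \<le> s * J" using J(1) ls0 by (intro mult_left_mono)
        then show ?thesis using short[OF that] by (simp add: mgfS S_def[symmetric] s_def[symmetric] algebra_simps)
      qed
      show "sum_list S \<le> n" using ls ls0 by (simp add: s_def)
      show "8 * real M * real n \<le> (\<delta> * n)\<^sup>2" by (rule M)
    qed (use rw M \<delta> R n in \<open>auto simp: S_def\<close>)
  qed
  have "exp (- (J + 3 * \<eta> + R * \<delta>) * n) / 2 \<le> exp (- (J + \<eta>) * l) * (exp (- (s * J + 2 * \<eta> * n) - R * (\<delta> * n)) / 2)"
  proof -
    have "\<eta> * l \<le> \<eta> * n" using ls ls0 \<eta> by (intro mult_left_mono) auto
    moreover have "(J + 3 * \<eta> + R * \<delta>) * n = J * l + J * s + 3 * \<eta> * n + R * (\<delta> * n)"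
      unfolding ls[symmetric] by (simp add: algebra_simps)
    ultimately have "- (J + 3 * \<eta> + R * \<delta>) * n \<le> - (J + \<eta>) * l + (- (s * J + 2 * \<eta> * n) - R * (\<delta> * n))"
      by (simp add: algebra_simps)
    then show ?thesis by (simp flip: exp_add)
  qed
  also have "\<dots> \<le> window (conv_list (map rw L)) (x * l) (\<delta> * l) *
      window (conv_list (map rw S)) (x * s) (\<delta> * n)"
    using 1 2 by (intro mult_mono) auto
  also have "\<dots> \<le> window (conv_pmf (conv_list (map rw L)) (conv_list (map rw S))) (x * l + x * s) (\<delta> * l + \<delta> * n)"
    by (rule measure_conv_pmf_ge)
  also have "conv_pmf (conv_list (map rw L)) (conv_list (map rw S)) = conv_list (map rw Ts)"
    unfolding L_def S_def by (rule conv_list_partition[symmetric])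
  also have "x * l + x * s = x * n" by (simp add: ls[symmetric] distrib_left)
  also have "window (conv_list (map rw Ts)) (x * n) (\<delta> * l + \<delta> * n)
     \<le> window (conv_list (map rw Ts)) (x * n) (2 * \<delta> * n)"
  proof (intro measure_pmf.finite_measure_mono)
    have "\<delta> * l \<le> \<delta> * n" using ls ls0 \<delta> by (intro mult_left_mono) auto
    then show "{y. \<bar>of_int y - x * n\<bar> \<le> \<delta> * l + \<delta> * n} \<subseteq> {y. \<bar>of_int y - x * n\<bar> \<le> 2 * \<delta> * n}"
      by (auto simp: algebra_simps)
  qed simp
  finally show ?thesis by simp
qed


text \<open>\<open>X n\<close> is the law of the cooling walk at time \<open>n\<close> and \<open>rw T\<close> that of the static walk after
  \<open>T\<close> steps.\<close>
locale block_walk =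
  fixes X rw :: "nat \<Rightarrow> int pmf" and c :: real and \<Lambda> G :: "real \<Rightarrow> real"
  assumes bounded_X: "\<And>n. bounded_by n (X n)" and bounded_rw: "\<And>T. bounded_by T (rw T)"
    and X_step: "\<And>n. n > 0 \<Longrightarrow> \<exists>s<n. X n = conv_pmf (X s) (rw (n - s))"
    and X_0: "X 0 = return_pmf 0"
    and rw_elliptic: "\<And>T \<theta>. ln (mgf (rw T) \<theta>) \<ge> T * (\<bar>\<theta>\<bar> + ln c)"
    and X_limit: "\<And>\<theta>. (\<lambda>n. ln (mgf (X n) \<theta>) / n) \<longlonglongrightarrow> \<Lambda> \<theta>"
    and rw_limit: "\<And>\<theta>. (\<lambda>T. ln (mgf (rw T) \<theta>) / T) \<longlonglongrightarrow> G \<theta>"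
    and rw_lower: "\<And>x J \<delta> \<epsilon>. 0 < \<bar>x\<bar> \<Longrightarrow> \<bar>x\<bar> < 1 \<Longrightarrow> (\<And>\<theta>. x * \<theta> - G \<theta> \<le> J) \<Longrightarrow> \<delta> > 0 \<Longrightarrow> \<epsilon> > 0 \<Longrightarrow>
       \<forall>\<^sub>F T in sequentially. exp (- (J + \<epsilon>) * real T) \<le> window (rw T) (x * real T) (\<delta> * real T)"
begin

section \<open>The lower bound for a sum of blocks at speeds 0 < |x| < 1\<close>

lemma \<Lambda>_0: "\<Lambda> 0 = 0"
  using X_limit[of 0] by (simp add: LIMSEQ_const_iff)

text \<open>Peeling off the last block repeatedly. The last clause remembers the time at which a
  block was appended, so that a single block can be compared with two values of the logarithmic
  moment generating function of \<open>X\<close>.\<close>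

lemma blocks_exist:
  "\<exists>Ts. sum_list Ts = n \<and> X n = conv_list (map rw Ts)
     \<and> (\<forall>T\<in>set Ts. T > 0 \<and> (\<exists>s. s + T \<le> n \<and> X (s + T) = conv_pmf (X s) (rw T)))"
proof (induction n rule: less_induct)
  case (less n)
  show ?case
  proof (cases "n = 0")
    case True
    then show ?thesis by (auto simp: X_0 intro!: exI[of _ "[]"])
  next
    case False
    then obtain s where s: "s < n" "X n = conv_pmf (X s) (rw (n - s))" using X_step by blast
    from less[OF s(1)] obtain Ts where Ts: "sum_list Ts = s" "X s = conv_list (map rw Ts)"
      "\<forall>T\<in>set Ts. T > 0 \<and> (\<exists>u. u + T \<le> s \<and> X (u + T) = conv_pmf (X u) (rw T))" by blast
    show ?thesis
    proof (intro exI[of _ "(n - s) # Ts"] conjI ballI)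
      show "sum_list ((n - s) # Ts) = n" using s(1) Ts(1) by simp
      show "X n = conv_list (map rw ((n - s) # Ts))" using s(2) Ts(2) by (simp add: conv_pmf_comm)
      fix T assume T: "T \<in> set ((n - s) # Ts)"
      show "T > 0" using T s(1) Ts(3) by auto
      show "\<exists>s. s + T \<le> n \<and> X (s + T) = conv_pmf (X s) (rw T)"
      proof (cases "T = n - s")
        case True
        then show ?thesis using s by (intro exI[of _ s]) simp
      next
        case False
        then obtain u where "u + T \<le> s" "X (u + T) = conv_pmf (X u) (rw T)" using T Ts(3) by auto
        then show ?thesis using s(1) by (intro exI[of _ u]) simp
      qed
    qed
  qed
qed

text \<open>A macroscopic block is a difference of two values of \<open>n \<Lambda>\<^sub>n\<close>, so it forces
  \<open>\<Lambda> = G\<close>.\<close>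
lemma no_macroscopic_block:
  fixes e :: real
  assumes neq: "\<Lambda> \<theta> \<noteq> G \<theta>" and e: "e > 0"
  shows "\<forall>\<^sub>F n in sequentially. \<forall>s T. s + T \<le> n \<longrightarrow> X (s + T) = conv_pmf (X s) (rw T) \<longrightarrow> real T \<le> e * n"
proof -
  \<comment> \<open>The deviation from linear growth. It is o(m), and the constant \<open>C\<close>
    below absorbs small m, so the bound holds at both ends of any block.\<close>
  define a where "a m = ln (mgf (X m) \<theta>) - m * \<Lambda> \<theta>" for m
  define d where "d = \<bar>\<Lambda> \<theta> - G \<theta>\<bar>"
  \<comment> \<open>Two endpoints contribute at most 2 \<eta> n = e d n / 4, half of the discrepancy
    e n d / 2 that a block longer than e n would create.\<close>
  define \<eta> where "\<eta> = e * d / 8"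
  have d: "d > 0" "\<eta> > 0" using neq e by (auto simp: d_def \<eta>_def)
  have "\<exists>C. \<forall>m. \<bar>a m\<bar> \<le> \<eta> * m + C"
  proof -
    obtain m0 where m0: "\<And>m. m \<ge> m0 \<Longrightarrow> \<bar>ln (mgf (X m) \<theta>) / m - \<Lambda> \<theta>\<bar> < \<eta>"
      using LIMSEQ_D[OF X_limit d(2)] unfolding real_norm_def by blast
    have "\<bar>a m\<bar> \<le> \<eta> * m + (\<Sum>m\<le>m0. \<bar>a m\<bar>)" for m
    proof (cases "m \<ge> m0 \<and> m > 0")
      case True
      then have "a m = m * (ln (mgf (X m) \<theta>) / m - \<Lambda> \<theta>)" by (simp add: a_def field_simps)
      then have "\<bar>a m\<bar> = m * \<bar>ln (mgf (X m) \<theta>) / m - \<Lambda> \<theta>\<bar>" by (simp add: abs_mult)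
      also have "\<dots> \<le> m * \<eta>" using m0[of m] True by (intro mult_left_mono) auto
      finally show ?thesis by (simp add: mult.commute sum_nonneg add_increasing2)
    next
      case False
      then have "\<bar>a m\<bar> \<le> (\<Sum>m\<le>m0. \<bar>a m\<bar>)" by (intro member_le_sum) auto
      then show ?thesis using d by (simp add: add_increasing)
    qed
    then show ?thesis by blast
  qed
  then obtain C where C: "\<And>m. \<bar>a m\<bar> \<le> \<eta> * m + C" by blast
  obtain T0 where T0: "\<And>T. T \<ge> T0 \<Longrightarrow> \<bar>ln (mgf (rw T) \<theta>) / T - G \<theta>\<bar> < d / 2"
    using LIMSEQ_D[OF rw_limit half_gt_zero[OF d(1)]] unfolding real_norm_def by blast
  have "filterlim (\<lambda>n. e * real n) at_top sequentially"
    using e by (intro filterlim_tendsto_pos_mult_at_top[OF tendsto_const] filterlim_real_sequentially)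
  then have "\<forall>\<^sub>F n in sequentially. e * real n > max T0 (8 * (C + 1) / d)"
    by (simp only: filterlim_at_top_dense)
  then show ?thesis
  proof eventually_elim
    case (elim n)
    show ?case
    proof (intro allI impI, rule ccontr)
      fix s T assume sT: "s + T \<le> n" "X (s + T) = conv_pmf (X s) (rw T)" and "\<not> real T \<le> e * n"
      then have T: "real T > e * n" by simp
      then have T0': "T \<ge> T0" "T > 0" using elim by auto
      have "ln (mgf (X (s + T)) \<theta>) = ln (mgf (X s) \<theta>) + ln (mgf (rw T) \<theta>)"
        using mgf_pos[OF bounded_by_finite[OF bounded_X[of s]], of \<theta>] mgf_pos[OF bounded_by_finite[OF bounded_rw[of T]], of \<theta>]
        by (simp add: sT mgf_conv bounded_by_finite[OF bounded_X] bounded_by_finite[OF bounded_rw] ln_mult)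
      then have "T * (ln (mgf (rw T) \<theta>) / T - \<Lambda> \<theta>) = a (s + T) - a s"
        using T0' by (simp add: a_def field_simps)
      then have "T * \<bar>ln (mgf (rw T) \<theta>) / T - \<Lambda> \<theta>\<bar> = \<bar>a (s + T) - a s\<bar>"
        by (metis abs_mult abs_of_nat)
      also have "\<dots> \<le> (\<eta> * n + C) + (\<eta> * n + C)"
      proof -
        have "\<eta> * real (s + T) \<le> \<eta> * n" "\<eta> * real s \<le> \<eta> * n" using sT d by (auto intro!: mult_left_mono)
        then show ?thesis using C[of "s + T"] C[of s] by linarith
      qed
      finally have up: "T * \<bar>ln (mgf (rw T) \<theta>) / T - \<Lambda> \<theta>\<bar> \<le> 2 * \<eta> * n + 2 * C" by simp
      have "d / 2 \<le> \<bar>ln (mgf (rw T) \<theta>) / T - \<Lambda> \<theta>\<bar>" using T0[OF T0'(1)] unfolding d_def by (smt (verit) field_sum_of_halves)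
      then have "T * (d / 2) \<le> 2 * \<eta> * n + 2 * C" using up by (meson mult_left_mono of_nat_0_le_iff order_trans)
      moreover have "e * n * (d / 2) \<le> T * (d / 2)" using T d by (intro mult_right_mono) auto
      moreover have "2 * \<eta> * n = e * n * d / 4" by (simp add: \<eta>_def)
      ultimately have "e * n * d \<le> 8 * C" by linarith
      moreover have "8 * (C + 1) < e * n * d" using elim d by (simp add: divide_less_eq)
      ultimately show False by simp
    qed
  qed
qed

text \<open>The threshold between short and long depends on the limit: if \<Lambda> = G it is a
  constant and long blocks follow the static walk; otherwise it is a small multiple of n and no
  block is long.\<close>

lemma X_lower_aux:
  assumes x: "0 < \<bar>x\<bar>" "\<bar>x\<bar> < 1" and J: "\<And>\<theta>. x * \<theta> - \<Lambda> \<theta> \<le> J" and \<delta>: "0 < \<delta>" "\<delta> \<le> 2" and \<eta>: "\<eta> > 0"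
    and R: "(1 - \<bar>x\<bar>) * R + ln c > 0" "R > 0"
  shows "\<forall>\<^sub>F n in sequentially. exp (- (J + 3 * \<eta> + R * \<delta>) * real n) / 2
    \<le> window (X n) (x * real n) (2 * \<delta> * real n)"
proof -
  have J0: "J \<ge> 0" using J[of 0] by (simp add: \<Lambda>_0)
  have unif: "\<forall>\<^sub>F n in sequentially. \<forall>\<theta>. \<bar>\<theta>\<bar> \<le> R \<longrightarrow> \<bar>ln (mgf (X n) \<theta>) / n - \<Lambda> \<theta>\<bar> \<le> \<eta>"
    by (rule lipschitz_pointwise_limit_uniform[OF scaled_ln_mgf_lipschitz X_limit \<eta>]) (rule bounded_X)
  have Xunif: "\<forall>\<^sub>F n in sequentially. \<forall>\<theta>. \<bar>\<theta>\<bar> \<le> R \<longrightarrow> ln (mgf (X n) \<theta>) \<ge> n * \<Lambda> \<theta> - \<eta> * n"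
    using unif eventually_gt_at_top[of 0]
  proof eventually_elim
    case (elim n)
    show ?case
    proof (intro allI impI)
      fix \<theta> assume "\<bar>\<theta>\<bar> \<le> R"
      then have "ln (mgf (X n) \<theta>) / n \<ge> \<Lambda> \<theta> - \<eta>" using elim(1) by (auto simp: abs_le_iff)
      then show "ln (mgf (X n) \<theta>) \<ge> n * \<Lambda> \<theta> - \<eta> * n" using elim(2) by (simp add: field_simps)
    qed
  qed
  have large: "\<forall>\<^sub>F n in sequentially. K \<le> real n" for K
    using filterlim_real_sequentially by (simp add: filterlim_at_top)
  show ?thesis
  proof (cases "\<Lambda> = G")
    case True
    have "\<forall>\<^sub>F T in sequentially. \<forall>\<theta>. \<bar>\<theta>\<bar> \<le> R \<longrightarrow> \<bar>ln (mgf (rw T) \<theta>) / T - G \<theta>\<bar> \<le> \<eta>"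
      by (rule lipschitz_pointwise_limit_uniform[OF scaled_ln_mgf_lipschitz rw_limit \<eta>]) (rule bounded_rw)
    moreover have "\<forall>\<^sub>F T in sequentially. exp (- (J + \<eta>) * real T) \<le> window (rw T) (x * real T) (\<delta> * real T)"
      using J by (intro rw_lower x \<delta> \<eta>) (simp add: True)
    ultimately have "\<forall>\<^sub>F T in sequentially. (\<forall>\<theta>. \<bar>\<theta>\<bar> \<le> R \<longrightarrow> \<bar>ln (mgf (rw T) \<theta>) / T - G \<theta>\<bar> \<le> \<eta>) \<and>
       exp (- (J + \<eta>) * real T) \<le> window (rw T) (x * real T) (\<delta> * real T)"
      by eventually_elim blast
    then obtain M where M: "\<And>T. T \<ge> M \<Longrightarrow> (\<forall>\<theta>. \<bar>\<theta>\<bar> \<le> R \<longrightarrow> \<bar>ln (mgf (rw T) \<theta>) / T - G \<theta>\<bar> \<le> \<eta>)"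
       "\<And>T. T \<ge> M \<Longrightarrow> exp (- (J + \<eta>) * real T) \<le> window (rw T) (x * real T) (\<delta> * real T)"
      unfolding eventually_sequentially by blast
    \<comment> \<open>Beyond a fixed length the static limit and the static lower bound hold for
      each block, with the same \<open>J\<close> because \<Lambda> = G.\<close>
    define M' where "M' = max 1 M"
    show ?thesis
      using Xunif large[of "8 * M' / \<delta>\<^sup>2"] eventually_gt_at_top[of 0]
    proof eventually_elim
      case (elim n)
      obtain Ts where Ts: "sum_list Ts = n" "X n = conv_list (map rw Ts)" "\<And>T. T \<in> set Ts \<Longrightarrow> T > 0"
        using blocks_exist[of n] by blast
      show ?case unfolding Ts(2)
      proof (rule mixed_blocks_lower_bound[where M=M' and c=c and \<Lambda>=\<Lambda>, OF bounded_rw rw_elliptic Ts(1,3)])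
        show "M' \<ge> 1" by (simp add: M'_def)
        have "8 * real M' * real n \<le> (\<delta>\<^sup>2 * n) * n" using elim(2) \<delta> by (intro mult_right_mono) (auto simp: field_simps)
        then show "8 * real M' * real n \<le> (\<delta> * real n)\<^sup>2" by (simp add: power2_eq_square mult_ac)
        show "exp (- (J + \<eta>) * real T) \<le> window (rw T) (x * real T) (\<delta> * real T)" if "T > M'" for T
          using that by (intro M) (simp add: M'_def)
        show "(\<Sum>T\<leftarrow>filter (\<lambda>T. \<not> T > M') Ts. ln (mgf (rw T) \<theta>)) \<ge> real (sum_list (filter (\<lambda>T. \<not> T > M') Ts)) * \<Lambda> \<theta> - 2 * \<eta> * real n"
          if \<theta>: "\<bar>\<theta>\<bar> \<le> R" for \<theta>
        proof -
          \<comment> \<open>The short blocks get their bound by subtraction: the whole sum is at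
            least n \<Lambda> - \<eta> n, and each long block contributes at most T (\<Lambda> +
            \<eta>).\<close>
          let ?S = "filter (\<lambda>T. \<not> T > M') Ts" and ?L = "filter (\<lambda>T. T > M') Ts"
          have "sum_list ?L + sum_list ?S = sum_list Ts" by (induction Ts) auto
          then have sn: "real (sum_list ?L) + real (sum_list ?S) = n" unfolding Ts(1)[symmetric] by linarith
          have "ln (mgf (X n) \<theta>) = (\<Sum>T\<leftarrow>Ts. ln (mgf (rw T) \<theta>))"
            unfolding Ts(2) by (rule mgf_conv_list[OF bounded_rw])
          also have "\<dots> = (\<Sum>T\<leftarrow>?L. ln (mgf (rw T) \<theta>)) + (\<Sum>T\<leftarrow>?S. ln (mgf (rw T) \<theta>))"
            by (induction Ts) auto
          also have "(\<Sum>T\<leftarrow>?L. ln (mgf (rw T) \<theta>)) \<le> (\<Sum>T\<leftarrow>?L. real T * (\<Lambda> \<theta> + \<eta>))"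
          proof (rule sum_list_mono)
            fix T assume "T \<in> set ?L"
            then have "T \<ge> M" "T > 0" by (auto simp: M'_def)
            with M(1)[of T] \<theta> have "ln (mgf (rw T) \<theta>) / T \<le> \<Lambda> \<theta> + \<eta>" by (auto simp: abs_le_iff True)
            then show "ln (mgf (rw T) \<theta>) \<le> real T * (\<Lambda> \<theta> + \<eta>)" using \<open>T > 0\<close> by (simp add: field_simps)
          qed
          also have "\<dots> = real (sum_list ?L) * (\<Lambda> \<theta> + \<eta>)" by (simp add: sum_list_mult_const sum_list_of_nat)
          finally have "real n * \<Lambda> \<theta> - \<eta> * n \<le> real (sum_list ?L) * (\<Lambda> \<theta> + \<eta>) + (\<Sum>T\<leftarrow>?S. ln (mgf (rw T) \<theta>))"
            using elim(1) \<theta> by fastforce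
          moreover have "real (sum_list ?L) * \<eta> \<le> real n * \<eta>"
            using sn \<eta> by (intro mult_right_mono) auto
          ultimately show ?thesis unfolding sn[symmetric] by (simp add: algebra_simps)
        qed
      qed (use elim J J0 R \<delta> \<eta> in auto)
    qed
  next
    case False
    then obtain \<theta>0 where neq: "\<Lambda> \<theta>0 \<noteq> G \<theta>0" by auto
    \<comment> \<open>The threshold \<open>M\<close> will be about e n; with \<delta>^2 / 16, the
      rounded-up threshold still satisfies 8 M n <= (\<delta> n)^2 once n >= 16 /
      \<delta>^2.\<close>
    define e where "e = \<delta>\<^sup>2 / 16"
    have e: "e > 0" using \<delta> by (simp add: e_def)
    show ?thesis
      using Xunif no_macroscopic_block[OF neq e] large[of "16 / \<delta>\<^sup>2"] eventually_gt_at_top[of 0]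
    proof eventually_elim
      case (elim n)
      obtain Ts where Ts: "sum_list Ts = n" "X n = conv_list (map rw Ts)" "\<And>T. T \<in> set Ts \<Longrightarrow> T > 0"
        and Ts': "\<And>T. T \<in> set Ts \<Longrightarrow> \<exists>s. s + T \<le> n \<and> X (s + T) = conv_pmf (X s) (rw T)"
        using blocks_exist[of n] by blast
      define M where "M = nat \<lceil>e * n\<rceil>"
      have Mr: "real M \<ge> e * n" "real M < e * n + 1" using e by (auto simp: M_def) linarith
      have small: "T \<le> M" if "T \<in> set Ts" for T
        using elim(2) Ts'[OF that] Mr(1) by fastforce
      have filt: "filter (\<lambda>T. \<not> T > M) Ts = Ts" using small by (simp add: filter_id_conv not_less)
      show ?case unfolding Ts(2)
      proof (rule mixed_blocks_lower_bound[where M=M and c=c and \<Lambda>=\<Lambda>, OF bounded_rw rw_elliptic Ts(1,3)])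
        have "e * n > 0" using e elim by simp
        then show "M \<ge> 1" unfolding M_def by linarith
        have "8 * real M \<le> 8 * (e * n + 1)" using Mr by simp
        also have "\<dots> \<le> \<delta>\<^sup>2 * n" using elim(3) \<delta> by (simp add: e_def field_simps)
        finally have "8 * real M * n \<le> (\<delta>\<^sup>2 * n) * n" by (intro mult_right_mono) auto
        then show "8 * real M * real n \<le> (\<delta> * real n)\<^sup>2" by (simp add: power2_eq_square mult_ac)
        show "(\<Sum>T\<leftarrow>filter (\<lambda>T. \<not> T > M) Ts. ln (mgf (rw T) \<theta>)) \<ge> real (sum_list (filter (\<lambda>T. \<not> T > M) Ts)) * \<Lambda> \<theta> - 2 * \<eta> * real n"
          if \<theta>: "\<bar>\<theta>\<bar> \<le> R" for \<theta>
        proof -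
          have "ln (mgf (X n) \<theta>) = (\<Sum>T\<leftarrow>Ts. ln (mgf (rw T) \<theta>))"
            unfolding Ts(2) by (rule mgf_conv_list[OF bounded_rw])
          moreover have "ln (mgf (X n) \<theta>) \<ge> n * \<Lambda> \<theta> - \<eta> * n" using elim(1) \<theta> by blast
          moreover have "\<eta> * n \<ge> 0" using \<eta> by simp
          ultimately show ?thesis unfolding filt Ts(1) by linarith
        qed
      qed (use elim J J0 R \<delta> \<eta> small in \<open>auto simp: leD\<close>)
    qed
  qed
qed

lemma X_lower:
  assumes x: "0 < \<bar>x\<bar>" "\<bar>x\<bar> < 1" and J: "\<And>\<theta>. x * \<theta> - \<Lambda> \<theta> \<le> J" and \<delta>: "\<delta> > 0" and \<epsilon>: "\<epsilon> > 0"
  shows "\<forall>\<^sub>F n in sequentially. exp (- (J + \<epsilon>) * real n)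
    \<le> window (X n) (x * real n) (\<delta> * real n)"
proof -
  \<comment> \<open>The second entry gives (1 - |x|) R + ln c >= 1; this is where |x| < 1
    enters.\<close>
  define R where "R = max 1 ((1 - ln c) / (1 - \<bar>x\<bar>))"
  have R: "R > 0" "(1 - \<bar>x\<bar>) * R + ln c > 0"
  proof -
    have "(1 - ln c) / (1 - \<bar>x\<bar>) \<le> R" by (simp add: R_def)
    then have "1 - ln c \<le> (1 - \<bar>x\<bar>) * R" using x by (simp add: field_simps)
    then show "(1 - \<bar>x\<bar>) * R + ln c > 0" by simp
  qed (simp add: R_def)
  \<comment> \<open>A quarter of \<epsilon> pays for R d, a quarter for the three errors \<epsilon>
    / 12, and a quarter absorbs the factor 1/2 for large n.\<close>
  define d where "d = Min {1, \<delta> / 2, \<epsilon> / (4 * R)}"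
  have d: "0 < d" "d \<le> 2" "d \<le> \<delta> / 2" "d \<le> \<epsilon> / (4 * R)" using \<delta> \<epsilon> R by (auto simp: d_def)
  have Rd: "R * d \<le> \<epsilon> / 4" using d(4) R(1) by (simp add: field_simps)
  have "\<forall>\<^sub>F n in sequentially. 4 / \<epsilon> \<le> real n"
    using filterlim_real_sequentially by (simp add: filterlim_at_top)
  moreover have "\<forall>\<^sub>F n in sequentially. exp (- (J + 3 * (\<epsilon> / 12) + R * d) * real n) / 2
    \<le> window (X n) (x * real n) (2 * d * real n)"
    by (rule X_lower_aux) (use x J d R \<epsilon> in auto)
  ultimately show ?thesis
  proof eventually_elim
    case (elim n)
    have "1 \<le> \<epsilon> / 4 * n" using elim(1) \<epsilon> by (simp add: field_simps)
    then have "2 \<le> exp (\<epsilon> / 4 * n)" using exp_ge_add_one_self[of "\<epsilon> / 4 * n"] by linarith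
    then have "exp (- (J + \<epsilon>) * real n) \<le> exp (- (J + \<epsilon>) * real n) * (exp (\<epsilon> / 4 * n) / 2)" by simp
    also have "\<dots> = exp (- (J + \<epsilon> * 3 / 4) * real n) / 2" by (simp add: algebra_simps flip: exp_add)
    also have "\<dots> \<le> exp (- (J + 3 * (\<epsilon> / 12) + R * d) * real n) / 2"
    proof -
      have "(J + 3 * (\<epsilon> / 12) + R * d) * n \<le> (J + \<epsilon> * 3 / 4) * n" using Rd \<epsilon> by (intro mult_right_mono) auto
      then show ?thesis by (simp only: minus_mult_left[symmetric] divide_right_mono exp_le_cancel_iff neg_le_iff_le divide_le_cancel) simp
    qed
    also note elim(2)
    also have "window (X n) (x * real n) (2 * d * real n)
       \<le> window (X n) (x * real n) (\<delta> * real n)"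
    proof (intro measure_pmf.finite_measure_mono)
      have "2 * d * real n \<le> \<delta> * real n" using d by (intro mult_right_mono) auto
      then show "{y. \<bar>of_int y - x * real n\<bar> \<le> 2 * d * real n} \<subseteq> {y. \<bar>of_int y - x * real n\<bar> \<le> \<delta> * real n}" by auto
    qed simp
    finally show ?case .
  qed
qed

end

section \<open>The large deviation principle for block walks\<close>

lemma log_ereal_div_le:
  assumes "n > 0" "0 \<le> p" "p \<le> exp (a * real n)"
  shows "log_ereal p / ereal (real n) \<le> ereal a"
proof (cases "p = 0")
  case False
  then have "ln p \<le> a * real n" using assms by (metis exp_gt_zero ln_exp ln_le_cancel_iff less_eq_real_def)
  then show ?thesis using False assms by (simp add: log_ereal_def field_simps)
qed (use assms in \<open>simp add: log_ereal_def\<close>)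

lemma log_ereal_div_ge:
  assumes "n > 0" "exp (a * real n) \<le> p"
  shows "ereal a \<le> log_ereal p / ereal (real n)"
proof -
  have p: "p > 0" using assms(2) by (meson exp_gt_zero less_le_trans)
  have "a * real n \<le> ln p" using assms(2) p by (metis ln_exp ln_le_cancel_iff exp_gt_zero)
  then show ?thesis using p assms by (simp add: log_ereal_def field_simps)
qed

context block_walk
begin

section \<open>The rate function and its level sets\<close>

definition rate :: "real \<Rightarrow> ereal" where
  "rate x = (SUP \<theta>. ereal (x * \<theta> - \<Lambda> \<theta>))"

lemma rate_le_iff: "rate x \<le> ereal J \<longleftrightarrow> (\<forall>\<theta>. x * \<theta> - \<Lambda> \<theta> \<le> J)"
  by (simp add: rate_def SUP_le_iff)

text \<open>Moving straight in the direction of \<theta> costs at most a factor \<open>c\<close> per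
  step in every block. Consequently the rate is at most \<open>- ln c\<close> on [-1, 1].\<close>

lemma \<Lambda>_ge: "\<Lambda> \<theta> \<ge> \<bar>\<theta>\<bar> + ln c"
proof (rule LIMSEQ_le_const[OF X_limit])
  have "ln (mgf (X n) \<theta>) / n \<ge> \<bar>\<theta>\<bar> + ln c" if "n \<ge> 1" for n
  proof -
    obtain Ts where Ts: "sum_list Ts = n" "X n = conv_list (map rw Ts)" using blocks_exist[of n] by blast
    have "(\<Sum>T\<leftarrow>Ts. real T * (\<bar>\<theta>\<bar> + ln c)) \<le> (\<Sum>T\<leftarrow>Ts. ln (mgf (rw T) \<theta>))"
      by (intro sum_list_mono rw_elliptic)
    also have "\<dots> = ln (mgf (X n) \<theta>)" unfolding Ts(2) by (rule mgf_conv_list[OF bounded_rw, symmetric])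
    also have "(\<Sum>T\<leftarrow>Ts. real T * (\<bar>\<theta>\<bar> + ln c)) = n * (\<bar>\<theta>\<bar> + ln c)"
      unfolding Ts(1)[symmetric] by (simp add: sum_list_mult_const sum_list_of_nat)
    finally show ?thesis using that by (simp add: field_simps)
  qed
  then show "\<exists>N. \<forall>n\<ge>N. \<bar>\<theta>\<bar> + ln c \<le> ln (mgf (X n) \<theta>) / n" by blast
qed

lemma \<Lambda>_le: "\<Lambda> \<theta> \<le> \<bar>\<theta>\<bar>"
proof (rule LIMSEQ_le_const2[OF X_limit])
  have "ln (mgf (X n) \<theta>) / n \<le> \<bar>\<theta>\<bar>" if "n \<ge> 1" for n
    using ln_mgf_lipschitz[OF bounded_X, of n \<theta> 0] that by (simp add: field_simps)
  then show "\<exists>N. \<forall>n\<ge>N. ln (mgf (X n) \<theta>) / n \<le> \<bar>\<theta>\<bar>" by blast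
qed

lemma rate_nonneg: "0 \<le> rate x"
  unfolding rate_def by (rule SUP_upper2[of 0]) (auto simp: \<Lambda>_0)

lemma rate_le_elliptic:
  assumes "\<bar>x\<bar> \<le> 1"
  shows "x * \<theta> - \<Lambda> \<theta> \<le> - ln c"
proof -
  have "x * \<theta> \<le> \<bar>x\<bar> * \<bar>\<theta>\<bar>" by (metis abs_le_D1 abs_mult order_refl)
  also have "\<dots> \<le> \<bar>\<theta>\<bar>" using assms by (simp add: mult_left_le_one_le)
  finally show ?thesis using \<Lambda>_ge[of \<theta>] by linarith
qed

lemma rate_finite_imp:
  assumes "rate x \<le> ereal J"
  shows "\<bar>x\<bar> \<le> 1"
proof (rule ccontr)
  assume "\<not> \<bar>x\<bar> \<le> 1"
  \<comment> \<open>At the tilt sgn x * t the bound \<Lambda> <= |\<theta>| leaves at least t (|x| -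
    1) = |J| + 1, which exceeds J.\<close>
  define t where "t = (\<bar>J\<bar> + 1) / (\<bar>x\<bar> - 1)"
  have t: "t > 0" "t * (\<bar>x\<bar> - 1) = \<bar>J\<bar> + 1" using \<open>\<not> \<bar>x\<bar> \<le> 1\<close> by (auto simp: t_def)
  have "x * (sgn x * t) - \<Lambda> (sgn x * t) \<le> J" using assms by (simp add: rate_le_iff)
  moreover have "x * (sgn x * t) = \<bar>x\<bar> * t" by (simp add: abs_sgn)
  moreover have "\<Lambda> (sgn x * t) \<le> t"
  proof -
    have "x \<noteq> 0" using \<open>\<not> \<bar>x\<bar> \<le> 1\<close> by auto
    then show ?thesis using \<Lambda>_le[of "sgn x * t"] t(1) by (simp add: abs_mult abs_sgn_eq)
  qed
  ultimately have "\<bar>x\<bar> * t - t \<le> J" by linarith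
  then show False using t(2) by (simp add: algebra_simps)
qed

text \<open>A supremum of affine functions is lower semicontinuous, and its finite level sets lie in
  [-1, 1] because \<Lambda> grows with slope at most 1.\<close>

lemma good_rate: "good_rate_function rate"
proof -
  have "rate 0 \<noteq> \<infinity>"
  proof -
    have "rate 0 \<le> ereal (- ln c)" using rate_le_elliptic[of 0] by (simp add: rate_le_iff)
    then show ?thesis by auto
  qed
  moreover have "rate x \<le> Liminf (at x) rate" for x
    unfolding rate_def[of x]
  proof (rule SUP_least)
    fix \<theta> :: real
    have "((\<lambda>y. ereal (y * \<theta> - \<Lambda> \<theta>)) \<longlongrightarrow> ereal (x * \<theta> - \<Lambda> \<theta>)) (at x)"
      by (intro tendsto_intros)
    then have "ereal (x * \<theta> - \<Lambda> \<theta>) = Liminf (at x) (\<lambda>y. ereal (y * \<theta> - \<Lambda> \<theta>))"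
      by (intro lim_imp_Liminf[symmetric]) auto
    also have "\<dots> \<le> Liminf (at x) rate"
      unfolding rate_def by (intro Liminf_mono always_eventually allI SUP_upper) simp
    finally show "ereal (x * \<theta> - \<Lambda> \<theta>) \<le> Liminf (at x) rate" .
  qed
  moreover have "compact {x. rate x \<le> ereal J}" for J
  proof -
    have "{x. rate x \<le> ereal J} = (\<Inter>\<theta>. {x. x * \<theta> - \<Lambda> \<theta> \<le> J})" by (auto simp: rate_le_iff)
    also have "closed \<dots>" by (intro closed_INT ballI closed_Collect_le continuous_intros)
    finally have "closed {x. rate x \<le> ereal J}" .
    moreover have "{x. rate x \<le> ereal J} \<subseteq> {-1..1}" using rate_finite_imp by (auto simp: abs_le_iff)
    ultimately show ?thesis using compact_Icc by (metis compact_Int_closed inf.absorb_iff2)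
  qed
  ultimately show ?thesis using rate_nonneg unfolding good_rate_function_def by blast
qed

section \<open>Exponential upper and lower bounds\<close>

abbreviation law :: "nat \<Rightarrow> real measure" where
  "law n \<equiv> distr (measure_pmf (X n)) borel (\<lambda>y. real_of_int y / real n)"

lemma chernoff:
  "measure (measure_pmf (X n)) {y. of_int y * \<theta> > a} \<le> mgf (X n) \<theta> * exp (- a)"
proof -
  note fin = bounded_by_finite[OF bounded_X[of n]]
  have "measure (measure_pmf (X n)) {y. of_int y * \<theta> > a} = measure (measure_pmf (X n)) {y \<in> set_pmf (X n). of_int y * \<theta> > a}"
    by (subst measure_Int_set_pmf[symmetric]) (rule arg_cong[where f="measure (measure_pmf (X n))"], auto)
  also have "\<dots> = (\<Sum>y\<in>{y \<in> set_pmf (X n). of_int y * \<theta> > a}. pmf (X n) y)"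
    using fin by (intro measure_measure_pmf_finite) auto
  also have "\<dots> \<le> (\<Sum>y\<in>{y \<in> set_pmf (X n). of_int y * \<theta> > a}. pmf (X n) y * exp (\<theta> * of_int y) * exp (- a))"
  proof (rule sum_mono)
    fix y assume "y \<in> {y \<in> set_pmf (X n). of_int y * \<theta> > a}"
    then have "1 \<le> exp (\<theta> * of_int y) * exp (- a)" by (simp add: mult.commute flip: exp_add)
    from mult_left_mono[OF this pmf_nonneg] show "pmf (X n) y \<le> pmf (X n) y * exp (\<theta> * of_int y) * exp (- a)"
      by (simp add: mult.assoc)
  qed
  also have "\<dots> \<le> (\<Sum>y\<in>set_pmf (X n). pmf (X n) y * exp (\<theta> * of_int y) * exp (- a))"
    using fin by (intro sum_mono2) auto
  finally show ?thesis by (simp add: mgf_sum[OF fin] sum_distrib_right)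
qed

lemma mgf_eventually_le:
  assumes "\<epsilon> > 0"
  shows "\<forall>\<^sub>F n in sequentially. mgf (X n) \<theta> \<le> exp (n * (\<Lambda> \<theta> + \<epsilon>))"
proof -
  have "\<forall>\<^sub>F n in sequentially. ln (mgf (X n) \<theta>) / n < \<Lambda> \<theta> + \<epsilon>"
    using order_tendstoD(2)[OF X_limit, of \<theta> "\<Lambda> \<theta> + \<epsilon>"] assms by simp
  then show ?thesis using eventually_gt_at_top[of 0]
  proof eventually_elim
    case (elim n)
    then have "ln (mgf (X n) \<theta>) \<le> n * (\<Lambda> \<theta> + \<epsilon>)" by (simp add: field_simps)
    then show ?case using mgf_pos[OF bounded_by_finite[OF bounded_X]] by (metis exp_le_cancel_iff exp_ln)
  qed
qed

text \<open>Since |X_n| <= n, only the compact set C cut with [-1, 1] matters. It is covered by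
  finitely many half-lines, each with one tilt that certifies the rate \<open>K\<close>; their
  number is absorbed by half of \<epsilon>.\<close>

lemma upper_bound_exponential:
  assumes C: "closed C" and K: "\<And>x. x \<in> C \<Longrightarrow> ereal K < rate x" and e: "\<epsilon> > 0"
  shows "\<forall>\<^sub>F n in sequentially. measure (measure_pmf (X n)) {y. of_int y / real n \<in> C} \<le> exp ((- K + \<epsilon>) * real n)"
proof -
  let ?U = "\<lambda>\<theta>. {y. y * \<theta> - \<Lambda> \<theta> > K}"
  have "compact (C \<inter> {-1..1})" using C by (simp add: closed_Int_compact)
  moreover have "open (?U \<theta>)" for \<theta> by (intro open_Collect_less continuous_intros)
  moreover have "C \<inter> {-1..1} \<subseteq> (\<Union>\<theta>\<in>UNIV. ?U \<theta>)"
    using K by (fastforce simp: rate_def less_SUP_iff)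
  ultimately obtain F where F: "finite F" "C \<inter> {-1..1} \<subseteq> (\<Union>\<theta>\<in>F. ?U \<theta>)"
    by (metis (no_types, lifting) compactE_image)
  have "\<forall>\<^sub>F n in sequentially. \<forall>\<theta>\<in>F. mgf (X n) \<theta> \<le> exp (n * (\<Lambda> \<theta> + \<epsilon> / 2))"
    using e by (intro eventually_ball_finite F ballI mgf_eventually_le) auto
  moreover have "\<forall>\<^sub>F n in sequentially. card F / (\<epsilon> / 2) \<le> real n"
    using filterlim_real_sequentially unfolding filterlim_at_top by blast
  ultimately show ?thesis using eventually_gt_at_top[of 0]
  proof eventually_elim
    case (elim n)
    have "measure (measure_pmf (X n)) {y. of_int y / real n \<in> C}
      = measure (measure_pmf (X n)) ({y. of_int y / real n \<in> C} \<inter> set_pmf (X n))"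
      by (rule measure_Int_set_pmf[symmetric])
    also have "\<dots> \<le> measure (measure_pmf (X n)) (\<Union>\<theta>\<in>F. {y. of_int y * \<theta> > n * (K + \<Lambda> \<theta>)})"
    proof (intro measure_pmf.finite_measure_mono subsetI)
      fix y assume y: "y \<in> {y. of_int y / real n \<in> C} \<inter> set_pmf (X n)"
      then have "\<bar>real_of_int y\<bar> \<le> real n" using bounded_byD[OF bounded_X] by blast
      then have "of_int y / real n \<in> C \<inter> {-1..1}" using y elim(3) by (auto simp: field_simps abs_le_iff)
      then obtain \<theta> where "\<theta> \<in> F" "of_int y / real n * \<theta> - \<Lambda> \<theta> > K" using F(2) by blast
      then show "y \<in> (\<Union>\<theta>\<in>F. {y. of_int y * \<theta> > n * (K + \<Lambda> \<theta>)})"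
        using elim(3) by (auto simp: field_simps intro!: bexI[of _ \<theta>])
    qed simp
    also have "\<dots> \<le> (\<Sum>\<theta>\<in>F. measure (measure_pmf (X n)) {y. of_int y * \<theta> > n * (K + \<Lambda> \<theta>)})"
      by (intro measure_pmf.finite_measure_subadditive_finite F) auto
    also have "\<dots> \<le> (\<Sum>\<theta>\<in>F. exp (n * (\<epsilon> / 2 - K)))"
    proof (rule sum_mono)
      fix \<theta> assume "\<theta> \<in> F"
      then have "mgf (X n) \<theta> * exp (- (n * (K + \<Lambda> \<theta>))) \<le> exp (n * (\<Lambda> \<theta> + \<epsilon> / 2)) * exp (- (n * (K + \<Lambda> \<theta>)))"
        using elim(1) by (intro mult_right_mono) auto
      also have "\<dots> = exp (n * (\<epsilon> / 2 - K))" by (simp add: algebra_simps flip: exp_add)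
      finally show "measure (measure_pmf (X n)) {y. of_int y * \<theta> > n * (K + \<Lambda> \<theta>)} \<le> exp (n * (\<epsilon> / 2 - K))"
        using chernoff by (rule order_trans[rotated])
    qed
    also have "\<dots> = card F * exp (n * (\<epsilon> / 2 - K))" by simp
    also have "\<dots> \<le> exp (n * (\<epsilon> / 2)) * exp (n * (\<epsilon> / 2 - K))"
    proof (rule mult_right_mono)
      have "card F \<le> n * (\<epsilon> / 2)" using elim(2) e by (simp add: field_simps)
      also have "\<dots> \<le> exp (n * (\<epsilon> / 2))" using exp_ge_add_one_self[of "n * (\<epsilon> / 2)"] by linarith
      finally show "real (card F) \<le> exp (n * (\<epsilon> / 2))" .
    qed simp
    also have "\<dots> = exp ((- K + \<epsilon>) * real n)" by (simp add: algebra_simps flip: exp_add)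
    finally show ?case .
  qed
qed

lemma lower_bound_exponential:
  assumes U: "open U" "x \<in> U" and J: "rate x \<le> ereal J" and e: "\<epsilon> > 0"
  shows "\<forall>\<^sub>F n in sequentially. exp ((- J - \<epsilon>) * real n) \<le> measure (measure_pmf (X n)) {y. of_int y / real n \<in> U}"
proof -
  have x: "\<bar>x\<bar> \<le> 1" by (rule rate_finite_imp[OF J])
  have J': "x * \<theta> - \<Lambda> \<theta> \<le> J" for \<theta> using J by (simp add: rate_le_iff)
  have J0: "J \<ge> 0" using J'[of 0] by (simp add: \<Lambda>_0)
  obtain d where d: "d > 0" "ball x d \<subseteq> U" using U by (meson openE)
  \<comment> \<open>The block estimate covers 0 < |x| < 1. A small step towards 1/2 or -1/2, on the
    side of x, enters that range from 0, 1 and -1 alike. By convexity of the Legendre transform it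
    costs at most s |ln c|, because the rate at \<open>z\<close> is at most
    \<open>- ln c\<close>.\<close>
  define z where "z = (if x \<ge> 0 then 1 / 2 else - 1 / 2 :: real)"
  define s where "s = min (1 / 2) (min (d / 4) (\<epsilon> / (2 * (\<bar>ln c\<bar> + 1))))"
  have s: "0 < s" "s \<le> 1 / 2" "s \<le> d / 4" "s \<le> \<epsilon> / (2 * (\<bar>ln c\<bar> + 1))"
    using d e unfolding s_def by (simp_all add: add_nonneg_pos del: divide_le_eq_numeral1 le_divide_eq_numeral1 distrib_left_numeral)
  have sc: "s * \<bar>ln c\<bar> \<le> \<epsilon> / 2"
  proof -
    have "s * (2 * (\<bar>ln c\<bar> + 1)) \<le> \<epsilon>" using s(4) by (simp add: pos_le_divide_eq add_nonneg_pos)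
    then show ?thesis using s(1) by (simp add: algebra_simps)
  qed
  define x' where "x' = (1 - s) * x + s * z"
  have x'x: "x' - x = s * (z - x)" by (simp add: x'_def algebra_simps)
  have zx: "\<bar>z - x\<bar> \<le> 1" using x by (auto simp: z_def)
  have x'd: "\<bar>x' - x\<bar> \<le> d / 4"
  proof -
    have "\<bar>x' - x\<bar> = s * \<bar>z - x\<bar>" using s by (simp add: x'x abs_mult)
    also have "\<dots> \<le> s * 1" using zx s by (intro mult_left_mono) auto
    finally show ?thesis using s by simp
  qed
  have ax': "\<bar>x'\<bar> = (1 - s) * \<bar>x\<bar> + s / 2"
  proof (cases "x \<ge> 0")
    case True
    then have "x' \<ge> 0" using s by (simp add: x'_def z_def)
    then show ?thesis using True by (simp add: x'_def z_def)
  next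
    case False
    then have "(1 - s) * x \<le> 0" using s by (intro mult_nonneg_nonpos) auto
    then have "x' \<le> 0" using s False by (simp add: x'_def z_def)
    then show ?thesis using False by (simp add: x'_def z_def)
  qed
  have b: "(1 - s) * \<bar>x\<bar> \<le> 1 - s" "(1 - s) * \<bar>x\<bar> \<ge> 0" using x s by (auto simp: mult_left_le)
  have x'1: "0 < \<bar>x'\<bar>" "\<bar>x'\<bar> < 1" unfolding ax' using b s by linarith+
  have Jx': "x' * \<theta> - \<Lambda> \<theta> \<le> J + \<epsilon> / 2" for \<theta>
  proof -
    have "x' * \<theta> - \<Lambda> \<theta> = (1 - s) * (x * \<theta> - \<Lambda> \<theta>) + s * (z * \<theta> - \<Lambda> \<theta>)"
      by (simp add: x'_def algebra_simps)
    also have "(1 - s) * (x * \<theta> - \<Lambda> \<theta>) \<le> (1 - s) * J" using s by (intro mult_left_mono J') auto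
    also have "(1 - s) * J \<le> J" using J0 s by (simp add: mult_left_le_one_le)
    also have "s * (z * \<theta> - \<Lambda> \<theta>) \<le> s * \<bar>ln c\<bar>"
      using s rate_le_elliptic[of z \<theta>] by (intro mult_left_mono) (auto simp: z_def)
    finally show ?thesis using sc by simp
  qed
  have "\<forall>\<^sub>F n in sequentially. exp (- (J + \<epsilon> / 2 + \<epsilon> / 2) * real n)
    \<le> window (X n) (x' * real n) (d / 2 * real n)"
    using d e by (intro X_lower x'1 Jx') auto
  then show ?thesis using eventually_gt_at_top[of 0]
  proof eventually_elim
    case (elim n)
    have "{y. \<bar>of_int y - x' * real n\<bar> \<le> d / 2 * real n} \<subseteq> {y. of_int y / real n \<in> U}"
    proof safe
      fix y assume y: "\<bar>of_int y - x' * real n\<bar> \<le> d / 2 * real n"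
      have "\<bar>of_int y / real n - x'\<bar> = \<bar>of_int y - x' * real n\<bar> / real n" using elim(2) by (simp add: field_simps)
      also have "\<dots> \<le> d / 2" using y elim(2) by (simp add: divide_le_eq)
      finally have "\<bar>of_int y / real n - x\<bar> < d" using x'd d(1) by linarith
      then show "of_int y / real n \<in> U" using d(2) by (auto simp: dist_real_def abs_minus_commute subset_eq)
    qed
    then have "window (X n) (x' * real n) (d / 2 * real n)
       \<le> measure (measure_pmf (X n)) {y. of_int y / real n \<in> U}"
      by (intro measure_pmf.finite_measure_mono) auto
    then show ?case using elim(1) by (simp add: algebra_simps)
  qed
qed

theorem satisfies_LDP_rate:
  "satisfies_LDP law rate"
  unfolding satisfies_LDP_def
proof (intro conjI allI impI)
  fix n :: nat
  show "prob_space (law n)"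
    by (rule measure_pmf.prob_space_distr) simp
  show "sets (law n) = sets borel" by simp
next
  show "good_rate_function rate" by (rule good_rate)
next
  have meas: "measure (law n) A
     = measure (measure_pmf (X n)) {y. of_int y / real n \<in> A}" if "A \<in> sets borel" for n A
    using that by (simp add: measure_distr vimage_def)
  fix C :: "real set" assume C: "closed C"
  let ?l = "limsup (\<lambda>n. log_ereal (measure (law n) C) / ereal (real n))"
  have le: "?l \<le> ereal (- K + \<epsilon>)" if K: "ereal K < (INF x\<in>C. rate x)" and e: "\<epsilon> > 0" for K \<epsilon>
  proof (rule Limsup_bounded)
    have "ereal K < rate x" if "x \<in> C" for x using K that by (meson INF_lower less_le_trans)
    then have "\<forall>\<^sub>F n in sequentially. measure (measure_pmf (X n)) {y. of_int y / real n \<in> C} \<le> exp ((- K + \<epsilon>) * real n)"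
      by (rule upper_bound_exponential[OF C _ e])
    then show "\<forall>\<^sub>F n in sequentially. log_ereal (measure (law n) C) / ereal (real n) \<le> ereal (- K + \<epsilon>)"
      using eventually_gt_at_top[of 0] by eventually_elim (use C in \<open>auto simp: meas intro!: log_ereal_div_le\<close>)
  qed
  have le': "?l \<le> ereal (- K)" if K: "ereal K < (INF x\<in>C. rate x)" for K
  proof (rule ereal_le_epsilon2)
    show "?l \<le> ereal (- K) + ereal e" if "0 < e" for e using le[OF K that] by simp
  qed
  show "?l \<le> - (INF x\<in>C. rate x)"
  proof (rule dense_ge)
    \<comment> \<open>Testing all y above the bound, instead of estimating the infimum itself, also
      treats an infinite infimum, as for the empty set.\<close>
    fix y assume y: "- (INF x\<in>C. rate x) < y"
    show "?l \<le> y"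
    proof (cases y)
      case (real r)
      then have "ereal (- r) < (INF x\<in>C. rate x)" using y by (metis ereal_uminus_less_reorder uminus_ereal.simps(1))
      from le'[OF this] show ?thesis using real by simp
    next
      case MInf
      then show ?thesis using y by simp
    qed simp
  qed
next
  have meas: "measure (law n) A
     = measure (measure_pmf (X n)) {y. of_int y / real n \<in> A}" if "A \<in> sets borel" for n A
    using that by (simp add: measure_distr vimage_def)
  fix U :: "real set" assume U: "open U"
  let ?l = "liminf (\<lambda>n. log_ereal (measure (law n) U) / ereal (real n))"
  have lo: "- rate x \<le> ?l" if x: "x \<in> U" for x
  proof (cases "rate x")
    case (real J)
    have "ereal (- J) \<le> ?l"
    proof (rule ereal_le_epsilon2)
      fix e :: real assume e: "0 < e"
      have "ereal (- J - e) \<le> ?l"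
      proof (rule Liminf_bounded)
        have "rate x \<le> ereal J" using real by simp
        from lower_bound_exponential[OF U x this e] eventually_gt_at_top[of 0]
        show "\<forall>\<^sub>F n in sequentially. ereal (- J - e) \<le> log_ereal (measure (law n) U) / ereal (real n)"
          by eventually_elim (use U in \<open>auto simp: meas intro!: log_ereal_div_ge\<close>)
      qed
      then have "ereal (- J - e) + ereal e \<le> ?l + ereal e" by (rule add_right_mono)
      then show "ereal (- J) \<le> ?l + ereal e" by simp
    qed
    then show ?thesis using real by simp
  qed (use rate_nonneg[of x] in auto)
  have "- ?l \<le> rate x" if "x \<in> U" for x
    using lo[OF that] by (rule ereal_uminus_le_reorder[THEN iffD1])
  then have "- ?l \<le> (INF x\<in>U. rate x)" by (intro INF_greatest)
  then show "- (INF x\<in>U. rate x) \<le> ?l" by (rule ereal_uminus_le_reorder[THEN iffD1])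
qed

end

section \<open>Quenched walks and bridges\<close>

primrec kernel :: "environment \<Rightarrow> nat \<Rightarrow> int \<Rightarrow> int \<Rightarrow> real" where
  "kernel \<omega> 0 x y = of_bool (x = y)"
| "kernel \<omega> (Suc n) x y = \<omega> x * kernel \<omega> n (x + 1) y + (1 - \<omega> x) * kernel \<omega> n (x - 1) y"

text \<open>Only sites in \<open>[0, y)\<close> are used, so that bridges over adjacent intervals are independent
  under the annealed law.\<close>
primrec bridge :: "environment \<Rightarrow> int \<Rightarrow> nat \<Rightarrow> int \<Rightarrow> real" where
  "bridge \<omega> y 0 x = of_bool (x = y)"
| "bridge \<omega> y (Suc t) x =
     (if 0 \<le> x \<and> x < y then \<omega> x * bridge \<omega> y t (x + 1) + (1 - \<omega> x) * bridge \<omega> y t (x - 1) else 0)"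

primrec first_hit :: "environment \<Rightarrow> int \<Rightarrow> nat \<Rightarrow> int \<Rightarrow> real" where
  "first_hit \<omega> y 0 x = of_bool (x = y)"
| "first_hit \<omega> y (Suc t) x =
     (if x < y then \<omega> x * first_hit \<omega> y t (x + 1) + (1 - \<omega> x) * first_hit \<omega> y t (x - 1) else 0)"

abbreviation shift_env :: "int \<Rightarrow> environment \<Rightarrow> environment" where
  "shift_env z \<omega> \<equiv> (\<lambda>x. \<omega> (x + z))"

lemma kernel_shift: "kernel (shift_env z \<omega>) n x y = kernel \<omega> n (x + z) (y + z)"
  by (induction n arbitrary: x) (auto simp: algebra_simps)

lemma kernel_reflect: "kernel (\<lambda>x. 1 - \<omega> (- x)) n x y = kernel \<omega> n (- x) (- y)"
  by (induction n arbitrary: x) (auto simp: algebra_simps)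

lemma kernel_far: "\<bar>x - y\<bar> > int n \<Longrightarrow> kernel \<omega> n x y = 0"
  by (induction n arbitrary: x) auto

lemma bridge_far: "y - x > int t \<Longrightarrow> bridge \<omega> y t x = 0"
  by (induction t arbitrary: x) auto

lemma bridge_cong:
  "(\<And>z. 0 \<le> z \<Longrightarrow> z < y \<Longrightarrow> \<omega> z = \<omega>' z) \<Longrightarrow> bridge \<omega> y t x = bridge \<omega>' y t x"
  by (induction t arbitrary: x) auto

lemma bridge_nonneg:
  "(\<And>x. 0 \<le> \<omega> x) \<Longrightarrow> (\<And>x. \<omega> x \<le> 1) \<Longrightarrow> 0 \<le> bridge \<omega> y t x"
  by (induction t arbitrary: x) (auto intro!: add_nonneg_nonneg mult_nonneg_nonneg)

section \<open>Path decompositions in a fixed environment\<close>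

context
  fixes \<omega> :: environment
  assumes \<omega>: "\<And>x. 0 \<le> \<omega> x" "\<And>x. \<omega> x \<le> 1"
begin

lemma bridge_nn: "0 \<le> bridge \<omega> y t x"
  by (rule bridge_nonneg[OF \<omega>])

lemma kernel_nonneg: "0 \<le> kernel \<omega> n x y"
  by (induction n arbitrary: x) (auto intro!: add_nonneg_nonneg mult_nonneg_nonneg \<omega>)

lemma kernel_le_1: "kernel \<omega> n x y \<le> 1"
proof (induction n arbitrary: x)
  case (Suc n)
  have "\<omega> x * kernel \<omega> n (x + 1) y + (1 - \<omega> x) * kernel \<omega> n (x - 1) y \<le> \<omega> x * 1 + (1 - \<omega> x) * 1"
    using Suc \<omega> by (intro add_mono mult_left_mono) auto
  then show ?case by simp
qed simp

lemma bridge_le_kernel: "bridge \<omega> y t x \<le> kernel \<omega> t x y"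
  by (induction t arbitrary: x)
    (auto intro!: add_mono mult_left_mono add_nonneg_nonneg mult_nonneg_nonneg \<omega> kernel_nonneg)

text \<open>A bridge over the right part of the interval is a path of the larger interval that never
  enters the left part.\<close>

lemma bridge_shift_le:
  assumes "0 \<le> y"
  shows "bridge (shift_env y \<omega>) (Y - y) t x \<le> bridge \<omega> Y t (x + y)"
proof (induction t arbitrary: x)
  case (Suc t)
  show ?case
  proof (cases "0 \<le> x \<and> x < Y - y")
    case True
    have e: "x + 1 + y = x + y + 1" "x - 1 + y = x + y - 1" by simp_all
    have "\<omega> (x + y) * bridge (shift_env y \<omega>) (Y - y) t (x + 1) + (1 - \<omega> (x + y)) * bridge (shift_env y \<omega>) (Y - y) t (x - 1)
       \<le> \<omega> (x + y) * bridge \<omega> Y t (x + y + 1) + (1 - \<omega> (x + y)) * bridge \<omega> Y t (x + y - 1)"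
      using Suc[of "x + 1"] Suc[of "x - 1"] unfolding e by (intro add_mono mult_left_mono) (auto simp: \<omega>)
    then show ?thesis using True assms by simp
  next
    case False
    then have "bridge (shift_env y \<omega>) (Y - y) (Suc t) x = 0" by auto
    then show ?thesis using bridge_nn[of Y "Suc t" "x + y"] by (simp del: bridge.simps)
  qed
qed auto

text \<open>The index \<open>y\<close> is the position at time \<open>t\<close>, so different terms
  describe disjoint sets of paths. Only an inequality holds, since the concatenations stay below
  \<open>y\<close> before that time and at or above it afterwards.\<close>

lemma bridge_concat:
  "(\<Sum>y=0..Y. bridge \<omega> y t x * bridge (shift_env y \<omega>) (Y - y) t' 0) \<le> bridge \<omega> Y (t + t') x"
proof (induction t arbitrary: x)
  case 0
  have "(\<Sum>y=0..Y. bridge \<omega> y 0 x * bridge (shift_env y \<omega>) (Y - y) t' 0)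
     = (\<Sum>y=0..Y. if x = y then bridge (shift_env y \<omega>) (Y - y) t' 0 else 0)"
    by (intro sum.cong) auto
  also have "\<dots> = (if x \<in> {0..Y} then bridge (shift_env x \<omega>) (Y - x) t' 0 else 0)"
    by (subst sum.delta') auto
  also have "\<dots> \<le> bridge \<omega> Y t' x"
    using bridge_shift_le[of x Y t' 0] bridge_nn[of Y t' x] by auto
  finally show ?case by simp
next
  case (Suc t)
  let ?b = "\<lambda>y. bridge (shift_env y \<omega>) (Y - y) t' 0"
  have b: "0 \<le> ?b y" if "y \<in> {0..Y}" for y
  by (rule bridge_nonneg) (auto simp: \<omega>)
  show ?case
  proof (cases "0 \<le> x \<and> x < Y")
    case True
    have "(\<Sum>y=0..Y. bridge \<omega> y (Suc t) x * ?b y)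
       \<le> (\<Sum>y=0..Y. \<omega> x * (bridge \<omega> y t (x + 1) * ?b y) + (1 - \<omega> x) * (bridge \<omega> y t (x - 1) * ?b y))"
    proof (rule sum_mono)
      fix y assume y: "y \<in> {0..Y}"
      have "bridge \<omega> y (Suc t) x \<le> \<omega> x * bridge \<omega> y t (x + 1) + (1 - \<omega> x) * bridge \<omega> y t (x - 1)"
        by (auto intro!: add_nonneg_nonneg mult_nonneg_nonneg \<omega> bridge_nn)
      from mult_right_mono[OF this b[OF y]]
      show "bridge \<omega> y (Suc t) x * ?b y \<le> \<omega> x * (bridge \<omega> y t (x + 1) * ?b y) + (1 - \<omega> x) * (bridge \<omega> y t (x - 1) * ?b y)"
        by (simp only: distrib_right mult.assoc)
    qed
    also have "\<dots> = \<omega> x * (\<Sum>y=0..Y. bridge \<omega> y t (x + 1) * ?b y) + (1 - \<omega> x) * (\<Sum>y=0..Y. bridge \<omega> y t (x - 1) * ?b y)"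
      by (simp add: sum.distrib sum_distrib_left)
    also have "\<dots> \<le> \<omega> x * bridge \<omega> Y (t + t') (x + 1) + (1 - \<omega> x) * bridge \<omega> Y (t + t') (x - 1)"
      using Suc \<omega> by (intro add_mono mult_left_mono) auto
    finally show ?thesis using True by simp
  next
    case False
    then have "(\<Sum>y=0..Y. bridge \<omega> y (Suc t) x * ?b y) = 0"
      by (intro sum.neutral) auto
    then show ?thesis using bridge_nn[of Y "Suc t + t'" x] by simp
  qed
qed

lemma kernel_first_hit:
  assumes "x \<le> y"
  shows "kernel \<omega> T x y = (\<Sum>t\<le>T. first_hit \<omega> y t x * kernel \<omega> (T - t) y y)"
  using assms
proof (induction T arbitrary: x)
  case (Suc T)
  show ?case
  proof (cases "x = y")
    case False
    then have x: "x < y" using Suc.prems by simp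
    have "(\<Sum>t\<le>Suc T. first_hit \<omega> y t x * kernel \<omega> (Suc T - t) y y)
      = (\<Sum>t\<le>T. first_hit \<omega> y (Suc t) x * kernel \<omega> (T - t) y y)"
      using x by (simp add: sum.atMost_Suc_shift del: sum.atMost_Suc first_hit.simps(2))
    also have "\<dots> = (\<Sum>t\<le>T. \<omega> x * (first_hit \<omega> y t (x + 1) * kernel \<omega> (T - t) y y) + (1 - \<omega> x) * (first_hit \<omega> y t (x - 1) * kernel \<omega> (T - t) y y))"
      using x by (intro sum.cong refl) (simp add: algebra_simps)
    also have "\<dots> = \<omega> x * kernel \<omega> T (x + 1) y + (1 - \<omega> x) * kernel \<omega> T (x - 1) y"
      using x Suc.IH[of "x + 1"] Suc.IH[of "x - 1"] by (simp add: sum.distrib sum_distrib_left)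
    finally show ?thesis by simp
  qed (simp add: sum.atMost_Suc_shift del: sum.atMost_Suc kernel.simps(2))
qed simp

text \<open>Split at the last visit to 0: from then on the path stays above 0 until it hits
  \<open>y\<close>, which is contained in a bridge from 0. The first term covers paths that start to
  the right of 0 and never visit it; it is present for the induction on the starting point and
  vanishes at \<open>x = 0\<close>.\<close>

lemma first_hit_last_exit:
  assumes "0 \<le> y"
  shows "first_hit \<omega> y t x \<le> (if 1 \<le> x then bridge \<omega> y t x else 0)
     + (\<Sum>s\<le>t. kernel \<omega> s x 0 * bridge \<omega> y (t - s) 0)"
proof (induction t arbitrary: x)
  case (Suc t)
  let ?S = "\<lambda>x. \<Sum>s\<le>t. kernel \<omega> s x 0 * bridge \<omega> y (t - s) 0"
  have nn: "0 \<le> (\<Sum>s\<le>Suc t. kernel \<omega> s x 0 * bridge \<omega> y (Suc t - s) 0)"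
    by (intro sum_nonneg mult_nonneg_nonneg kernel_nonneg bridge_nn)
  show ?case
  proof (cases "x < y")
    case True
    let ?A = "\<lambda>x. if 1 \<le> x then bridge \<omega> y t x else 0"
    have "(\<Sum>s\<le>Suc t. kernel \<omega> s x 0 * bridge \<omega> y (Suc t - s) 0)
       = of_bool (x = 0) * bridge \<omega> y (Suc t) 0 + (\<Sum>s\<le>t. kernel \<omega> (Suc s) x 0 * bridge \<omega> y (t - s) 0)"
      by (simp add: sum.atMost_Suc_shift del: sum.atMost_Suc kernel.simps(2) bridge.simps(2))
    also have "(\<Sum>s\<le>t. kernel \<omega> (Suc s) x 0 * bridge \<omega> y (t - s) 0) = \<omega> x * ?S (x + 1) + (1 - \<omega> x) * ?S (x - 1)"
      by (simp add: sum_distrib_left sum.distrib[symmetric] algebra_simps)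
    finally have S: "(\<Sum>s\<le>Suc t. kernel \<omega> s x 0 * bridge \<omega> y (Suc t - s) 0)
       = of_bool (x = 0) * bridge \<omega> y (Suc t) 0 + (\<omega> x * ?S (x + 1) + (1 - \<omega> x) * ?S (x - 1))" .
    have "first_hit \<omega> y (Suc t) x = \<omega> x * first_hit \<omega> y t (x + 1) + (1 - \<omega> x) * first_hit \<omega> y t (x - 1)"
      using True by simp
    also have "\<dots> \<le> \<omega> x * (?A (x + 1) + ?S (x + 1)) + (1 - \<omega> x) * (?A (x - 1) + ?S (x - 1))"
      using \<omega> by (intro add_mono mult_left_mono Suc) auto
    also have "\<dots> = (\<omega> x * ?A (x + 1) + (1 - \<omega> x) * ?A (x - 1)) + (\<omega> x * ?S (x + 1) + (1 - \<omega> x) * ?S (x - 1))"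
      by (simp only: distrib_left)
    also have "\<omega> x * ?A (x + 1) + (1 - \<omega> x) * ?A (x - 1)
       \<le> (if 1 \<le> x then bridge \<omega> y (Suc t) x else 0) + of_bool (x = 0) * bridge \<omega> y (Suc t) 0"
    proof -
      consider "x \<ge> 1" | "x = 0" | "x < 0" by linarith
      then show ?thesis
      proof cases
        case 1
        have "(if 1 \<le> x - 1 then bridge \<omega> y t (x - 1) else 0) \<le> bridge \<omega> y t (x - 1)" by (simp add: bridge_nn)
        then have "(1 - \<omega> x) * (if 1 \<le> x - 1 then bridge \<omega> y t (x - 1) else 0) \<le> (1 - \<omega> x) * bridge \<omega> y t (x - 1)"
          using \<omega> by (intro mult_left_mono) auto
        then show ?thesis using 1 True by simp
      next
        case 2
        \<comment> \<open>From 0, a step to the right without return completes a bridge: this is the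
          term with last visit at time 0. The step to the left contributes nothing to it.\<close>
        have "0 \<le> (1 - \<omega> 0) * bridge \<omega> y t (- 1)" using \<omega> bridge_nn by simp
        then show ?thesis using 2 True by simp
      qed auto
    qed
    finally show ?thesis unfolding S by simp
  next
    case False
    then show ?thesis using nn bridge_nn[of y "Suc t" x] by (auto simp del: bridge.simps(2) sum.atMost_Suc kernel.simps(2) intro!: add_nonneg_nonneg)
  qed
qed (use assms in auto)

text \<open>The function \<open>r powi x\<close> is a supersolution with eigenvalue \<kappa> at
  every site, hence dominates the kernel. For \<open>x = y\<close> the power disappears and a loop
  of n steps has probability at most \<kappa>^n in any such environment.\<close>

lemma kernel_return_le:
  assumes r: "r > 0" and super: "\<And>x. \<omega> x * r + (1 - \<omega> x) / r \<le> \<kappa>"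
  shows "kernel \<omega> n x y \<le> \<kappa> ^ n * r powi (x - y)"
proof (induction n arbitrary: x)
  case (Suc n)
  have \<kappa>: "0 \<le> \<kappa>" using super[of 0] \<omega>[of 0] r by (intro order_trans[OF _ super[of 0]]) auto
  have "kernel \<omega> (Suc n) x y \<le> \<omega> x * (\<kappa> ^ n * r powi (x + 1 - y)) + (1 - \<omega> x) * (\<kappa> ^ n * r powi (x - 1 - y))"
    using Suc \<omega> by (auto intro!: add_mono mult_left_mono)
  also have "\<dots> = \<kappa> ^ n * r powi (x - y) * (\<omega> x * r + (1 - \<omega> x) / r)"
  proof -
    have "r powi (x + 1 - y) = r powi (x - y) * r" "r powi (x - 1 - y) = r powi (x - y) / r"
      using r by (simp_all add: power_int_diff power_int_add field_simps)
    then show ?thesis by (simp add: algebra_simps)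
  qed
  also have "\<dots> \<le> \<kappa> ^ n * r powi (x - y) * \<kappa>"
    using super \<kappa> r by (intro mult_left_mono) auto
  finally show ?case by (simp add: mult_ac)
qed (auto intro!: zero_le_power_int less_imp_le[OF r])

text \<open>Here \<open>t\<close> is the first hitting time of \<open>y\<close> and \<open>s\<close>
  the last visit to 0 before it. The loops at the two ends last s and T - t, which gives the
  exponent.\<close>

lemma kernel_le_bridge:
  assumes r: "r > 0" and super: "\<And>x. \<omega> x * r + (1 - \<omega> x) / r \<le> \<kappa>" and y: "0 \<le> y"
  shows "kernel \<omega> T 0 y \<le> (\<Sum>t\<le>T. \<Sum>s\<le>t. \<kappa> ^ (T - (t - s)) * bridge \<omega> y (t - s) 0)"
proof -
  have ret: "kernel \<omega> n x x \<le> \<kappa> ^ n" for n x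
    using kernel_return_le[OF r super, of n x x] by simp
  have \<kappa>: "0 \<le> \<kappa>" using super[of 0] \<omega>[of 0] r by (intro order_trans[OF _ super[of 0]]) auto
  have "kernel \<omega> T 0 y = (\<Sum>t\<le>T. first_hit \<omega> y t 0 * kernel \<omega> (T - t) y y)"
    by (rule kernel_first_hit[OF y])
  also have "\<dots> \<le> (\<Sum>t\<le>T. (\<Sum>s\<le>t. kernel \<omega> s 0 0 * bridge \<omega> y (t - s) 0) * \<kappa> ^ (T - t))"
    using first_hit_last_exit[OF y, of _ 0] ret
    by (intro sum_mono mult_mono) (auto intro!: sum_nonneg mult_nonneg_nonneg kernel_nonneg bridge_nn)
  also have "\<dots> \<le> (\<Sum>t\<le>T. (\<Sum>s\<le>t. \<kappa> ^ s * bridge \<omega> y (t - s) 0) * \<kappa> ^ (T - t))"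
    using ret \<kappa> by (intro sum_mono mult_right_mono) (auto intro: bridge_nn)
  also have "\<dots> = (\<Sum>t\<le>T. \<Sum>s\<le>t. \<kappa> ^ (T - (t - s)) * bridge \<omega> y (t - s) 0)"
  proof (intro sum.cong refl)
    fix t assume "t \<in> {..T}"
    then have "\<kappa> ^ (T - (t - s)) = \<kappa> ^ s * \<kappa> ^ (T - t)" if "s \<le> t" for s
      using that by (simp add: add.commute flip: power_add)
    then show "(\<Sum>s\<le>t. \<kappa> ^ s * bridge \<omega> y (t - s) 0) * \<kappa> ^ (T - t) = (\<Sum>s\<le>t. \<kappa> ^ (T - (t - s)) * bridge \<omega> y (t - s) 0)"
      by (simp add: sum_distrib_right sum_distrib_left mult_ac)
  qed
  finally show ?thesis .
qed

lemma bridge_straight: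
  assumes c: "0 \<le> c" "\<And>x. c \<le> \<omega> x" and "0 \<le> x"
  shows "c ^ t \<le> bridge \<omega> (x + int t) t x"
  using assms(3)
proof (induction t arbitrary: x)
  case (Suc t)
  have "c ^ Suc t \<le> \<omega> x * bridge \<omega> (x + 1 + int t) t (x + 1)"
    using Suc.IH[of "x + 1"] Suc.prems c \<omega> by (auto intro!: mult_mono)
  also have "\<dots> \<le> \<dots> + (1 - \<omega> x) * bridge \<omega> (x + 1 + int t) t (x - 1)"
    using \<omega> bridge_nn by simp
  also have "\<dots> = bridge \<omega> (x + int (Suc t)) (Suc t) x" using Suc.prems by (simp add: add_ac)
  finally show ?case .
qed auto

text \<open>The endpoint after \<open>s\<close> steps in the trap \<open>[0, N)\<close> is arbitrary; \<open>N\<close> further steps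
  straight to the right complete a bridge.\<close>
lemma bridge_trap:
  fixes G :: "int \<Rightarrow> real"
  assumes c: "0 \<le> c" "\<And>x. c \<le> \<omega> x" and k: "0 \<le> k"
    and sub: "\<And>x. 0 \<le> x \<Longrightarrow> x < int N \<Longrightarrow> \<omega> x * G (x + 1) + (1 - \<omega> x) * G (x - 1) \<ge> k * G x"
    and G: "\<And>x. G x \<le> 1" "G (-1) = 0" "G (int N) = 0"
    and x: "0 \<le> x" "x < int N"
  shows "c ^ N * k ^ s * G x \<le> (\<Sum>y=int N..2 * int N. bridge \<omega> y (s + N) x)"
  using x
proof (induction s arbitrary: x)
  case 0
  have "c ^ N * G x \<le> c ^ N" using c G(1)[of x] by (simp add: mult_left_le)
  also have "\<dots> \<le> bridge \<omega> (x + int N) N x" by (rule bridge_straight) (use c 0 in auto)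
  also have "\<dots> \<le> (\<Sum>y=int N..2 * int N. bridge \<omega> y N x)"
    using 0 by (intro member_le_sum bridge_nn) auto
  finally show ?case by simp
next
  case (Suc s)
  let ?B = "\<lambda>x. \<Sum>y=int N..2 * int N. bridge \<omega> y (s + N) x"
  \<comment> \<open>At -1 and \<open>int N\<close> the left-hand side vanishes with
    \<open>G\<close>, so paths leaving the trap are discarded without an estimate.\<close>
  have IH: "c ^ N * k ^ s * G z \<le> ?B z" if "-1 \<le> z" "z \<le> int N" for z
  proof -
    have nn: "0 \<le> ?B z" by (intro sum_nonneg bridge_nn)
    consider "z = -1" | "z = int N" | "0 \<le> z" "z < int N" using \<open>-1 \<le> z\<close> \<open>z \<le> int N\<close> by linarith
    then show ?thesis by cases (use nn Suc.IH[of z] G in auto)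
  qed
  have "c ^ N * k ^ Suc s * G x \<le> c ^ N * k ^ s * (\<omega> x * G (x + 1) + (1 - \<omega> x) * G (x - 1))"
    using mult_left_mono[OF sub[OF Suc.prems], of "c ^ N * k ^ s"] c k by (simp add: mult_ac)
  also have "\<dots> = \<omega> x * (c ^ N * k ^ s * G (x + 1)) + (1 - \<omega> x) * (c ^ N * k ^ s * G (x - 1))"
    by (simp add: algebra_simps)
  also have "\<dots> \<le> \<omega> x * ?B (x + 1) + (1 - \<omega> x) * ?B (x - 1)"
    using \<omega> Suc.prems by (intro add_mono mult_left_mono IH) auto
  also have "\<dots> = (\<Sum>y=int N..2 * int N. bridge \<omega> y (Suc s + N) x)"
    using Suc.prems by (simp add: sum_distrib_left sum.distrib[symmetric])
  finally show ?case .
qed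

end

section \<open>Annealed bridges\<close>

lemma indep_vars_PiM_components:
  assumes M: "\<And>i. i \<in> I \<Longrightarrow> prob_space (M i)" and I: "I \<noteq> {}"
  shows "prob_space.indep_vars (Pi\<^sub>M I M) M (\<lambda>i \<omega>. \<omega> i) I"
proof -
  interpret prob_space "Pi\<^sub>M I M" by (intro prob_space_PiM M)
  have "distr (Pi\<^sub>M I M) (Pi\<^sub>M I M) (\<lambda>x. \<lambda>i\<in>I. x i) = Pi\<^sub>M I M"
    using distr_PiM_reindex[of I M id I] M by simp
  also have "\<dots> = (\<Pi>\<^sub>M i\<in>I. distr (Pi\<^sub>M I M) (M i) (\<lambda>\<omega>. \<omega> i))"
    by (intro PiM_cong refl) (simp add: distr_PiM_component M)
  finally show ?thesis
    by (subst indep_vars_iff_distr_eq_PiM'[OF I]) auto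
qed

text \<open>Invariance under \<open>restrict\<close> expresses that a function reads only the given
  coordinates. The lemma serves twice: for bridges over adjacent intervals and for blocks with
  different environments.\<close>

lemma integral_PiM_disjoint:
  fixes f g :: "('i \<Rightarrow> 'a) \<Rightarrow> real"
  assumes M: "\<And>i. i \<in> I \<Longrightarrow> prob_space (M i)"
    and JK: "J \<inter> K = {}" "J \<subseteq> I" "K \<subseteq> I" "K \<noteq> {}"
    and f: "f \<in> borel_measurable (Pi\<^sub>M J M)" "\<And>\<omega>. f (restrict \<omega> J) = f \<omega>"
    and g: "g \<in> borel_measurable (Pi\<^sub>M K M)" "\<And>\<omega>. g (restrict \<omega> K) = g \<omega>"
    and int: "integrable (Pi\<^sub>M I M) f" "integrable (Pi\<^sub>M I M) g"
  shows "(\<integral>\<omega>. f \<omega> * g \<omega> \<partial>Pi\<^sub>M I M) = (\<integral>\<omega>. f \<omega> \<partial>Pi\<^sub>M I M) * (\<integral>\<omega>. g \<omega> \<partial>Pi\<^sub>M I M)"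
proof -
  interpret prob_space "Pi\<^sub>M I M" by (intro prob_space_PiM M)
  have "I \<noteq> {}" using JK by auto
  have "indep_var (Pi\<^sub>M J M) (\<lambda>\<omega>. restrict (\<lambda>i. \<omega> i) J) (Pi\<^sub>M K M) (\<lambda>\<omega>. restrict (\<lambda>i. \<omega> i) K)"
    using indep_vars_PiM_components[OF M \<open>I \<noteq> {}\<close>] JK by (intro indep_var_restrict) auto
  from indep_var_compose[OF this f(1) g(1)]
  have "indep_var borel f borel g" by (simp add: comp_def f(2) g(2))
  then show ?thesis using int by (rule indep_var_lebesgue_integral)
qed

text \<open>Reversing space and exchanging left and right steps turns an i.i.d. environment into one
  with the law of 1 - p at each site, so results on walks to the right transfer to the left.\<close>

lemma env_law_reflect:
  assumes \<alpha>: "prob_space \<alpha>" "sets \<alpha> = sets borel"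
  shows "env_law (distr \<alpha> borel (\<lambda>p. 1 - p)) = distr (env_law \<alpha>) env_space (\<lambda>\<omega> x. 1 - \<omega> (- x))"
proof -
  let ?\<alpha>' = "distr \<alpha> borel (\<lambda>p::real. 1 - p)"
  have m: "(\<lambda>p. 1 - p) \<in> \<alpha> \<rightarrow>\<^sub>M (borel :: real measure)" using \<alpha>(2) by (simp add: measurable_cong_sets[OF \<alpha>(2) refl])
  interpret \<alpha>: prob_space \<alpha> by fact
  interpret \<alpha>': prob_space ?\<alpha>' by (rule \<alpha>.prob_space_distr[OF m])
  interpret P: product_prob_space "\<lambda>_::int. ?\<alpha>'" UNIV ..
  have R: "(\<lambda>\<omega> x. 1 - \<omega> (- x)) \<in> env_law \<alpha> \<rightarrow>\<^sub>M env_space"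
    unfolding measurable_cong_sets[OF sets_env_law[OF \<alpha>(2)] refl]
    by (rule measurable_PiM_single') (auto simp: space_PiM)
  show ?thesis unfolding env_law_def[of ?\<alpha>']
  proof (rule P.PiM_eq[symmetric])
    show "sets (distr (env_law \<alpha>) env_space (\<lambda>\<omega> x. 1 - \<omega> (- x))) = sets (Pi\<^sub>M UNIV (\<lambda>_. ?\<alpha>'))"
      using sets_env_law[of ?\<alpha>'] by (simp add: env_law_def)
    fix J :: "int set" and F assume J: "finite J" "J \<subseteq> UNIV" and F: "\<And>j. j \<in> J \<Longrightarrow> F j \<in> sets ?\<alpha>'"
    let ?X = "prod_emb UNIV (\<lambda>_. ?\<alpha>') J (\<Pi>\<^sub>E j\<in>J. F j)"
    let ?J = "uminus ` J" and ?F = "\<lambda>j. (\<lambda>p. 1 - p) -` F (- j)"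
    have spa: "space \<alpha> = UNIV" using sets_eq_imp_space_eq[OF \<alpha>(2)] by simp
    have X: "?X \<in> sets env_space"
    proof -
      have "?X = prod_emb UNIV (\<lambda>_. borel) J (\<Pi>\<^sub>E j\<in>J. F j)" by (simp add: prod_emb_def space_PiM)
      also have "\<dots> \<in> sets env_space" using J F by (intro sets_PiM_I) auto
      finally show ?thesis .
    qed
    have F': "?F j \<in> sets \<alpha>" if "j \<in> ?J" for j
    proof -
      have "F (- j) \<in> sets borel" using that F by auto
      from measurable_sets[OF m this] show ?thesis using spa by simp
    qed
    have "emeasure (distr (env_law \<alpha>) env_space (\<lambda>\<omega> x. 1 - \<omega> (- x))) ?X
      = emeasure (env_law \<alpha>) ((\<lambda>\<omega> x. 1 - \<omega> (- x)) -` ?X \<inter> space (env_law \<alpha>))"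
      by (rule emeasure_distr[OF R X])
    also have "(\<lambda>\<omega> x. 1 - \<omega> (- x)) -` ?X \<inter> space (env_law \<alpha>) = prod_emb UNIV (\<lambda>_. \<alpha>) ?J (\<Pi>\<^sub>E j\<in>?J. ?F j)"
      by (auto simp: prod_emb_def env_law_def space_PiM spa PiE_iff)
    also have "emeasure (env_law \<alpha>) \<dots> = (\<Prod>j\<in>?J. emeasure \<alpha> (?F j))"
      unfolding env_law_def using J F' by (intro emeasure_PiM_emb \<alpha>(1)) auto
    also have "\<dots> = (\<Prod>j\<in>J. emeasure ?\<alpha>' (F j))"
      using F by (subst prod.reindex) (auto simp: inj_on_def emeasure_distr[OF m] spa intro!: prod.cong)
    finally show "emeasure (distr (env_law \<alpha>) env_space (\<lambda>\<omega> x. 1 - \<omega> (- x))) ?X = (\<Prod>j\<in>J. emeasure ?\<alpha>' (F j))" .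
  qed
qed

lemma env_law_shift:
  assumes \<alpha>: "prob_space \<alpha>" "sets \<alpha> = sets borel"
  shows "distr (env_law \<alpha>) env_space (shift_env z) = env_law \<alpha>"
proof -
  have s: "sets env_space = sets (Pi\<^sub>M UNIV (\<lambda>_::int. \<alpha>))"
    using sets_env_law[OF \<alpha>(2)] by (simp add: env_law_def)
  have "distr (Pi\<^sub>M UNIV (\<lambda>_::int. \<alpha>)) (Pi\<^sub>M UNIV (\<lambda>_::int. \<alpha>)) (\<lambda>\<omega>. \<lambda>n\<in>UNIV. \<omega> (n + z)) = Pi\<^sub>M UNIV (\<lambda>_. \<alpha>)"
    using \<alpha>(1) by (intro distr_PiM_reindex) (auto simp: inj_on_def)
  moreover have "(\<lambda>\<omega>. \<lambda>n\<in>UNIV. \<omega> (n + z)) = (\<lambda>\<omega>::environment. shift_env z \<omega>)" by (auto simp: fun_eq_iff)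
  ultimately show ?thesis unfolding env_law_def using distr_cong[OF refl s, of "Pi\<^sub>M UNIV (\<lambda>_. \<alpha>)" "shift_env z" "shift_env z"] by simp
qed

text \<open>\<open>u\<close> is the left end of the support: the largest almost sure lower bound,
  reached along a sequence of such bounds. Anything larger is not a lower bound, which gives
  positive mass just above \<open>u\<close>.\<close>

lemma ess_inf_exists:
  fixes \<alpha> :: "real measure"
  assumes "prob_space \<alpha>" "sets \<alpha> = sets borel" "AE p in \<alpha>. a \<le> p \<and> p \<le> b"
  shows "\<exists>u. a \<le> u \<and> u \<le> b \<and> (AE p in \<alpha>. u \<le> p) \<and> (\<forall>\<delta>>0. 0 < measure \<alpha> {p. p < u + \<delta>})"
proof -
  interpret prob_space \<alpha> by fact
  define S where "S = {t. AE p in \<alpha>. t \<le> p}"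
  have aS: "a \<in> S" using assms(3) by (auto simp: S_def)
  have le_b: "t \<le> b" if "t \<in> S" for t
  proof -
    have "AE p in \<alpha>. t \<le> b" using that assms(3) unfolding S_def mem_Collect_eq by eventually_elim linarith
    then show ?thesis by (simp add: AE_const)
  qed
  then have bdd: "bdd_above S" by (auto simp: bdd_above_def)
  define u where "u = Sup S"
  have up: "AE p in \<alpha>. u \<le> p"
  proof -
    have "AE p in \<alpha>. u - inverse (real (Suc n)) \<le> p" for n
    proof -
      obtain t where "t \<in> S" "u - inverse (real (Suc n)) < t"
        using less_cSup_iff[of S "u - inverse (real (Suc n))"] aS bdd unfolding u_def[symmetric] by auto
      then show ?thesis unfolding S_def mem_Collect_eq by (auto elim!: AE_mp)
    qed
    then have "AE p in \<alpha>. \<forall>n. u - inverse (real (Suc n)) \<le> p" by (simp add: AE_all_countable)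
    then show ?thesis
    proof eventually_elim
      case (elim p)
      show ?case
      proof (rule ccontr)
        assume "\<not> u \<le> p"
        then obtain n where "inverse (real (Suc n)) < u - p" using reals_Archimedean[of "u - p"] by auto
        then show False using elim[rule_format, of n] by linarith
      qed
    qed
  qed
  have "0 < measure \<alpha> {p. p < u + \<delta>}" if "\<delta> > 0" for \<delta>
  proof (rule ccontr)
    assume "\<not> 0 < measure \<alpha> {p. p < u + \<delta>}"
    then have "measure \<alpha> {p. p < u + \<delta>} = 0" using measure_nonneg[of \<alpha>] by (simp add: less_le)
    moreover have "{p. p < u + \<delta>} \<in> sets \<alpha>" using assms(2) by simp
    ultimately have "AE p in \<alpha>. \<not> p < u + \<delta>"
      by (intro AE_I'[of "{p. p < u + \<delta>}"]) (auto simp: null_sets_def emeasure_eq_measure)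
    then have "u + \<delta> \<in> S" by (simp add: S_def not_less)
    then have "u + \<delta> \<le> u" unfolding u_def using bdd by (intro cSup_upper)
    then show False using that by simp
  qed
  moreover have "a \<le> u" unfolding u_def by (rule cSup_upper[OF aS bdd])
  moreover have "u \<le> b" unfolding u_def using aS le_b by (intro cSup_least) auto
  ultimately show ?thesis using up by blast
qed

lemma ess_sup_exists:
  fixes \<alpha> :: "real measure"
  assumes "prob_space \<alpha>" "sets \<alpha> = sets borel" "AE p in \<alpha>. a \<le> p \<and> p \<le> b"
  shows "\<exists>v. a \<le> v \<and> v \<le> b \<and> (AE p in \<alpha>. p \<le> v) \<and> (\<forall>\<delta>>0. 0 < measure \<alpha> {p. v - \<delta> < p})"
proof -
  interpret prob_space \<alpha> by fact
  have spa: "space \<alpha> = UNIV" using sets_eq_imp_space_eq[OF assms(2)] by simp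
  have m: "uminus \<in> \<alpha> \<rightarrow>\<^sub>M (borel :: real measure)" by (simp add: measurable_cong_sets[OF assms(2) refl])
  have AEd: "(AE p in distr \<alpha> borel uminus. P p) \<longleftrightarrow> (AE p in \<alpha>. P (- p))" if "{p. P p} \<in> sets borel" for P :: "real \<Rightarrow> bool"
    using that by (subst AE_distr_iff[OF m]) auto
  obtain u where u: "- b \<le> u" "u \<le> - a" "AE p in distr \<alpha> borel uminus. u \<le> p" "\<And>\<delta>. \<delta> > 0 \<Longrightarrow> 0 < measure (distr \<alpha> borel uminus) {p. p < u + \<delta>}"
    using ess_inf_exists[of "distr \<alpha> borel uminus" "- b" "- a"] prob_space_distr[OF m] assms(3)
    by (auto simp: AEd AE_conj_iff)
  have "0 < measure \<alpha> {p. - u - \<delta> < p}" if "\<delta> > 0" for \<delta>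
  proof -
    have "uminus -` {p. p < u + \<delta>} \<inter> space \<alpha> = {p. - u - \<delta> < p}" using spa by auto
    then show ?thesis using u(4)[OF that] by (simp add: measure_distr[OF m])
  qed
  moreover have "AE p in \<alpha>. p \<le> - u" using u(3) by (auto simp: AEd elim!: AE_mp)
  ultimately show ?thesis using u(1,2) by (intro exI[of _ "- u"]) auto
qed

section \<open>The saddle point of the growth rates\<close>

locale elliptic_law =
  fixes \<alpha> :: "real measure" and c :: real
  assumes \<alpha>_prob: "prob_space \<alpha>" and \<alpha>_sets: "sets \<alpha> = sets borel"
    and c_pos: "0 < c" and elliptic_AE: "AE p in \<alpha>. c \<le> p \<and> p \<le> 1 - c"
begin

text \<open>The point of the convex hull of the support closest to \<open>1/2\<close>: it is the saddle point in the
  minimax description of the growth rate of walks that stay in a bounded region.\<close>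
lemma saddle_exists:
  "\<exists>q. c \<le> q \<and> q \<le> 1 - c
    \<and> (\<forall>\<delta>>0. 0 < measure \<alpha> {p. p < q + \<delta>}) \<and> (\<forall>\<delta>>0. 0 < measure \<alpha> {p. q - \<delta> < p})
    \<and> (q > 1 / 2 \<longrightarrow> (AE p in \<alpha>. q \<le> p)) \<and> (q < 1 / 2 \<longrightarrow> (AE p in \<alpha>. p \<le> q))"
proof -
  interpret prob_space \<alpha> by (rule \<alpha>_prob)
  obtain u where u: "c \<le> u" "u \<le> 1 - c" "AE p in \<alpha>. u \<le> p" "\<And>\<delta>. \<delta> > 0 \<Longrightarrow> 0 < measure \<alpha> {p. p < u + \<delta>}"
    using ess_inf_exists[OF \<alpha>_prob \<alpha>_sets elliptic_AE] by blast
  obtain v where v: "c \<le> v" "v \<le> 1 - c" "AE p in \<alpha>. p \<le> v" "\<And>\<delta>. \<delta> > 0 \<Longrightarrow> 0 < measure \<alpha> {p. v - \<delta> < p}"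
    using ess_sup_exists[OF \<alpha>_prob \<alpha>_sets elliptic_AE] by blast
  have "AE p in \<alpha>. u \<le> v" using u(3) v(3) by eventually_elim linarith
  then have uv: "u \<le> v" by simp
  define q where "q = max u (min v (1 / 2))"
  have q: "u \<le> q" "q \<le> v" using uv by (auto simp: q_def)
  have S: "{p. p < t} \<in> sets \<alpha>" "{p. t < p} \<in> sets \<alpha>" for t by (simp_all add: \<alpha>_sets)
  have "0 < measure \<alpha> {p. p < q + \<delta>}" if "\<delta> > 0" for \<delta>
    using q by (intro less_le_trans[OF u(4)[OF that]] finite_measure_mono S) auto
  moreover have "0 < measure \<alpha> {p. q - \<delta> < p}" if "\<delta> > 0" for \<delta>
    using q by (intro less_le_trans[OF v(4)[OF that]] finite_measure_mono S) auto
  moreover have "q = u" if "q > 1 / 2" using that by (auto simp: q_def max_def min_def split: if_splits)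
  moreover have "q = v" if "q < 1 / 2" using that uv by (auto simp: q_def max_def min_def split: if_splits)
  ultimately show ?thesis using u v q by (intro exI[of _ q]) auto
qed

text \<open>\<open>q\<close> has mass arbitrarily close to or beyond it on either side. For an
  affine function the favourable side is given by the sign of its slope \<open>a - b\<close>, so any
  value strictly below the one at \<open>q\<close> is exceeded with positive probability.\<close>

lemma affine_above_saddle:
  assumes q: "\<And>\<delta>. \<delta> > 0 \<Longrightarrow> 0 < measure \<alpha> {p. p < q + \<delta>}" "\<And>\<delta>. \<delta> > 0 \<Longrightarrow> 0 < measure \<alpha> {p. q - \<delta> < p}"
    and k: "q * a + (1 - q) * b > k"
  shows "0 < measure \<alpha> {p. p * a + (1 - p) * b > k}"
proof -
  interpret prob_space \<alpha> by (rule \<alpha>_prob)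
  have S: "{p. p * a + (1 - p) * b > k} \<in> sets \<alpha>" by (simp add: \<alpha>_sets)
  define e where "e = q * a + (1 - q) * b - k"
  define \<delta> where "\<delta> = e / (\<bar>a - b\<bar> + 1)"
  have e: "e > 0" using k by (simp add: e_def)
  have \<delta>: "\<delta> > 0" "\<bar>a - b\<bar> * \<delta> < e" using e by (auto simp: \<delta>_def field_simps)
  show ?thesis
  proof (cases "a \<ge> b")
    case True
    have "{p. q - \<delta> < p} \<subseteq> {p. p * a + (1 - p) * b > k}"
    proof safe
      fix p assume "q - \<delta> < p"
      then have "(a - b) * (q - \<delta>) \<le> (a - b) * p" using True by (intro mult_left_mono) auto
      then show "p * a + (1 - p) * b > k" using \<delta>(2) True by (simp add: e_def algebra_simps)
    qed
    then show ?thesis using q(2)[OF \<delta>(1)] finite_measure_mono[OF _ S] by (meson less_le_trans)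
  next
    case False
    have "{p. p < q + \<delta>} \<subseteq> {p. p * a + (1 - p) * b > k}"
    proof safe
      fix p assume "p < q + \<delta>"
      then have "(b - a) * p \<le> (b - a) * (q + \<delta>)" using False by (intro mult_left_mono) auto
      then show "p * a + (1 - p) * b > k" using \<delta>(2) False by (simp add: e_def algebra_simps)
    qed
    then show ?thesis using q(1)[OF \<delta>(1)] finite_measure_mono[OF _ S] by (meson less_le_trans)
  qed
qed

text \<open>\<kappa> is the growth rate of the walk with constant parameter \<open>q\<close>
  confined to long intervals. From above, \<open>q\<close> is the worst parameter in the support,
  because p - q and r - 1 / r have opposite signs or one of them vanishes. From below, a truncated
  eigenfunction proves any smaller rate with finitely many sites, each of which may choose its own
  parameter from a set of positive measure.\<close>

lemma saddle_rates:
  "\<exists>r \<kappa>. r > 0 \<and> \<kappa> > 0 \<and> (AE p in \<alpha>. p * r + (1 - p) / r \<le> \<kappa>)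
    \<and> (\<forall>\<kappa>'. 0 < \<kappa>' \<and> \<kappa>' < \<kappa> \<longrightarrow> (\<exists>N>0. \<exists>G :: int \<Rightarrow> real. (\<forall>x. G x \<le> 1) \<and> G (-1) = 0 \<and> G (int N) = 0 \<and> G 0 > 0
      \<and> (\<forall>x. 0 \<le> x \<and> x < int N \<longrightarrow> 0 < measure \<alpha> {p. p * G (x + 1) + (1 - p) * G (x - 1) > \<kappa>' * G x})))"
proof -
  obtain q where q: "c \<le> q" "q \<le> 1 - c" and
    qm: "\<And>\<delta>. \<delta> > 0 \<Longrightarrow> 0 < measure \<alpha> {p. p < q + \<delta>}" "\<And>\<delta>. \<delta> > 0 \<Longrightarrow> 0 < measure \<alpha> {p. q - \<delta> < p}"
    and qa: "q > 1 / 2 \<Longrightarrow> AE p in \<alpha>. q \<le> p" "q < 1 / 2 \<Longrightarrow> AE p in \<alpha>. p \<le> q"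
    using saddle_exists by blast
  have q01: "0 < q" "q < 1" using q c_pos by auto
  \<comment> \<open>This \<open>r\<close> minimises q r + (1 - q) / r by making the two terms equal,
    and \<kappa> is the minimum.\<close>
  define r where "r = sqrt ((1 - q) / q)"
  define \<kappa> where "\<kappa> = 2 * sqrt (q * (1 - q))"
  have r: "r > 0" using q01 by (simp add: r_def)
  have \<kappa>: "\<kappa> > 0" using q01 by (simp add: \<kappa>_def)
  have qr: "q * r = \<kappa> / 2"
  proof -
    have "q * r = sqrt (q\<^sup>2 * ((1 - q) / q))" unfolding r_def real_sqrt_mult using q01 by simp
    also have "q\<^sup>2 * ((1 - q) / q) = q * (1 - q)" using q01 by (simp add: power2_eq_square)
    finally show ?thesis by (simp add: \<kappa>_def)
  qed
  have qr': "(1 - q) / r = \<kappa> / 2"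
  proof -
    have "r\<^sup>2 = (1 - q) / q" using q01 by (simp add: r_def)
    then have "1 - q = q * r * r" using q01 by (simp add: power2_eq_square field_simps)
    then show ?thesis using r qr by simp
  qed
  have "AE p in \<alpha>. p * r + (1 - p) / r \<le> \<kappa>"
  proof -
    have eq: "p * r + (1 - p) / r = \<kappa> + (p - q) * (r - 1 / r)" for p
    proof -
      have "p * r + (1 - p) / r = q * r + (1 - q) / r + (p - q) * (r - 1 / r)" by (simp add: algebra_simps diff_divide_distrib)
      then show ?thesis by (simp add: qr qr')
    qed
    consider "q > 1 / 2" | "q < 1 / 2" | "q = 1 / 2" by linarith
    then show ?thesis
    proof cases
      case 1
      then have "r \<le> 1" using q01 by (simp add: r_def divide_le_eq)
      then have "r - 1 / r \<le> 0" using r by (simp add: field_simps) (metis less_eq_real_def mult_le_one power2_eq_square)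
      note sg = this
      show ?thesis using qa(1)[OF 1]
      proof eventually_elim
        case (elim p)
        then have "(p - q) * (r - 1 / r) \<le> 0" using sg by (intro mult_nonneg_nonpos) auto
        then show ?case unfolding eq by simp
      qed
    next
      case 2
      then have "r \<ge> 1" using q01 by (simp add: r_def le_divide_eq)
      then have "r - 1 / r \<ge> 0" using r mult_mono[of 1 r 1 r] by (simp add: field_simps)
      note sg = this
      show ?thesis using qa(2)[OF 2]
      proof eventually_elim
        case (elim p)
        then have "(p - q) * (r - 1 / r) \<le> 0" using sg by (intro mult_nonpos_nonneg) auto
        then show ?case unfolding eq by simp
      qed
    next
      case 3
      then have "r = 1" by (simp add: r_def)
      then show ?thesis unfolding eq by simp
    qed
  qed
  moreover have "\<exists>N>0. \<exists>G :: int \<Rightarrow> real. (\<forall>x. G x \<le> 1) \<and> G (-1) = 0 \<and> G (int N) = 0 \<and> G 0 > 0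
      \<and> (\<forall>x. 0 \<le> x \<and> x < int N \<longrightarrow> 0 < measure \<alpha> {p. p * G (x + 1) + (1 - p) * G (x - 1) > \<kappa>' * G x})"
    if \<kappa>': "0 < \<kappa>'" "\<kappa>' < \<kappa>" for \<kappa>'
  proof -
    \<comment> \<open>Chosen so that \<kappa>' g < \<kappa> (g - 1) whenever g >= N: on a wide
      interval the loss of 1 is negligible.\<close>
    obtain N :: nat where N: "\<kappa> / (\<kappa> - \<kappa>') < real N" using reals_Archimedean2 by blast
    have Npos: "N > 0" using N \<kappa>' \<kappa> by (cases N) (auto simp: divide_less_0_iff)
    txt \<open>\<open>r\<close> removes the drift of the walk with constant parameter \<open>q\<close>; for the symmetric walk, the
      parabola \<open>g\<close> exceeds the mean of its neighbours by exactly \<open>1\<close>, and \<open>g \<ge> N\<close> in the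
      window.\<close>
    define g where "g x = real_of_int ((x + 1) * (int N - x))" for x
    define C where "C = 1 + (\<Sum>x=0..int N. r powi x * g x)"
    define G where "G x = r powi x * g x / C" for x
    have g0: "g x \<ge> 0" if "0 \<le> x" "x \<le> int N" for x using that by (simp add: g_def)
    have C: "C \<ge> 1" unfolding C_def using r g0 by (auto intro!: sum_nonneg mult_nonneg_nonneg zero_le_power_int)
    have gN: "g x \<ge> N" if "0 \<le> x" "x < int N" for x
    proof -
      have "int N \<le> (x + 1) * (int N - x)"
      proof -
        have "0 \<le> x * (int N - 1 - x)" using that by simp
        then show ?thesis by (simp add: algebra_simps)
      qed
      then show ?thesis unfolding g_def by (metis of_int_le_iff of_int_of_nat_eq)
    qed
    have "G x \<le> 1" for x
    proof (cases "0 \<le> x \<and> x \<le> int N")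
      case True
      then have "r powi x * g x \<le> (\<Sum>x=0..int N. r powi x * g x)"
        using r g0 by (intro member_le_sum) (auto intro!: mult_nonneg_nonneg zero_le_power_int)
      then show ?thesis using C by (simp add: G_def C_def)
    next
      case False
      then have "(x + 1) * (int N - x) \<le> 0" by (auto intro: mult_nonneg_nonpos mult_nonpos_nonneg)
      then have "g x \<le> 0" unfolding g_def by (metis of_int_le_0_iff)
      then have "r powi x * g x \<le> 0" using r by (intro mult_nonneg_nonpos) (auto intro: zero_le_power_int)
      then show ?thesis using C unfolding G_def by (smt (verit) divide_nonpos_pos)
    qed
    moreover have "0 < measure \<alpha> {p. p * G (x + 1) + (1 - p) * G (x - 1) > \<kappa>' * G x}" if x: "0 \<le> x" "x < int N" for x
    proof (rule affine_above_saddle[OF qm])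
      have "q * G (x + 1) + (1 - q) * G (x - 1) = r powi x / C * (q * r * g (x + 1) + (1 - q) / r * g (x - 1))"
        using r C by (simp add: G_def power_int_add power_int_diff field_simps)
      also have "\<dots> = r powi x / C * (\<kappa> / 2 * (g (x + 1) + g (x - 1)))" unfolding qr qr' by (simp add: algebra_simps)
      also have "g (x + 1) + g (x - 1) = 2 * (g x - 1)" by (simp add: g_def algebra_simps)
      also have "\<kappa> / 2 * (2 * (g x - 1)) = \<kappa> * (g x - 1)" by simp
      finally have eq: "q * G (x + 1) + (1 - q) * G (x - 1) = r powi x / C * (\<kappa> * (g x - 1))" .
      have "\<kappa>' * g x < \<kappa> * (g x - 1)"
      proof -
        have "(\<kappa> - \<kappa>') * N \<le> (\<kappa> - \<kappa>') * g x" using gN[OF x] \<kappa>' by (intro mult_left_mono) auto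
        moreover have "\<kappa> < (\<kappa> - \<kappa>') * N" using N \<kappa>' by (simp add: field_simps)
        ultimately show ?thesis by (simp add: algebra_simps)
      qed
      then have "r powi x / C * (\<kappa>' * g x) < r powi x / C * (\<kappa> * (g x - 1))"
        using r C by (intro mult_strict_left_mono) auto
      then show "q * G (x + 1) + (1 - q) * G (x - 1) > \<kappa>' * G x"
        unfolding eq by (simp add: G_def mult_ac)
    qed
    moreover have "G 0 > 0" using C gN[of 0] Npos by (auto simp: G_def g_def)
    moreover have "G (-1) = 0" "G (int N) = 0" by (auto simp: G_def g_def)
    ultimately show ?thesis using Npos by blast
  qed
  ultimately show ?thesis using r \<kappa> by blast
qed

section \<open>Annealed bridge and walk probabilities\<close>

definition bridge_prob :: "nat \<Rightarrow> int \<Rightarrow> real" where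
  "bridge_prob t y = (\<integral>\<omega>. bridge \<omega> y t 0 \<partial>env_law \<alpha>)"

definition walk_prob :: "nat \<Rightarrow> int \<Rightarrow> real" where
  "walk_prob n y = (\<integral>\<omega>. kernel \<omega> n 0 y \<partial>env_law \<alpha>)"

lemma prob_env: "prob_space (env_law \<alpha>)"
  by (rule prob_space_env_law[OF \<alpha>_prob])

lemma AE_env:
  assumes "AE p in \<alpha>. P p"
  shows "AE \<omega> in env_law \<alpha>. \<forall>x. P (\<omega> x)"
  unfolding AE_all_countable env_law_def using assms \<alpha>_prob by (auto intro: AE_PiM_component)

lemma AE_env_elliptic: "AE \<omega> in env_law \<alpha>. (\<forall>x. c \<le> \<omega> x) \<and> (\<forall>x. 0 \<le> \<omega> x) \<and> (\<forall>x. \<omega> x \<le> 1)"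
  using AE_env[OF elliptic_AE] by eventually_elim (use c_pos in \<open>auto intro: order_trans[of _ c] simp: le_diff_eq order_trans[OF _ diff_ge_0_iff_ge[THEN iffD1]]; smt (verit)\<close>)

lemma measurable_component: "(\<lambda>\<omega>. \<omega> x) \<in> borel_measurable (Pi\<^sub>M J (\<lambda>_. \<alpha>))" if "x \<in> J"
  using measurable_component_singleton[OF that, of "\<lambda>_. \<alpha>"] by (simp add: measurable_cong_sets[OF refl \<alpha>_sets])

lemma measurable_bridge:
  "{z..<z + y} \<subseteq> J \<Longrightarrow> (\<lambda>\<omega>. bridge (shift_env z \<omega>) y t x) \<in> borel_measurable (Pi\<^sub>M J (\<lambda>_. \<alpha>))"
proof (induction t arbitrary: x)
  case (Suc t)
  show ?case
  proof (cases "0 \<le> x \<and> x < y")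
    case True
    then have "x + z \<in> J" using Suc.prems by auto
    note m = measurable_component[OF this] Suc.IH[OF Suc.prems]
    have "(\<lambda>\<omega>. bridge (shift_env z \<omega>) y (Suc t) x) = (\<lambda>\<omega>. \<omega> (x + z) * bridge (shift_env z \<omega>) y t (x + 1) + (1 - \<omega> (x + z)) * bridge (shift_env z \<omega>) y t (x - 1))"
      using True by simp
    also have "\<dots> \<in> borel_measurable (Pi\<^sub>M J (\<lambda>_. \<alpha>))"
      by (intro borel_measurable_add borel_measurable_times borel_measurable_diff m borel_measurable_const)
    finally show ?thesis .
  next
    case False
    then have "(\<lambda>\<omega>. bridge (shift_env z \<omega>) y (Suc t) x) = (\<lambda>_. 0)" by (auto simp: fun_eq_iff)
    then show ?thesis by simp
  qed
qed simp

lemma measurable_bridge': "(\<lambda>\<omega>. bridge (shift_env z \<omega>) y t x) \<in> borel_measurable (env_law \<alpha>)"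
  unfolding env_law_def by (rule measurable_bridge) simp

lemma measurable_bridge0: "(\<lambda>\<omega>. bridge \<omega> y t x) \<in> borel_measurable (env_law \<alpha>)"
  using measurable_bridge'[of 0] by simp

lemma measurable_kernel: "(\<lambda>\<omega>. kernel \<omega> t x y) \<in> borel_measurable (env_law \<alpha>)"
proof (induction t arbitrary: x)
  case (Suc t)
  have "(\<lambda>\<omega>. \<omega> x) \<in> borel_measurable (env_law \<alpha>)" unfolding env_law_def by (rule measurable_component) simp
  with Suc show ?case unfolding kernel.simps
    by (intro borel_measurable_add borel_measurable_times borel_measurable_diff borel_measurable_const)
qed simp

lemma integrable_kernel: "integrable (env_law \<alpha>) (\<lambda>\<omega>. kernel \<omega> t x y)"
proof -
  interpret E: prob_space "env_law \<alpha>" by (rule prob_env)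
  show ?thesis
  proof (rule E.integrable_const_bound[where B=1, OF _ measurable_kernel])
    show "AE \<omega> in env_law \<alpha>. norm (kernel \<omega> t x y) \<le> 1"
      using AE_env_elliptic by eventually_elim (auto simp: kernel_nonneg kernel_le_1)
  qed
qed

lemma bridge_le_1: "(\<And>x. 0 \<le> \<omega> x) \<Longrightarrow> (\<And>x. \<omega> x \<le> 1) \<Longrightarrow> bridge \<omega> y t x \<le> 1"
  using bridge_le_kernel[of \<omega> y t x] kernel_le_1[of \<omega> t x y] by simp

lemma integrable_bridge: "integrable (env_law \<alpha>) (\<lambda>\<omega>. bridge (shift_env z \<omega>) y t x)"
proof -
  interpret E: prob_space "env_law \<alpha>" by (rule prob_env)
  show ?thesis
  proof (rule E.integrable_const_bound[where B=1, OF _ measurable_bridge'])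
    show "AE \<omega> in env_law \<alpha>. norm (bridge (shift_env z \<omega>) y t x) \<le> 1"
      using AE_env_elliptic by eventually_elim (auto simp: bridge_nonneg bridge_le_1)
  qed
qed

lemma integrable_bridge0: "integrable (env_law \<alpha>) (\<lambda>\<omega>. bridge \<omega> y t x)"
  using integrable_bridge[of 0] by simp

lemma integral_env_shift:
  fixes f :: "environment \<Rightarrow> real"
  assumes "f \<in> borel_measurable (env_law \<alpha>)"
  shows "(\<integral>\<omega>. f (shift_env z \<omega>) \<partial>env_law \<alpha>) = (\<integral>\<omega>. f \<omega> \<partial>env_law \<alpha>)"
proof -
  have s: "sets (env_law \<alpha>) = sets env_space" by (rule sets_env_law[OF \<alpha>_sets])
  have "shift_env z \<in> env_law \<alpha> \<rightarrow>\<^sub>M env_space"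
    unfolding measurable_cong_sets[OF s refl] by (rule measurable_PiM_single') (auto simp: space_PiM)
  moreover have "f \<in> borel_measurable env_space" using assms by (simp add: measurable_cong_sets[OF s refl])
  ultimately have "(\<integral>\<omega>. f (shift_env z \<omega>) \<partial>env_law \<alpha>) = (\<integral>\<omega>. f \<omega> \<partial>distr (env_law \<alpha>) env_space (shift_env z))"
    by (subst integral_distr) auto
  then show ?thesis by (simp add: env_law_shift[OF \<alpha>_prob \<alpha>_sets])
qed

lemma walk_prob_shift: "(\<integral>\<omega>. kernel \<omega> n x y \<partial>env_law \<alpha>) = walk_prob n (y - x)"
proof -
  have "walk_prob n (y - x) = (\<integral>\<omega>. kernel (shift_env x \<omega>) n 0 (y - x) \<partial>env_law \<alpha>)"
    unfolding walk_prob_def by (rule integral_env_shift[OF measurable_kernel, symmetric])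
  then show ?thesis by (simp add: kernel_shift)
qed

lemma bridge_prob_nonneg: "0 \<le> bridge_prob t y"
  unfolding bridge_prob_def using AE_env_elliptic by (intro integral_nonneg_AE) (auto elim!: AE_mp simp: bridge_nonneg)

lemma bridge_prob_far: "y > int t \<Longrightarrow> bridge_prob t y = 0"
  by (simp add: bridge_prob_def bridge_far)

lemma bridge_prob_le_walk_prob: "bridge_prob t y \<le> walk_prob t y"
  unfolding bridge_prob_def walk_prob_def using AE_env_elliptic
  by (intro integral_mono_AE integrable_kernel integrable_bridge0) (auto elim!: AE_mp simp: bridge_le_kernel)

lemma walk_prob_nonneg: "0 \<le> walk_prob t y"
  using order_trans[OF bridge_prob_nonneg bridge_prob_le_walk_prob] .

lemma bridge_prob_straight: "c ^ t \<le> bridge_prob t (int t)"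
proof -
  interpret E: prob_space "env_law \<alpha>" by (rule prob_env)
  have "(\<integral>\<omega>. c ^ t \<partial>env_law \<alpha>) \<le> bridge_prob t (int t)"
    unfolding bridge_prob_def
  proof (intro integral_mono_AE integrable_bridge0)
    show "AE \<omega> in env_law \<alpha>. c ^ t \<le> bridge \<omega> (int t) t 0"
      using AE_env_elliptic
    proof eventually_elim
      case (elim \<omega>)
      then show ?case using bridge_straight[of \<omega> c 0 t] c_pos by auto
    qed
  qed simp
  then show ?thesis by (simp add: E.prob_space)
qed

text \<open>The first bridge reads sites left of \<open>y\<close>, the second sites from
  \<open>y\<close> on. Hence the annealed expectation of the quenched product factorises, although
  the annealed walk itself is not Markov.\<close>

lemma bridge_prob_concat: "(\<Sum>y=0..Y. bridge_prob t y * bridge_prob t' (Y - y)) \<le> bridge_prob (t + t') Y"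
proof -
  interpret E: prob_space "env_law \<alpha>" by (rule prob_env)
  let ?F = "\<lambda>y \<omega>. bridge \<omega> y t 0 * bridge (shift_env y \<omega>) (Y - y) t' 0"
  have int: "integrable (env_law \<alpha>) (?F y)" for y
  proof (rule E.integrable_const_bound[where B=1])
    show "AE \<omega> in env_law \<alpha>. norm (?F y \<omega>) \<le> 1"
      using AE_env_elliptic by eventually_elim (auto simp: abs_mult bridge_nonneg bridge_le_1 mult_le_one)
    show "?F y \<in> borel_measurable (env_law \<alpha>)"
      by (intro borel_measurable_times measurable_bridge0 measurable_bridge')
  qed
  have prod: "bridge_prob t y * bridge_prob t' (Y - y) = (\<integral>\<omega>. ?F y \<omega> \<partial>env_law \<alpha>)" if y: "y \<in> {0..Y}" for y
  proof -
    have b2: "bridge_prob t' (Y - y) = (\<integral>\<omega>. bridge (shift_env y \<omega>) (Y - y) t' 0 \<partial>env_law \<alpha>)"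
      unfolding bridge_prob_def by (rule integral_env_shift[OF measurable_bridge0, symmetric])
    have "(\<integral>\<omega>. ?F y \<omega> \<partial>env_law \<alpha>) = (\<integral>\<omega>. bridge \<omega> y t 0 \<partial>env_law \<alpha>) * (\<integral>\<omega>. bridge (shift_env y \<omega>) (Y - y) t' 0 \<partial>env_law \<alpha>)"
      unfolding env_law_def
    proof (rule integral_PiM_disjoint[where J="{..<y}" and K="{y..}"])
      show "(\<lambda>\<omega>. bridge \<omega> y t 0) \<in> borel_measurable (\<Pi>\<^sub>M x\<in>{..<y}. \<alpha>)"
        using measurable_bridge[of 0 y "{..<y}" t 0] by (simp add: subset_eq)
      show "(\<lambda>\<omega>. bridge (shift_env y \<omega>) (Y - y) t' 0) \<in> borel_measurable (\<Pi>\<^sub>M x\<in>{y..}. \<alpha>)"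
        by (rule measurable_bridge) auto
      show "bridge (restrict \<omega> {..<y}) y t 0 = bridge \<omega> y t 0" for \<omega>
        by (rule bridge_cong) auto
      show "bridge (shift_env y (restrict \<omega> {y..})) (Y - y) t' 0 = bridge (shift_env y \<omega>) (Y - y) t' 0" for \<omega>
        by (rule bridge_cong) auto
      show "integrable (\<Pi>\<^sub>M x\<in>UNIV. \<alpha>) (\<lambda>\<omega>. bridge \<omega> y t 0)" using integrable_bridge0 by (simp add: env_law_def)
      show "integrable (\<Pi>\<^sub>M x\<in>UNIV. \<alpha>) (\<lambda>\<omega>. bridge (shift_env y \<omega>) (Y - y) t' 0)"
        using integrable_bridge by (simp add: env_law_def)
    qed (auto simp: \<alpha>_prob)
    then show ?thesis unfolding b2 unfolding bridge_prob_def by simp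
  qed
  have "(\<Sum>y=0..Y. bridge_prob t y * bridge_prob t' (Y - y)) = (\<integral>\<omega>. (\<Sum>y=0..Y. ?F y \<omega>) \<partial>env_law \<alpha>)"
    using int by (simp add: prod Bochner_Integration.integral_sum)
  also have "\<dots> \<le> bridge_prob (t + t') Y"
    unfolding bridge_prob_def
  proof (intro integral_mono_AE integrable_bridge0 Bochner_Integration.integrable_sum int)
    show "AE \<omega> in env_law \<alpha>. (\<Sum>y=0..Y. ?F y \<omega>) \<le> bridge \<omega> Y (t + t') 0"
      using AE_env_elliptic by eventually_elim (auto intro: bridge_concat)
  qed
  finally show ?thesis .
qed

lemma bridge_prob_return:
  assumes r: "r > 0" and super: "AE p in \<alpha>. p * r + (1 - p) / r \<le> \<kappa>"
  shows "bridge_prob t y \<le> \<kappa> ^ t * r powi (- y)"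
proof -
  interpret E: prob_space "env_law \<alpha>" by (rule prob_env)
  have "bridge_prob t y \<le> (\<integral>\<omega>. \<kappa> ^ t * r powi (- y) \<partial>env_law \<alpha>)"
    unfolding bridge_prob_def
  proof (intro integral_mono_AE integrable_bridge0)
    show "AE \<omega> in env_law \<alpha>. bridge \<omega> y t 0 \<le> \<kappa> ^ t * r powi (- y)"
      using AE_env_elliptic AE_env[OF super]
    proof eventually_elim
      case (elim \<omega>)
      then show ?case using bridge_le_kernel[of \<omega> y t 0] kernel_return_le[of \<omega> r \<kappa> t 0 y] r by auto
    qed
  qed simp
  then show ?thesis by (simp add: E.prob_space)
qed

lemma walk_prob_le_bridge_prob:
  assumes r: "r > 0" and super: "AE p in \<alpha>. p * r + (1 - p) / r \<le> \<kappa>" and y: "0 \<le> y"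
  shows "walk_prob T y \<le> (\<Sum>t\<le>T. \<Sum>s\<le>t. \<kappa> ^ (T - (t - s)) * bridge_prob (t - s) y)"
proof -
  have "walk_prob T y \<le> (\<integral>\<omega>. (\<Sum>t\<le>T. \<Sum>s\<le>t. \<kappa> ^ (T - (t - s)) * bridge \<omega> y (t - s) 0) \<partial>env_law \<alpha>)"
    unfolding walk_prob_def
  proof (intro integral_mono_AE integrable_kernel)
    show "AE \<omega> in env_law \<alpha>. kernel \<omega> T 0 y \<le> (\<Sum>t\<le>T. \<Sum>s\<le>t. \<kappa> ^ (T - (t - s)) * bridge \<omega> y (t - s) 0)"
      using AE_env_elliptic AE_env[OF super]
    proof eventually_elim
      case (elim \<omega>)
      show ?case by (rule kernel_le_bridge[OF _ _ r _ y]) (use elim in auto)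
    qed
  qed (auto intro!: Bochner_Integration.integrable_sum integrable_bridge0)
  then show ?thesis
    by (simp add: bridge_prob_def integrable_bridge0 Bochner_Integration.integral_sum Bochner_Integration.integrable_sum)
qed

text \<open>Only \<open>N\<close> sites are constrained, so the event that the environment forms the
  trap has a positive probability independent of \<open>s\<close>: the annealed law pays for the
  trap once, however long the walk waits in it.\<close>

lemma bridge_prob_trap:
  assumes N: "N > 0" and G: "\<And>x. G x \<le> 1" "G (-1) = 0" "G (int N) = 0" "G 0 > 0" and \<kappa>: "0 \<le> \<kappa>"
    and pos: "\<And>x. 0 \<le> x \<Longrightarrow> x < int N \<Longrightarrow> 0 < measure \<alpha> {p. p * G (x + 1) + (1 - p) * G (x - 1) > \<kappa> * G x}"
  shows "\<exists>D>0. \<forall>s. D * \<kappa> ^ s \<le> (\<Sum>y=int N..2 * int N. bridge_prob (s + N) y)"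
proof -
  interpret E: prob_space "env_law \<alpha>" by (rule prob_env)
  interpret a: prob_space \<alpha> by (rule \<alpha>_prob)
  let ?A = "\<lambda>x. {p. p * G (x + 1) + (1 - p) * G (x - 1) > \<kappa> * G x}"
  define E where "E = prod_emb UNIV (\<lambda>_. \<alpha>) {0..<int N} (\<Pi>\<^sub>E x\<in>{0..<int N}. ?A x)"
  have A: "?A x \<in> sets \<alpha>" for x by (simp add: \<alpha>_sets)
  have E: "E \<in> sets (env_law \<alpha>)" unfolding E_def env_law_def using A by (intro sets_PiM_I) auto
  have "emeasure (env_law \<alpha>) E = (\<Prod>x\<in>{0..<int N}. emeasure \<alpha> (?A x))"
    unfolding E_def env_law_def using A by (intro emeasure_PiM_emb \<alpha>_prob) auto
  also have "\<dots> = ennreal (\<Prod>x\<in>{0..<int N}. measure \<alpha> (?A x))"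
    by (simp add: a.emeasure_eq_measure prod_ennreal)
  finally have mE: "measure (env_law \<alpha>) E = (\<Prod>x\<in>{0..<int N}. measure \<alpha> (?A x))"
    by (simp add: E.emeasure_eq_measure prod_nonneg)
  have mpos: "measure (env_law \<alpha>) E > 0" unfolding mE using pos by (intro prod_pos) auto
  define D where "D = measure (env_law \<alpha>) E * (c ^ N * G 0)"
  have "D * \<kappa> ^ s \<le> (\<Sum>y=int N..2 * int N. bridge_prob (s + N) y)" for s
  proof -
    have "D * \<kappa> ^ s = (\<integral>\<omega>. c ^ N * \<kappa> ^ s * G 0 * indicator E \<omega> \<partial>env_law \<alpha>)"
      using E by (simp add: D_def)
    also have "\<dots> \<le> (\<integral>\<omega>. (\<Sum>y=int N..2 * int N. bridge \<omega> y (s + N) 0) \<partial>env_law \<alpha>)"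
    proof (rule integral_mono_AE)
      show "integrable (env_law \<alpha>) (\<lambda>\<omega>. c ^ N * \<kappa> ^ s * G 0 * indicator E \<omega>)"
        using E by (intro integrable_mult_right E.integrable_const_bound[where B=1]) (auto simp: indicator_def)
      show "AE \<omega> in env_law \<alpha>. c ^ N * \<kappa> ^ s * G 0 * indicator E \<omega> \<le> (\<Sum>y=int N..2 * int N. bridge \<omega> y (s + N) 0)"
        using AE_env_elliptic
      proof eventually_elim
        case (elim \<omega>)
        show ?case
        proof (cases "\<omega> \<in> E")
          case True
          have "\<omega> x \<in> ?A x" if "0 \<le> x" "x < int N" for x
            using True that by (auto simp: E_def prod_emb_def)
          then have "c ^ N * \<kappa> ^ s * G 0 \<le> (\<Sum>y=int N..2 * int N. bridge \<omega> y (s + N) 0)"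
            using elim c_pos \<kappa> G N by (intro bridge_trap) (auto intro: less_imp_le)
          then show ?thesis using True by simp
        next
          case False
          then show ?thesis using elim by (auto intro!: sum_nonneg bridge_nonneg)
        qed
      qed
    qed (auto intro!: Bochner_Integration.integrable_sum integrable_bridge0)
    also have "\<dots> = (\<Sum>y=int N..2 * int N. bridge_prob (s + N) y)"
      by (simp add: bridge_prob_def integrable_bridge0 Bochner_Integration.integral_sum)
    finally show ?thesis .
  qed
  moreover have "D > 0" using mpos c_pos G by (simp add: D_def)
  ultimately show ?thesis by blast
qed

text \<open>Walks to the left are treated by instantiating the locale at the reflected law with the
  same ellipticity constant.\<close>

lemma reflected: "elliptic_law (distr \<alpha> borel (\<lambda>p. 1 - p)) c"
proof -
  interpret a: prob_space \<alpha> by (rule \<alpha>_prob)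
  have m: "(\<lambda>p. 1 - p) \<in> \<alpha> \<rightarrow>\<^sub>M (borel :: real measure)" by (simp add: measurable_cong_sets[OF \<alpha>_sets refl])
  show ?thesis
  proof (rule elliptic_law.intro)
    show "prob_space (distr \<alpha> borel (\<lambda>p. 1 - p))" by (rule a.prob_space_distr[OF m])
    show "AE p in distr \<alpha> borel (\<lambda>p. 1 - p). c \<le> p \<and> p \<le> 1 - c"
      using elliptic_AE by (subst AE_distr_iff[OF m]) (auto elim!: AE_mp)
  qed (use c_pos in auto)
qed

lemma walk_prob_reflect: "elliptic_law.walk_prob (distr \<alpha> borel (\<lambda>p. 1 - p)) n y = walk_prob n (- y)"
proof -
  interpret R: elliptic_law "distr \<alpha> borel (\<lambda>p. 1 - p)" c by (rule reflected)
  have s: "sets (env_law \<alpha>) = sets env_space" by (rule sets_env_law[OF \<alpha>_sets])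
  have m: "(\<lambda>\<omega> x. 1 - \<omega> (- x)) \<in> env_law \<alpha> \<rightarrow>\<^sub>M env_space"
    unfolding measurable_cong_sets[OF s refl] by (rule measurable_PiM_single') (auto simp: space_PiM)
  have "R.walk_prob n y = (\<integral>\<omega>. kernel (\<lambda>x. 1 - \<omega> (- x)) n 0 y \<partial>env_law \<alpha>)"
    unfolding R.walk_prob_def env_law_reflect[OF \<alpha>_prob \<alpha>_sets]
    using measurable_kernel[of n 0 y] by (subst integral_distr[OF m]) (auto simp: measurable_cong_sets[OF s refl])
  then show ?thesis by (simp add: kernel_reflect walk_prob_def)
qed

end

section \<open>The exponential rate of bridges\<close>

context elliptic_law
begin

lemma bridge_prob_neg: "y < 0 \<Longrightarrow> bridge_prob t y = 0"
proof -
  assume "y < 0"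
  then have "bridge \<omega> y t 0 = 0" for \<omega> by (cases t) auto
  then show ?thesis by (simp add: bridge_prob_def)
qed

lemma bridge_prob_0: "bridge_prob 0 y = of_bool (y = 0)"
proof -
  interpret E: prob_space "env_law \<alpha>" by (rule prob_env)
  show ?thesis by (auto simp: bridge_prob_def E.prob_space)
qed

lemma bridge_prob_concat': "(\<Sum>z=0..int t. bridge_prob t z * bridge_prob t' (Y - z)) \<le> bridge_prob (t + t') Y"
proof -
  have "(\<Sum>z=0..int t. bridge_prob t z * bridge_prob t' (Y - z)) = (\<Sum>z\<in>{0..int t} \<inter> {0..Y}. bridge_prob t z * bridge_prob t' (Y - z))"
    by (intro sum.mono_neutral_right) (auto simp: bridge_prob_neg)
  also have "\<dots> \<le> (\<Sum>z=0..Y. bridge_prob t z * bridge_prob t' (Y - z))"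
    by (intro sum_mono2) (auto simp: bridge_prob_nonneg)
  also have "\<dots> \<le> bridge_prob (t + t') Y" by (rule bridge_prob_concat)
  finally show ?thesis .
qed

text \<open>Unnormalised: the value at \<theta> = 0 is the annealed probability that a path of
  \<open>t\<close> steps is a bridge to some endpoint.\<close>

definition bridge_mgf :: "nat \<Rightarrow> real \<Rightarrow> real" where
  "bridge_mgf t \<theta> = (\<Sum>y=0..int t. exp (\<theta> * of_int y) * bridge_prob t y)"

lemma bridge_mgf_ge: "(c * exp \<theta>) ^ t \<le> bridge_mgf t \<theta>"
proof -
  have "(c * exp \<theta>) ^ t \<le> exp (\<theta> * of_int (int t)) * bridge_prob t (int t)"
    using bridge_prob_straight[of t] by (simp add: power_mult_distrib exp_of_nat_mult[symmetric] mult.commute)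
  also have "\<dots> \<le> bridge_mgf t \<theta>" unfolding bridge_mgf_def by (intro member_le_sum) (auto simp: bridge_prob_nonneg)
  finally show ?thesis .
qed

lemma bridge_mgf_pos: "0 < bridge_mgf t \<theta>"
  using bridge_mgf_ge[of \<theta> t] c_pos by (meson exp_gt_zero less_le_trans mult_pos_pos zero_less_power)

lemma bridge_mgf_0: "bridge_mgf 0 \<theta> = 1"
  by (simp add: bridge_mgf_def bridge_prob_0)

lemma bridge_prob_le_1: "bridge_prob t y \<le> 1"
proof -
  interpret E: prob_space "env_law \<alpha>" by (rule prob_env)
  have "bridge_prob t y \<le> (\<integral>\<omega>. 1 \<partial>env_law \<alpha>)" unfolding bridge_prob_def
    using AE_env_elliptic by (intro integral_mono_AE integrable_bridge0) (auto elim!: AE_mp simp: bridge_le_1)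
  then show ?thesis by (simp add: E.prob_space)
qed

lemma bridge_mgf_le: "bridge_mgf t \<theta> \<le> (t + 1) * exp (\<bar>\<theta>\<bar> * t)"
proof -
  have "bridge_mgf t \<theta> \<le> (\<Sum>y=0..int t. exp (\<bar>\<theta>\<bar> * t) * 1)"
    unfolding bridge_mgf_def
  proof (intro sum_mono mult_mono bridge_prob_le_1 bridge_prob_nonneg)
    fix y assume "y \<in> {0..int t}"
    then have "\<theta> * of_int y \<le> \<bar>\<theta>\<bar> * of_int y" "\<bar>\<theta>\<bar> * of_int y \<le> \<bar>\<theta>\<bar> * t"
      by (auto intro!: mult_right_mono mult_left_mono)
    then show "exp (\<theta> * of_int y) \<le> exp (\<bar>\<theta>\<bar> * t)" by simp
  qed auto
  then show ?thesis by simp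
qed

text \<open>Independence of adjacent bridges becomes supermultiplicativity, since the tilt splits
  over the two displacements.\<close>

lemma bridge_mgf_mult: "bridge_mgf s \<theta> * bridge_mgf t \<theta> \<le> bridge_mgf (s + t) \<theta>"
proof -
  have shift: "bridge_mgf t \<theta> \<le> (\<Sum>Y=0..int (s + t). exp (\<theta> * of_int (Y - z)) * bridge_prob t (Y - z))" if z: "z \<in> {0..int s}" for z
  proof -
    have "bridge_mgf t \<theta> = (\<Sum>Y=z..z + int t. exp (\<theta> * of_int (Y - z)) * bridge_prob t (Y - z))"
      unfolding bridge_mgf_def by (intro sum.reindex_bij_witness[of _ "\<lambda>Y. Y - z" "\<lambda>y. y + z"]) auto
    also have "\<dots> \<le> (\<Sum>Y=0..int (s + t). exp (\<theta> * of_int (Y - z)) * bridge_prob t (Y - z))"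
      using z by (intro sum_mono2) (auto simp: bridge_prob_nonneg)
    finally show ?thesis .
  qed
  have "bridge_mgf s \<theta> * bridge_mgf t \<theta> = (\<Sum>z=0..int s. exp (\<theta> * of_int z) * bridge_prob s z * bridge_mgf t \<theta>)"
    unfolding bridge_mgf_def[of s] by (simp add: sum_distrib_right)
  also have "\<dots> \<le> (\<Sum>z=0..int s. exp (\<theta> * of_int z) * bridge_prob s z * (\<Sum>Y=0..int (s + t). exp (\<theta> * of_int (Y - z)) * bridge_prob t (Y - z)))"
    by (intro sum_mono mult_left_mono shift) (auto simp: bridge_prob_nonneg)
  also have "\<dots> = (\<Sum>z=0..int s. \<Sum>Y=0..int (s + t). exp (\<theta> * of_int Y) * (bridge_prob s z * bridge_prob t (Y - z)))"
  proof (intro sum.cong refl, unfold sum_distrib_left, intro sum.cong refl)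
    fix z Y
    have "exp (\<theta> * of_int Y) = exp (\<theta> * of_int z) * exp (\<theta> * of_int (Y - z))" by (simp add: algebra_simps flip: exp_add)
    then show "exp (\<theta> * of_int z) * bridge_prob s z * (exp (\<theta> * of_int (Y - z)) * bridge_prob t (Y - z)) = exp (\<theta> * of_int Y) * (bridge_prob s z * bridge_prob t (Y - z))"
      by simp
  qed
  also have "\<dots> = (\<Sum>Y=0..int (s + t). exp (\<theta> * of_int Y) * (\<Sum>z=0..int s. bridge_prob s z * bridge_prob t (Y - z)))"
    by (subst sum.swap) (simp add: sum_distrib_left)
  also have "\<dots> \<le> bridge_mgf (s + t) \<theta>"
    unfolding bridge_mgf_def by (intro sum_mono mult_left_mono bridge_prob_concat') auto
  finally show ?thesis .
qed

lemma bridge_mgf_power: "bridge_mgf L \<theta> ^ N \<le> bridge_mgf (N * L) \<theta>"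
proof (induction N)
  case (Suc N)
  have "bridge_mgf L \<theta> ^ Suc N \<le> bridge_mgf L \<theta> * bridge_mgf (N * L) \<theta>" using Suc bridge_mgf_pos[of L \<theta>] by simp
  also have "\<dots> \<le> bridge_mgf (L + N * L) \<theta>" by (rule bridge_mgf_mult)
  finally show ?case by simp
qed (simp add: bridge_mgf_0)

text \<open>By superadditivity this supremum is also the limit; as a supremum it bounds
  \<open>bridge_mgf\<close> at every time without an error term.\<close>

definition \<beta> :: "real \<Rightarrow> real" where
  "\<beta> \<theta> = (SUP t\<in>{1..}. ln (bridge_mgf t \<theta>) / real t)"

lemma ln_bridge_mgf_div_le: "t \<ge> 1 \<Longrightarrow> ln (bridge_mgf t \<theta>) / real t \<le> \<bar>\<theta>\<bar> + 1"
proof -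
  assume t: "t \<ge> 1"
  have "ln (bridge_mgf t \<theta>) \<le> ln ((t + 1) * exp (\<bar>\<theta>\<bar> * t))" using bridge_mgf_le[of t \<theta>] bridge_mgf_pos by (subst ln_le_cancel_iff) (auto simp: add.commute)
  also have "\<dots> = ln (t + 1) + \<bar>\<theta>\<bar> * t" by (simp add: ln_mult)
  also have "ln (t + 1) \<le> real t" using ln_le_minus_one[of "real t + 1"] by (simp add: add.commute)
  finally show ?thesis using t by (simp add: field_simps)
qed

lemma \<beta>_bdd: "bdd_above ((\<lambda>t. ln (bridge_mgf t \<theta>) / real t) ` {1..})"
  using ln_bridge_mgf_div_le by (auto intro!: bdd_aboveI2)

lemma ln_bridge_mgf_le_\<beta>: "t \<ge> 1 \<Longrightarrow> ln (bridge_mgf t \<theta>) / real t \<le> \<beta> \<theta>"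
  unfolding \<beta>_def by (intro cSUP_upper \<beta>_bdd) auto

lemma bridge_mgf_le_\<beta>: "bridge_mgf t \<theta> \<le> exp (t * \<beta> \<theta>)"
proof (cases "t = 0")
  case False
  then have "ln (bridge_mgf t \<theta>) \<le> t * \<beta> \<theta>" using ln_bridge_mgf_le_\<beta>[of t \<theta>] by (simp add: field_simps)
  then show ?thesis using bridge_mgf_pos[of t \<theta>] by (metis exp_le_cancel_iff exp_ln)
qed (simp add: bridge_mgf_0)

lemma \<beta>_lower: "\<beta> \<theta> \<ge> \<theta> + ln c"
proof -
  have "\<theta> + ln c = ln ((c * exp \<theta>) ^ 1) / real 1" using c_pos by (simp add: ln_mult)
  also have "\<dots> \<le> ln (bridge_mgf 1 \<theta>) / real 1"
    using bridge_mgf_ge[of \<theta> 1] bridge_mgf_pos[of 1 \<theta>] c_pos by (simp only: of_nat_1 div_by_1) (subst ln_le_cancel_iff, auto)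
  also have "\<dots> \<le> \<beta> \<theta>" by (rule ln_bridge_mgf_le_\<beta>) simp
  finally show ?thesis .
qed

text \<open>Fekete's argument: repeat a nearly optimal duration \<open>L\<close> and fill the
  remainder of T modulo \<open>L\<close> by a straight run.\<close>

lemma ln_bridge_mgf_limit: "(\<lambda>t. ln (bridge_mgf t \<theta>) / real t) \<longlonglongrightarrow> \<beta> \<theta>"
proof (rule LIMSEQ_I)
  fix e :: real assume e: "e > 0"
  obtain L where L: "L \<ge> 1" "\<beta> \<theta> - e / 2 < ln (bridge_mgf L \<theta>) / real L"
    using less_cSUP_iff[OF _ \<beta>_bdd, of "\<beta> \<theta> - e / 2" \<theta>] e unfolding \<beta>_def[symmetric] by auto
  \<comment> \<open>Bounds what the remainder, shorter than L, can lose: its share of \<beta> and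
    the cost of the straight run.\<close>
  define K where "K = L * (\<bar>\<beta> \<theta>\<bar> + \<bar>\<theta> + ln c\<bar>)"
  have K: "K \<ge> 0" by (simp add: K_def)
  obtain T0 :: nat where T0: "2 * K / e < T0" using reals_Archimedean2 by blast
  have "\<bar>ln (bridge_mgf T \<theta>) / T - \<beta> \<theta>\<bar> < e" if T: "T \<ge> max 1 T0" for T
  proof -
    define N where "N = T div L"
    define \<rho> where "\<rho> = T mod L"
    have TN: "T = N * L + \<rho>" "\<rho> < L" using L(1) by (auto simp: N_def \<rho>_def)
    have "bridge_mgf L \<theta> ^ N * (c * exp \<theta>) ^ \<rho> \<le> bridge_mgf (N * L) \<theta> * bridge_mgf \<rho> \<theta>"
      using bridge_mgf_pos[of L] bridge_mgf_pos[of "N * L"] c_pos by (intro mult_mono bridge_mgf_power bridge_mgf_ge) (auto intro: less_imp_le)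
    also have "\<dots> \<le> bridge_mgf T \<theta>" unfolding TN(1) by (rule bridge_mgf_mult)
    finally have "ln (bridge_mgf L \<theta> ^ N * (c * exp \<theta>) ^ \<rho>) \<le> ln (bridge_mgf T \<theta>)"
      using bridge_mgf_pos c_pos by (subst ln_le_cancel_iff) auto
    then have "N * ln (bridge_mgf L \<theta>) + \<rho> * (\<theta> + ln c) \<le> ln (bridge_mgf T \<theta>)"
      using bridge_mgf_pos[of L \<theta>] c_pos by (simp add: ln_mult ln_realpow add.commute)
    moreover have "N * (L * (\<beta> \<theta> - e / 2)) \<le> N * ln (bridge_mgf L \<theta>)"
      using L by (intro mult_left_mono) (auto simp: field_simps)
    moreover have "N * (L * (\<beta> \<theta> - e / 2)) \<ge> T * (\<beta> \<theta> - e / 2) - L * \<bar>\<beta> \<theta>\<bar>"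
    proof -
      have "\<rho> * \<beta> \<theta> \<le> \<rho> * \<bar>\<beta> \<theta>\<bar>" by (intro mult_left_mono) auto
      moreover have "\<rho> * \<bar>\<beta> \<theta>\<bar> \<le> L * \<bar>\<beta> \<theta>\<bar>" using TN(2) by (intro mult_right_mono) auto
      moreover have "0 \<le> \<rho> * (e / 2)" using e by simp
      ultimately show ?thesis unfolding TN(1) by (simp add: algebra_simps)
    qed
    moreover have "\<rho> * (\<theta> + ln c) \<ge> - (L * \<bar>\<theta> + ln c\<bar>)"
    proof -
      have "\<rho> * (- (\<theta> + ln c)) \<le> \<rho> * \<bar>\<theta> + ln c\<bar>" by (intro mult_left_mono) auto
      moreover have "\<rho> * \<bar>\<theta> + ln c\<bar> \<le> L * \<bar>\<theta> + ln c\<bar>" using TN(2) by (intro mult_right_mono) auto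
      ultimately show ?thesis unfolding mult_minus_right by linarith
    qed
    ultimately have "ln (bridge_mgf T \<theta>) \<ge> T * (\<beta> \<theta> - e / 2) - K" by (simp add: K_def algebra_simps)
    moreover have "K < T * (e / 2)"
    proof -
      have "2 * K / e < T" using T0 T by auto
      then show ?thesis using e by (simp add: field_simps)
    qed
    ultimately have "ln (bridge_mgf T \<theta>) > T * (\<beta> \<theta> - e)" by (simp add: algebra_simps)
    then have "ln (bridge_mgf T \<theta>) / T > \<beta> \<theta> - e" using T by (simp add: field_simps)
    moreover have "ln (bridge_mgf T \<theta>) / T \<le> \<beta> \<theta>" using T by (intro ln_bridge_mgf_le_\<beta>) auto
    ultimately show ?thesis using e by (simp add: abs_less_iff)
  qed
  then show "\<exists>no. \<forall>n\<ge>no. norm (ln (bridge_mgf n \<theta>) / n - \<beta> \<theta>) < e"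
    unfolding real_norm_def by blast
qed

lemma \<beta>_mono: "\<theta> \<le> \<theta>' \<Longrightarrow> \<beta> \<theta> \<le> \<beta> \<theta>'"
proof (rule LIMSEQ_le[OF ln_bridge_mgf_limit ln_bridge_mgf_limit])
  assume le: "\<theta> \<le> \<theta>'"
  have "bridge_mgf t \<theta> \<le> bridge_mgf t \<theta>'" for t
    unfolding bridge_mgf_def using le by (intro sum_mono mult_right_mono bridge_prob_nonneg) (auto intro!: mult_right_mono)
  then show "\<exists>N. \<forall>n\<ge>N. ln (bridge_mgf n \<theta>) / n \<le> ln (bridge_mgf n \<theta>') / n"
    using bridge_mgf_pos by (auto intro!: divide_right_mono)
qed

text \<open>At the tilt \<open>ln r\<close> the factor r^y cancels the power in the supersolution
  estimate, and the t + 1 endpoints only give a polynomial factor.\<close>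

lemma \<beta>_saddle_le:
  assumes r: "r > 0" and \<kappa>: "\<kappa> > 0" and super: "AE p in \<alpha>. p * r + (1 - p) / r \<le> \<kappa>"
  shows "\<beta> (ln r) \<le> ln \<kappa>"
proof -
  have "bridge_mgf t (ln r) \<le> (t + 1) * \<kappa> ^ t" for t
  proof -
    have "bridge_mgf t (ln r) \<le> (\<Sum>y=0..int t. \<kappa> ^ t)"
      unfolding bridge_mgf_def
    proof (rule sum_mono)
      fix y assume "y \<in> {0..int t}"
      have e: "exp (ln r * of_int y) = r powi y" using r using powr_real_of_int'[of r y] by (simp add: powr_def mult.commute)
      have "exp (ln r * of_int y) * bridge_prob t y \<le> r powi y * (\<kappa> ^ t * r powi (- y))"
        unfolding e using bridge_prob_return[OF r super, of t y] r by (intro mult_left_mono) auto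
      also have "\<dots> = \<kappa> ^ t" using r by (simp add: power_int_minus)
      finally show "exp (ln r * of_int y) * bridge_prob t y \<le> \<kappa> ^ t" .
    qed
    then show ?thesis by simp
  qed
  then have "ln (bridge_mgf t (ln r)) \<le> ln ((t + 1) * \<kappa> ^ t)" for t
    using bridge_mgf_pos \<kappa> by (subst ln_le_cancel_iff) auto
  then have le: "ln (bridge_mgf t (ln r)) / t \<le> ln (t + 1) / t + ln \<kappa>" if "t \<ge> 1" for t
  proof -
    have "ln ((real t + 1) * \<kappa> ^ t) = ln (real t + 1) + t * ln \<kappa>" using \<kappa> by (subst ln_mult) (auto simp: ln_realpow)
    then have "ln (bridge_mgf t (ln r)) \<le> ln (real t + 1) + t * ln \<kappa>" using \<open>\<And>t. ln (bridge_mgf t (ln r)) \<le> ln ((t + 1) * \<kappa> ^ t)\<close>[of t] by (simp add: add.commute)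
    then show ?thesis using that by (simp add: field_simps)
  qed
  have "(\<lambda>t. ln (real t + 1) / real t + ln \<kappa>) \<longlonglongrightarrow> 0 + ln \<kappa>"
    by (intro tendsto_add tendsto_const) real_asymp
  then show ?thesis
    using le by (intro LIMSEQ_le[OF ln_bridge_mgf_limit]) (auto simp: add.commute)
qed

text \<open>Trapped bridges end in [N, 2 N] whatever their duration, so every tilt changes their
  weight by a bounded factor and the rate is the same for all \<theta>.\<close>

lemma \<beta>_trap:
  assumes \<kappa>: "0 < \<kappa>'" and N: "N > 0" and G: "\<And>x. G x \<le> 1" "G (-1) = 0" "G (int N) = 0" "G 0 > 0"
    and pos: "\<And>x. 0 \<le> x \<Longrightarrow> x < int N \<Longrightarrow> 0 < measure \<alpha> {p. p * G (x + 1) + (1 - p) * G (x - 1) > \<kappa>' * G x}"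
  shows "ln \<kappa>' \<le> \<beta> \<theta>"
proof -
  obtain D where D: "D > 0" "\<And>s. D * \<kappa>' ^ s \<le> (\<Sum>y=int N..2 * int N. bridge_prob (s + N) y)"
    using bridge_prob_trap[OF N G _ pos] \<kappa> by auto
  define D' where "D' = D * exp (- (\<bar>\<theta>\<bar> * (2 * N)))"
  have D': "D' > 0" using D by (simp add: D'_def)
  have B: "D' * \<kappa>' ^ s \<le> bridge_mgf (s + N) \<theta>" if s: "s \<ge> N" for s
  proof -
    have "D' * \<kappa>' ^ s = exp (- (\<bar>\<theta>\<bar> * (2 * N))) * (D * \<kappa>' ^ s)" by (simp add: D'_def)
    also have "\<dots> \<le> exp (- (\<bar>\<theta>\<bar> * (2 * N))) * (\<Sum>y=int N..2 * int N. bridge_prob (s + N) y)"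
      by (intro mult_left_mono D) auto
    also have "\<dots> \<le> (\<Sum>y=int N..2 * int N. exp (\<theta> * of_int y) * bridge_prob (s + N) y)"
      unfolding sum_distrib_left
    proof (intro sum_mono mult_right_mono bridge_prob_nonneg)
      fix y assume y: "y \<in> {int N..2 * int N}"
      have "- \<theta> * of_int y \<le> \<bar>\<theta>\<bar> * of_int y" using y by (intro mult_right_mono) auto
      also have "\<dots> \<le> \<bar>\<theta>\<bar> * (2 * N)" using y by (intro mult_left_mono) auto
      finally show "exp (- (\<bar>\<theta>\<bar> * (2 * N))) \<le> exp (\<theta> * of_int y)" by simp
    qed
    also have "\<dots> \<le> bridge_mgf (s + N) \<theta>"
      unfolding bridge_mgf_def using s by (intro sum_mono2) (auto simp: bridge_prob_nonneg)
    finally show ?thesis .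
  qed
  have le: "(ln D' + s * ln \<kappa>') / real (s + N) \<le> ln (bridge_mgf (s + N) \<theta>) / real (s + N)" if "s \<ge> N" for s
  proof -
    have "ln (D' * \<kappa>' ^ s) \<le> ln (bridge_mgf (s + N) \<theta>)" using B[OF that] D' \<kappa> bridge_mgf_pos by (subst ln_le_cancel_iff) auto
    then show ?thesis using D' \<kappa> by (intro divide_right_mono) (auto simp: ln_mult ln_realpow)
  qed
  have "(\<lambda>s. (ln D' + real s * ln \<kappa>') / real (s + N)) \<longlonglongrightarrow> ln \<kappa>'"
    by real_asymp
  then show ?thesis
    using le by (intro LIMSEQ_le[OF _ LIMSEQ_ignore_initial_segment[OF ln_bridge_mgf_limit]]) auto
qed

text \<open>Let \<kappa>' increase to \<kappa>. Together with \<open>\<beta>_saddle_le\<close> this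
  identifies \<open>ln \<kappa>\<close> as the minimum of \<beta>, attained at
  \<open>ln r\<close>.\<close>

lemma saddle:
  "\<exists>r \<kappa>. r > 0 \<and> \<kappa> > 0 \<and> (AE p in \<alpha>. p * r + (1 - p) / r \<le> \<kappa>) \<and> (\<forall>\<theta>. ln \<kappa> \<le> \<beta> \<theta>)"
proof -
  obtain r \<kappa> where r: "r > 0" and \<kappa>: "\<kappa> > 0" and super: "AE p in \<alpha>. p * r + (1 - p) / r \<le> \<kappa>"
    and trap: "\<And>\<kappa>'. 0 < \<kappa>' \<Longrightarrow> \<kappa>' < \<kappa> \<Longrightarrow> \<exists>N>0. \<exists>G :: int \<Rightarrow> real. (\<forall>x. G x \<le> 1) \<and> G (-1) = 0 \<and> G (int N) = 0 \<and> G 0 > 0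
      \<and> (\<forall>x. 0 \<le> x \<and> x < int N \<longrightarrow> 0 < measure \<alpha> {p. p * G (x + 1) + (1 - p) * G (x - 1) > \<kappa>' * G x})"
    using saddle_rates by blast
  have le: "\<kappa>' \<le> exp (\<beta> \<theta>)" if tp: "0 < \<kappa>'" "\<kappa>' < \<kappa>" for \<kappa>' \<theta>
  proof -
    obtain N and G :: "int \<Rightarrow> real" where NG: "N > 0" "\<forall>x. G x \<le> 1" "G (-1) = 0" "G (int N) = 0" "G 0 > 0"
      "\<forall>x. 0 \<le> x \<and> x < int N \<longrightarrow> 0 < measure \<alpha> {p. p * G (x + 1) + (1 - p) * G (x - 1) > \<kappa>' * G x}"
      using trap[OF tp] by blast
    have "ln \<kappa>' \<le> \<beta> \<theta>" by (rule \<beta>_trap[where N=N and G=G]) (use NG tp in auto)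
    then show ?thesis using tp by (metis exp_le_cancel_iff exp_ln)
  qed
  have "\<kappa> \<le> exp (\<beta> \<theta>)" for \<theta>
  proof (rule dense_le_bounded[of 0])
    show "0 < \<kappa>" by (rule \<kappa>)
  qed (use le in auto)
  then have "ln \<kappa> \<le> \<beta> \<theta>" for \<theta> using \<kappa> by (metis exp_le_cancel_iff exp_ln)
  then show ?thesis using r \<kappa> super by blast
qed

end

section \<open>The static walk\<close>

lemma sum_kernel: "finite A \<Longrightarrow> {x - int n..x + int n} \<subseteq> A \<Longrightarrow> (\<Sum>y\<in>A. kernel \<omega> n x y) = 1"
proof (induction n arbitrary: x)
  case (Suc n)
  have "(\<Sum>y\<in>A. kernel \<omega> (Suc n) x y) = \<omega> x * (\<Sum>y\<in>A. kernel \<omega> n (x + 1) y) + (1 - \<omega> x) * (\<Sum>y\<in>A. kernel \<omega> n (x - 1) y)"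
    by (simp add: sum.distrib sum_distrib_left)
  also have "\<dots> = 1"
  proof -
    have "{x + 1 - int n..x + 1 + int n} \<subseteq> A" "{x - 1 - int n..x - 1 + int n} \<subseteq> A"
      using Suc.prems(2) by (auto simp: subset_eq)
    then show ?thesis using Suc.IH[of "x + 1"] Suc.IH[of "x - 1"] Suc.prems(1) by simp
  qed
  finally show ?case .
qed auto

context elliptic_law
begin

lemma sum_walk_prob:
  assumes "finite A" "{- int T..int T} \<subseteq> A"
  shows "(\<Sum>y\<in>A. walk_prob T y) = 1"
proof -
  interpret E: prob_space "env_law \<alpha>" by (rule prob_env)
  have "(\<Sum>y\<in>A. walk_prob T y) = (\<integral>\<omega>. (\<Sum>y\<in>A. kernel \<omega> T 0 y) \<partial>env_law \<alpha>)"
    unfolding walk_prob_def by (intro Bochner_Integration.integral_sum[symmetric] integrable_kernel)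
  also have "\<dots> = (\<integral>\<omega>. 1 \<partial>env_law \<alpha>)" using assms by (subst sum_kernel) auto
  finally show ?thesis by (simp add: E.prob_space)
qed

lemma walk_prob_far: "\<bar>y\<bar> > int T \<Longrightarrow> walk_prob T y = 0"
  by (simp add: walk_prob_def kernel_far)

section \<open>The annealed one-time laws and their exponential rate\<close>

definition rw :: "nat \<Rightarrow> int pmf" where
  "rw T = embed_pmf (walk_prob T)"

lemma pmf_rw: "pmf (rw T) y = walk_prob T y"
  unfolding rw_def
proof (rule pmf_embed_pmf)
  have "(\<integral>\<^sup>+ y. ennreal (walk_prob T y) \<partial>count_space UNIV) = (\<Sum>y\<in>{- int T..int T}. ennreal (walk_prob T y))"
    by (rule nn_integral_count_space'[where A="{- int T..int T}"]) (auto simp: walk_prob_far)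
  also have "\<dots> = ennreal (\<Sum>y\<in>{- int T..int T}. walk_prob T y)" by (rule sum_ennreal) (rule walk_prob_nonneg)
  also have "\<dots> = 1" by (simp add: sum_walk_prob)
  finally show "(\<integral>\<^sup>+ y. ennreal (walk_prob T y) \<partial>count_space UNIV) = 1" .
qed (rule walk_prob_nonneg)

lemma bounded_rw: "bounded_by T (rw T)"
  unfolding bounded_by_def
proof
  fix y assume "y \<in> set_pmf (rw T)"
  then have "walk_prob T y \<noteq> 0" by (simp add: set_pmf_iff pmf_rw)
  then have "\<not> \<bar>y\<bar> > int T" using walk_prob_far by blast
  then show "y \<in> {- int T..int T}" by auto
qed

lemma mgf_rw: "mgf (rw T) \<theta> = (\<Sum>y=- int T..int T. exp (\<theta> * of_int y) * walk_prob T y)"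
  unfolding mgf_def using bounded_rw[of T]
  by (subst integral_measure_pmf_real[where A="{- int T..int T}"]) (auto simp: bounded_by_def pmf_rw)

lemma mgf_rw_pos: "mgf (rw T) \<theta> > 0"
  by (rule mgf_pos[OF bounded_by_finite[OF bounded_rw]])

abbreviation \<alpha>' :: "real measure" where
  "\<alpha>' \<equiv> distr \<alpha> borel (\<lambda>p. 1 - p)"

lemma mgf_rw_split:
  "mgf (rw T) \<theta> \<le> (\<Sum>y=0..int T. exp (\<theta> * of_int y) * walk_prob T y) + (\<Sum>y=0..int T. exp (- \<theta> * of_int y) * elliptic_law.walk_prob \<alpha>' T y)"
proof -
  have "mgf (rw T) \<theta> = (\<Sum>y\<in>{0..int T} \<union> {- int T..-1}. exp (\<theta> * of_int y) * walk_prob T y)"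
    unfolding mgf_rw by (intro sum.cong) auto
  also have "\<dots> = (\<Sum>y=0..int T. exp (\<theta> * of_int y) * walk_prob T y) + (\<Sum>y=- int T..-1. exp (\<theta> * of_int y) * walk_prob T y)"
    by (rule sum.union_disjoint) auto
  also have "(\<Sum>y=- int T..-1. exp (\<theta> * of_int y) * walk_prob T y) = (\<Sum>y=1..int T. exp (- \<theta> * of_int y) * walk_prob T (- y))"
    by (rule sum.reindex_bij_witness[of _ uminus uminus]) auto
  also have "\<dots> \<le> (\<Sum>y=0..int T. exp (- \<theta> * of_int y) * walk_prob T (- y))"
    by (intro sum_mono2) (auto simp: walk_prob_nonneg)
  finally show ?thesis by (simp add: walk_prob_reflect)
qed

lemma bridge_mgf_le_mgf_rw: "bridge_mgf T \<theta> \<le> mgf (rw T) \<theta>"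
proof -
  have "bridge_mgf T \<theta> \<le> (\<Sum>y=0..int T. exp (\<theta> * of_int y) * walk_prob T y)"
    unfolding bridge_mgf_def by (intro sum_mono mult_left_mono bridge_prob_le_walk_prob) auto
  also have "\<dots> \<le> mgf (rw T) \<theta>" unfolding mgf_rw by (intro sum_mono2) (auto simp: walk_prob_nonneg)
  finally show ?thesis .
qed

lemma rw_reflect: "elliptic_law.rw \<alpha>' T = map_pmf uminus (rw T)"
proof -
  interpret R: elliptic_law \<alpha>' c by (rule reflected)
  show ?thesis
  proof (rule pmf_eqI)
    fix y
    have "pmf (map_pmf uminus (rw T)) y = pmf (map_pmf uminus (rw T)) (- (- y))" by simp
    also have "\<dots> = pmf (rw T) (- y)" by (rule pmf_map_inj') (auto simp: inj_on_def)
    finally show "pmf (R.rw T) y = pmf (map_pmf uminus (rw T)) y" by (simp add: R.pmf_rw pmf_rw walk_prob_reflect)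
  qed
qed

lemma mgf_rw_reflect: "mgf (elliptic_law.rw \<alpha>' T) \<theta> = mgf (rw T) (- \<theta>)"
  by (simp add: rw_reflect mgf_def)

lemma mgf_rw_elliptic: "ln (mgf (rw T) \<theta>) \<ge> T * (\<bar>\<theta>\<bar> + ln c)"
proof -
  interpret R: elliptic_law \<alpha>' c by (rule reflected)
  have "(c * exp \<theta>) ^ T \<le> mgf (rw T) \<theta>" using bridge_mgf_ge bridge_mgf_le_mgf_rw by (rule order_trans)
  moreover have "(c * exp (- \<theta>)) ^ T \<le> mgf (rw T) \<theta>"
    using order_trans[OF R.bridge_mgf_ge R.bridge_mgf_le_mgf_rw, of "- \<theta>" T] by (simp add: mgf_rw_reflect)
  ultimately have "(c * exp \<bar>\<theta>\<bar>) ^ T \<le> mgf (rw T) \<theta>" by (auto simp: abs_if)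
  then have "ln ((c * exp \<bar>\<theta>\<bar>) ^ T) \<le> ln (mgf (rw T) \<theta>)"
    using c_pos mgf_rw_pos by (subst ln_le_cancel_iff) auto
  then show ?thesis using c_pos by (simp add: ln_realpow ln_mult add.commute)
qed

text \<open>A step spent in a loop costs \<kappa> <= exp (\<beta> \<theta>), so loop time can be
  charged at the bridge rate. The quadratic factor counts the splitting times.\<close>

lemma walk_prob_nonneg_part_le: "(\<Sum>y=0..int T. exp (\<theta> * of_int y) * walk_prob T y) \<le> (real T + 1)\<^sup>2 * exp (T * \<beta> \<theta>)"
proof -
  obtain r \<kappa> where s: "r > 0" "\<kappa> > 0" "AE p in \<alpha>. p * r + (1 - p) / r \<le> \<kappa>" "ln \<kappa> \<le> \<beta> \<theta>"
    using saddle by blast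
  have \<kappa>e: "\<kappa> \<le> exp (\<beta> \<theta>)" using s by (metis exp_le_cancel_iff exp_ln)
  have "(\<Sum>y=0..int T. exp (\<theta> * of_int y) * walk_prob T y)
    \<le> (\<Sum>y=0..int T. exp (\<theta> * of_int y) * (\<Sum>t\<le>T. \<Sum>s\<le>t. \<kappa> ^ (T - (t - s)) * bridge_prob (t - s) y))"
    by (intro sum_mono mult_left_mono walk_prob_le_bridge_prob[OF s(1,3)]) auto
  also have "\<dots> = (\<Sum>y=0..int T. \<Sum>t\<le>T. \<Sum>s\<le>t. \<kappa> ^ (T - (t - s)) * (exp (\<theta> * of_int y) * bridge_prob (t - s) y))"
    by (simp add: sum_distrib_left mult_ac)
  also have "\<dots> = (\<Sum>t\<le>T. \<Sum>y=0..int T. \<Sum>s\<le>t. \<kappa> ^ (T - (t - s)) * (exp (\<theta> * of_int y) * bridge_prob (t - s) y))"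
    by (rule sum.swap)
  also have "\<dots> = (\<Sum>t\<le>T. \<Sum>s\<le>t. \<kappa> ^ (T - (t - s)) * (\<Sum>y=0..int T. exp (\<theta> * of_int y) * bridge_prob (t - s) y))"
    by (intro sum.cong refl) (subst sum.swap, simp add: sum_distrib_left)
  also have "\<dots> \<le> (\<Sum>t\<le>T. \<Sum>s\<le>t. exp (T * \<beta> \<theta>))"
  proof (intro sum_mono)
    fix t s assume ts: "t \<in> {..T}" "s \<in> {..t}"
    have "(\<Sum>y=0..int T. exp (\<theta> * of_int y) * bridge_prob (t - s) y) = bridge_mgf (t - s) \<theta>"
      unfolding bridge_mgf_def using ts by (intro sum.mono_neutral_right) (auto simp: bridge_prob_far)
    then have "\<kappa> ^ (T - (t - s)) * (\<Sum>y=0..int T. exp (\<theta> * of_int y) * bridge_prob (t - s) y)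
       \<le> exp (\<beta> \<theta>) ^ (T - (t - s)) * exp (real (t - s) * \<beta> \<theta>)"
      using \<kappa>e s(2) bridge_mgf_le_\<beta>[of "t - s" \<theta>] bridge_mgf_pos[of "t - s" \<theta>] by (auto intro!: mult_mono power_mono)
    also have "\<dots> = exp (T * \<beta> \<theta>)"
    proof -
      have "real (T - (t - s)) * \<beta> \<theta> + real (t - s) * \<beta> \<theta> = T * \<beta> \<theta>"
        using ts by (simp add: of_nat_diff algebra_simps)
      then show ?thesis by (simp flip: exp_of_nat_mult exp_add)
    qed
    finally show "\<kappa> ^ (T - (t - s)) * (\<Sum>y=0..int T. exp (\<theta> * of_int y) * bridge_prob (t - s) y) \<le> exp (T * \<beta> \<theta>)" .
  qed
  also have "\<dots> \<le> (\<Sum>t\<le>T. \<Sum>s\<le>T. exp (T * \<beta> \<theta>))"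
    by (intro sum_mono sum_mono2) auto
  also have "\<dots> = (real T + 1)\<^sup>2 * exp (T * \<beta> \<theta>)" by (simp add: power2_eq_square algebra_simps)
  finally show ?thesis .
qed

definition G :: "real \<Rightarrow> real" where
  "G \<theta> = max (\<beta> \<theta>) (elliptic_law.\<beta> \<alpha>' (- \<theta>))"

text \<open>Bridges in either direction are particular walks, which bounds the limit below; above,
  splitting by the sign of the endpoint leaves two bridge rates and a polynomial factor.\<close>

lemma rw_limit: "(\<lambda>T. ln (mgf (rw T) \<theta>) / T) \<longlonglongrightarrow> G \<theta>"
proof -
  interpret R: elliptic_law \<alpha>' c by (rule reflected)
  have lower: "max (ln (bridge_mgf T \<theta>) / T) (ln (R.bridge_mgf T (- \<theta>)) / T) \<le> ln (mgf (rw T) \<theta>) / T" for T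
  proof -
    have "ln (bridge_mgf T \<theta>) \<le> ln (mgf (rw T) \<theta>)" using bridge_mgf_le_mgf_rw bridge_mgf_pos mgf_rw_pos by simp
    moreover have "ln (R.bridge_mgf T (- \<theta>)) \<le> ln (mgf (rw T) \<theta>)"
      using R.bridge_mgf_le_mgf_rw[of T "- \<theta>"] R.bridge_mgf_pos mgf_rw_pos by (simp add: mgf_rw_reflect)
    ultimately show ?thesis by (auto intro: divide_right_mono)
  qed
  have upper: "ln (mgf (rw T) \<theta>) / T \<le> ln (2 * (real T + 1)\<^sup>2) / T + G \<theta>" if T: "T \<ge> 1" for T
  proof -
    have "mgf (rw T) \<theta> \<le> (real T + 1)\<^sup>2 * exp (T * \<beta> \<theta>) + (real T + 1)\<^sup>2 * exp (T * R.\<beta> (- \<theta>))"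
      using mgf_rw_split walk_prob_nonneg_part_le R.walk_prob_nonneg_part_le[where \<theta>="- \<theta>"] by (meson add_mono order_trans)
    also have "\<dots> \<le> (real T + 1)\<^sup>2 * exp (T * G \<theta>) + (real T + 1)\<^sup>2 * exp (T * G \<theta>)"
      by (intro add_mono mult_left_mono) (auto simp: G_def mult_left_mono)
    finally have "mgf (rw T) \<theta> \<le> 2 * (real T + 1)\<^sup>2 * exp (T * G \<theta>)" by (simp add: mult_ac)
    then have "ln (mgf (rw T) \<theta>) \<le> ln (2 * (real T + 1)\<^sup>2 * exp (T * G \<theta>))"
      using mgf_rw_pos by (subst ln_le_cancel_iff) auto
    also have "\<dots> = ln (2 * (real T + 1)\<^sup>2) + T * G \<theta>" by (subst ln_mult) auto
    finally show ?thesis using T by (simp add: field_simps)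
  qed
  show ?thesis
  proof (rule tendsto_sandwich)
    show "(\<lambda>T. max (ln (bridge_mgf T \<theta>) / T) (ln (R.bridge_mgf T (- \<theta>)) / T)) \<longlonglongrightarrow> G \<theta>"
      unfolding G_def by (intro tendsto_max ln_bridge_mgf_limit R.ln_bridge_mgf_limit)
    have "(\<lambda>T. ln (2 * (real T + 1)\<^sup>2) / real T + G \<theta>) \<longlonglongrightarrow> 0 + G \<theta>"
      by (intro tendsto_add tendsto_const) real_asymp
    then show "(\<lambda>T. ln (2 * (real T + 1)\<^sup>2) / real T + G \<theta>) \<longlonglongrightarrow> G \<theta>" by simp
    show "\<forall>\<^sub>F T in sequentially. ln (mgf (rw T) \<theta>) / T \<le> ln (2 * (real T + 1)\<^sup>2) / T + G \<theta>"
      using eventually_ge_at_top[of 1] by eventually_elim (rule upper)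
  qed (use lower in auto)
qed

text \<open>Both \<open>\<beta>\<close> and its reflection are bounded by \<open>ln \<kappa>\<close> at the saddle point; to the right of it only
  \<open>\<beta>\<close> matters, and this half of \<open>G\<close> already determines the Legendre transform at \<open>x \<ge> 0\<close>.\<close>
lemma legendre_\<beta>_le:
  assumes x: "x \<ge> 0" and J: "\<And>\<theta>. x * \<theta> - G \<theta> \<le> J"
  shows "x * \<theta> - \<beta> \<theta> \<le> J"
proof -
  interpret R: elliptic_law \<alpha>' c by (rule reflected)
  obtain r \<kappa> where s: "r > 0" "\<kappa> > 0" "AE p in \<alpha>. p * r + (1 - p) / r \<le> \<kappa>" "\<And>\<theta>. ln \<kappa> \<le> \<beta> \<theta>"
    using saddle by blast
  have m: "(\<lambda>p. 1 - p) \<in> \<alpha> \<rightarrow>\<^sub>M (borel :: real measure)" by (simp add: measurable_cong_sets[OF \<alpha>_sets refl])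
  have "AE p in \<alpha>'. p * (1 / r) + (1 - p) / (1 / r) \<le> \<kappa>"
    using s(3) by (subst AE_distr_iff[OF m]) (auto elim!: AE_mp simp: algebra_simps)
  from R.\<beta>_saddle_le[OF _ s(2) this] have R\<beta>: "R.\<beta> (- ln r) \<le> ln \<kappa>" using s(1) by (simp add: ln_div)
  have \<beta>: "\<beta> (ln r) \<le> ln \<kappa>" by (rule \<beta>_saddle_le[OF s(1-3)])
  show ?thesis
  proof (cases "\<theta> \<ge> ln r")
    case True
    have "R.\<beta> (- \<theta>) \<le> R.\<beta> (- ln r)" using True by (intro R.\<beta>_mono) simp
    then have "G \<theta> = \<beta> \<theta>" using R\<beta> s(4)[of \<theta>] by (simp add: G_def)
    then show ?thesis using J[of \<theta>] by simp
  next
    case False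
    \<comment> \<open>Left of the saddle both terms are worse than at \<open>ln r\<close>: x
      \<theta> is smaller, and \<beta> is at least \<open>ln \<kappa>\<close>, which bounds
      \<open>G (ln r)\<close> from above.\<close>
    have "x * \<theta> \<le> x * ln r" using False x by (intro mult_left_mono) auto
    then show ?thesis using J[of "ln r"] s(4)[of \<theta>] \<beta> R\<beta> by (simp add: G_def)
  qed
qed

section \<open>The static lower bound by concatenated bridges\<close>

definition bridge_pmf :: "nat \<Rightarrow> int pmf" where
  "bridge_pmf L = embed_pmf (\<lambda>y. bridge_prob L y / bridge_mgf L 0)"

lemma pmf_bridge: "pmf (bridge_pmf L) y = bridge_prob L y / bridge_mgf L 0"
  unfolding bridge_pmf_def
proof (rule pmf_embed_pmf)
  have "(\<integral>\<^sup>+ y. ennreal (bridge_prob L y / bridge_mgf L 0) \<partial>count_space UNIV) = (\<Sum>y\<in>{0..int L}. ennreal (bridge_prob L y / bridge_mgf L 0))"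
  proof (rule nn_integral_count_space'[where A="{0..int L}"])
    fix y assume "y \<notin> {0..int L}"
    then have "bridge_prob L y = 0" using bridge_prob_far bridge_prob_neg by (cases "y < 0") auto
    then show "ennreal (bridge_prob L y / bridge_mgf L 0) = 0" by simp
  qed auto
  also have "\<dots> = ennreal (\<Sum>y\<in>{0..int L}. bridge_prob L y / bridge_mgf L 0)"
    using bridge_mgf_pos[of L 0] by (intro sum_ennreal) (simp add: bridge_prob_nonneg)
  also have "(\<Sum>y\<in>{0..int L}. bridge_prob L y / bridge_mgf L 0) = 1"
    using bridge_mgf_pos[of L 0] by (simp add: bridge_mgf_def flip: sum_divide_distrib)
  finally show "(\<integral>\<^sup>+ y. ennreal (bridge_prob L y / bridge_mgf L 0) \<partial>count_space UNIV) = 1" by simp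
qed (use bridge_mgf_pos[of L 0] in \<open>simp add: bridge_prob_nonneg\<close>)

lemma set_bridge_pmf: "set_pmf (bridge_pmf L) \<subseteq> {0..int L}"
proof
  fix y assume "y \<in> set_pmf (bridge_pmf L)"
  then have "bridge_prob L y \<noteq> 0" by (simp add: set_pmf_iff pmf_bridge)
  then show "y \<in> {0..int L}" using bridge_prob_far[of L y] bridge_prob_neg[of y L] by (cases "y < 0"; cases "y > int L") auto
qed

lemma bounded_bridge: "bounded_by L (bridge_pmf L)"
  using set_bridge_pmf[of L] by (auto simp: bounded_by_def)

lemma mgf_bridge: "mgf (bridge_pmf L) \<theta> = bridge_mgf L \<theta> / bridge_mgf L 0"
  unfolding mgf_def using set_bridge_pmf[of L]
  by (subst integral_measure_pmf_real[where A="{0..int L}"]) (auto simp: pmf_bridge bridge_mgf_def sum_divide_distrib)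

lemma pmf_conv_sum:
  assumes "finite A" "set_pmf p \<subseteq> A"
  shows "pmf (conv_pmf p q) y = (\<Sum>z\<in>A. pmf p z * pmf q (y - z))"
proof -
  have "pmf (map_pmf ((+) z) q) y = pmf q (y - z)" for z
  proof -
    have "pmf (map_pmf ((+) z) q) (z + (y - z)) = pmf q (y - z)" by (rule pmf_map_inj') (auto simp: inj_on_def)
    then show ?thesis by simp
  qed
  then show ?thesis unfolding conv_pmf_def pmf_bind using assms
    by (subst integral_measure_pmf_real[where A=A]) (auto simp: mult.commute)
qed

text \<open>\<open>N\<close> bridges of the fixed duration \<open>L\<close>, then
  \<open>\<rho>\<close> steps straight ahead to reach an arbitrary total time. The powers of
  \<open>bridge_mgf L 0\<close> undo the conditioning in \<open>bridge_pmf\<close>.\<close>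

lemma bridge_prob_ge_bridge_conv:
  "bridge_mgf L 0 ^ N * pmf (conv_list (replicate N (bridge_pmf L))) y * c ^ \<rho> \<le> bridge_prob (N * L + \<rho>) (y + int \<rho>)"
proof (induction N arbitrary: y)
  case 0
  show ?case using bridge_prob_straight[of \<rho>] bridge_prob_nonneg[of \<rho> "y + int \<rho>"] by (auto simp: indicator_def)
next
  case (Suc N)
  let ?q = "conv_list (replicate N (bridge_pmf L))"
  have "bridge_mgf L 0 ^ Suc N * pmf (conv_list (replicate (Suc N) (bridge_pmf L))) y * c ^ \<rho>
     = bridge_mgf L 0 ^ Suc N * (\<Sum>z=0..int L. bridge_prob L z / bridge_mgf L 0 * pmf ?q (y - z)) * c ^ \<rho>"
    using set_bridge_pmf by (simp add: pmf_conv_sum[where A="{0..int L}"] pmf_bridge)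
  also have "\<dots> = (\<Sum>z=0..int L. bridge_prob L z * (bridge_mgf L 0 ^ N * pmf ?q (y - z) * c ^ \<rho>))"
    using bridge_mgf_pos[of L 0] by (simp add: sum_distrib_left sum_distrib_right mult_ac)
  also have "\<dots> \<le> (\<Sum>z=0..int L. bridge_prob L z * bridge_prob (N * L + \<rho>) (y - z + int \<rho>))"
    by (intro sum_mono mult_left_mono Suc bridge_prob_nonneg)
  also have "\<dots> = (\<Sum>z=0..int L. bridge_prob L z * bridge_prob (N * L + \<rho>) (y + int \<rho> - z))"
    by (intro sum.cong refl) (simp add: algebra_simps)
  also have "\<dots> \<le> bridge_prob (L + (N * L + \<rho>)) (y + int \<rho>)" by (rule bridge_prob_concat')
  finally show ?case by (simp add: add_ac)
qed

end

context elliptic_law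
begin

text \<open>The final run moves the walk by \<rho> and the target by at most \<rho>, which accounts
  for the loss 2 \<rho> in the radius.\<close>

lemma rw_prob_ge_bridge:
  assumes w: "w + 2 * real \<rho> \<le> v" and x: "\<bar>x\<bar> \<le> 1"
  shows "bridge_mgf L 0 ^ N * window (conv_list (replicate N (bridge_pmf L))) (x * real (N * L)) w * c ^ \<rho>
    \<le> window (rw (N * L + \<rho>)) (x * real (N * L + \<rho>)) v"
proof -
  let ?q = "conv_list (replicate N (bridge_pmf L))"
  have "bounded_by (sum_list (replicate N L)) (conv_list (map bridge_pmf (replicate N L)))"
    by (rule bounded_by_conv_list) (rule bounded_bridge)
  then have fin: "finite (set_pmf ?q)" by (auto dest: bounded_by_finite)
  define S where "S = {y \<in> set_pmf ?q. \<bar>of_int y - x * real (N * L)\<bar> \<le> w}"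
  have finS: "finite S" using fin by (simp add: S_def)
  have "window ?q (x * real (N * L)) w = measure (measure_pmf ?q) S"
    by (subst measure_Int_set_pmf[symmetric]) (rule arg_cong[where f="measure (measure_pmf ?q)"], auto simp: S_def)
  also have "\<dots> = (\<Sum>y\<in>S. pmf ?q y)" by (rule measure_measure_pmf_finite[OF finS])
  finally have "bridge_mgf L 0 ^ N * window ?q (x * real (N * L)) w * c ^ \<rho>
     = (\<Sum>y\<in>S. bridge_mgf L 0 ^ N * pmf ?q y * c ^ \<rho>)"
    by (simp add: sum_distrib_left sum_distrib_right)
  also have "\<dots> \<le> (\<Sum>y\<in>S. pmf (rw (N * L + \<rho>)) (y + int \<rho>))"
    using order_trans[OF bridge_prob_ge_bridge_conv bridge_prob_le_walk_prob] by (intro sum_mono) (simp add: pmf_rw)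
  also have "\<dots> = (\<Sum>y\<in>(\<lambda>y. y + int \<rho>) ` S. pmf (rw (N * L + \<rho>)) y)"
    by (subst sum.reindex) (auto simp: inj_on_def)
  also have "\<dots> = measure (measure_pmf (rw (N * L + \<rho>))) ((\<lambda>y. y + int \<rho>) ` S)"
    using finS by (subst measure_measure_pmf_finite) auto
  also have "\<dots> \<le> window (rw (N * L + \<rho>)) (x * real (N * L + \<rho>)) v"
  proof (intro measure_pmf.finite_measure_mono subsetI)
    fix z assume "z \<in> (\<lambda>y. y + int \<rho>) ` S"
    then obtain y where y: "z = y + int \<rho>" "\<bar>of_int y - x * real (N * L)\<bar> \<le> w" by (auto simp: S_def)
    have "\<bar>x * real \<rho>\<bar> \<le> real \<rho>" using x by (simp add: abs_mult mult_left_le_one_le)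
    moreover have "of_int z - x * real (N * L + \<rho>) = (of_int y - x * real (N * L)) + real \<rho> - x * real \<rho>"
      by (simp add: y algebra_simps)
    ultimately show "z \<in> {y. \<bar>of_int y - x * real (N * L + \<rho>)\<bar> \<le> v}"
      using y(2) w unfolding mem_Collect_eq by linarith
  qed simp
  finally show ?thesis .
qed

text \<open>The tilting bound for equal blocks, with \<open>L\<close> fixed as \<open>N\<close>
  grows. The normalisation contributes exp (n f(0)), which cancels the f(0) in the exponent of the
  conditioned law.\<close>

lemma bridge_conv_lower_bound:
  fixes x J \<eta> R w :: real
  assumes L: "L \<ge> 1" and x: "0 < x" and J: "\<And>\<theta>. x * \<theta> - \<beta> \<theta> \<le> J" and R: "R > 0"
    "\<beta> R - x * R \<ge> \<beta> 0 + 1" "\<beta> (- R) + x * R \<ge> \<beta> 0 + 1"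
    and unif: "\<And>\<theta>. \<bar>\<theta>\<bar> \<le> R \<Longrightarrow> \<bar>ln (bridge_mgf L \<theta>) / L - \<beta> \<theta>\<bar> \<le> \<eta>" and \<eta>: "0 < \<eta>" "\<eta> \<le> 1 / 4"
    and N: "N \<ge> 1" and w: "0 < w" "w \<le> 2 * real (N * L)" "w\<^sup>2 \<ge> 8 * real L * real (N * L)"
  shows "exp (- (J + \<eta>) * real (N * L) - R * w) / 2
    \<le> bridge_mgf L 0 ^ N * window (conv_list (replicate N (bridge_pmf L))) (x * real (N * L)) w"
proof -
  define f where "f \<theta> = ln (bridge_mgf L \<theta>) / L" for \<theta>
  define n where "n = real (N * L)"
  have n: "n > 0" using L N by (simp add: n_def)
  have lnB: "ln (bridge_mgf L \<theta>) = L * f \<theta>" for \<theta> using L by (simp add: f_def)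
  let ?Ts = "replicate N L"
  have sum: "sum_list ?Ts = N * L" by (simp add: sum_list_replicate)
  have \<Phi>: "ln (mgf (conv_list (map bridge_pmf ?Ts)) \<theta>) = n * (f \<theta> - f 0)" for \<theta>
  proof -
    have "ln (mgf (conv_list (map bridge_pmf ?Ts)) \<theta>) = (\<Sum>T\<leftarrow>?Ts. ln (mgf (bridge_pmf T) \<theta>))"
      by (rule mgf_conv_list) (rule bounded_bridge)
    also have "\<dots> = real N * ln (mgf (bridge_pmf L) \<theta>)" by (simp add: sum_list_replicate)
    also have "ln (mgf (bridge_pmf L) \<theta>) = L * f \<theta> - L * f 0"
      by (simp add: mgf_bridge ln_div lnB less_imp_neq[OF bridge_mgf_pos, symmetric])
    finally show ?thesis by (simp add: n_def algebra_simps)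
  qed
  have f: "\<bar>f \<theta> - \<beta> \<theta>\<bar> \<le> \<eta>" if "\<bar>\<theta>\<bar> \<le> R" for \<theta> using unif[OF that] by (simp add: f_def)
  have f0: "\<bar>f 0 - \<beta> 0\<bar> \<le> \<eta>" using f[of 0] R(1) by simp
  have "exp (- (n * (J + \<eta> + f 0)) - R * w) / 2
     \<le> window (conv_list (map bridge_pmf ?Ts)) (x * n) w"
  proof (rule short_blocks_lower_bound[where M=L and n="N * L"])
    show "sum_list ?Ts \<le> N * L" by (simp add: sum)
    \<comment> \<open>The margin 1 in the choice of \<open>R\<close> survives two errors \<eta> <=
      1/4.\<close>
    have "f R - f 0 - x * R > 0" using f[of R] f0 R \<eta> by auto
    then have "n * (f R - f 0 - x * R) > 0" using n by simp
    then show "ln (mgf (conv_list (map bridge_pmf ?Ts)) R) - x * n * R > 0" unfolding \<Phi> by (simp add: algebra_simps)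
    have "f (- R) - f 0 + x * R > 0" using f[of "- R"] f0 R \<eta> by auto
    then have "n * (f (- R) - f 0 + x * R) > 0" using n by simp
    then show "ln (mgf (conv_list (map bridge_pmf ?Ts)) (- R)) + x * n * R > 0" unfolding \<Phi> by (simp add: algebra_simps)
    show "- (n * (J + \<eta> + f 0)) \<le> ln (mgf (conv_list (map bridge_pmf ?Ts)) \<theta>) - x * n * \<theta>" if "\<bar>\<theta>\<bar> \<le> R" for \<theta>
    proof -
      have "- (J + \<eta> + f 0) \<le> f \<theta> - f 0 - x * \<theta>" using f[OF that] J[of \<theta>] by linarith
      then have "n * (- (J + \<eta> + f 0)) \<le> n * (f \<theta> - f 0 - x * \<theta>)" using n by (intro mult_left_mono) auto
      then show ?thesis unfolding \<Phi> by (simp add: algebra_simps)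
    qed
  qed (use R w L bounded_bridge in \<open>auto simp: n_def\<close>)
  then have "bridge_mgf L 0 ^ N * (exp (- (n * (J + \<eta> + f 0)) - R * w) / 2)
     \<le> bridge_mgf L 0 ^ N * window (conv_list (map bridge_pmf ?Ts)) (x * n) w"
    using bridge_mgf_pos[of L 0] by (intro mult_left_mono) auto
  moreover have "bridge_mgf L 0 ^ N * (exp (- (n * (J + \<eta> + f 0)) - R * w) / 2) = exp (- (J + \<eta>) * n - R * w) / 2"
  proof -
    have "bridge_mgf L 0 = exp (L * f 0)" using bridge_mgf_pos[of L 0] by (simp flip: lnB)
    then have "bridge_mgf L 0 ^ N = exp (n * f 0)" by (simp add: n_def mult_ac flip: exp_of_nat_mult)
    then show ?thesis by (simp add: algebra_simps flip: exp_add)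
  qed
  ultimately show ?thesis by (simp add: n_def)
qed

lemma rw_lower_pos:
  fixes x J \<delta> \<epsilon> :: real
  assumes x: "0 < x" "x < 1" and J: "\<And>\<theta>. x * \<theta> - G \<theta> \<le> J" and \<delta>: "\<delta> > 0" and \<epsilon>: "\<epsilon> > 0"
  shows "\<forall>\<^sub>F T in sequentially. exp (- (J + \<epsilon>) * real T) \<le> window (rw T) (x * real T) (\<delta> * real T)"
proof -
  have J\<beta>: "x * \<theta> - \<beta> \<theta> \<le> J" for \<theta> using x J by (intro legendre_\<beta>_le) auto
  have G0: "G 0 = 0" using rw_limit[of 0] by (simp add: LIMSEQ_const_iff)
  have J0: "J \<ge> 0" using J[of 0] by (simp add: G0)
  obtain r \<kappa> where s: "\<And>\<theta>. ln \<kappa> \<le> \<beta> \<theta>" using saddle by blast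
  \<comment> \<open>To the right, \<beta> R >= R + ln c outgrows x R because x < 1. To the left
    \<beta> is only known to stay above \<open>ln \<kappa>\<close>, so the growth must come from x R
    with x > 0.\<close>
  define R where "R = max 1 (max ((\<beta> 0 + 1 - ln c) / (1 - x)) ((\<beta> 0 + 1 - ln \<kappa>) / x))"
  have R: "R > 0" "\<beta> R - x * R \<ge> \<beta> 0 + 1" "\<beta> (- R) + x * R \<ge> \<beta> 0 + 1"
  proof -
    have "(\<beta> 0 + 1 - ln c) / (1 - x) \<le> R" by (simp add: R_def)
    then have "\<beta> 0 + 1 - ln c \<le> (1 - x) * R" using x by (simp add: field_simps)
    then show "\<beta> R - x * R \<ge> \<beta> 0 + 1" using \<beta>_lower[of R] by (simp add: algebra_simps)
    have "(\<beta> 0 + 1 - ln \<kappa>) / x \<le> R" by (simp add: R_def)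
    then have "\<beta> 0 + 1 - ln \<kappa> \<le> x * R" using x by (simp add: field_simps)
    then show "\<beta> (- R) + x * R \<ge> \<beta> 0 + 1" using s[of "- R"] by simp
  qed (simp add: R_def)
  define \<eta> where "\<eta> = min (1 / 4) (\<epsilon> / 4)"
  have \<eta>: "0 < \<eta>" "\<eta> \<le> 1 / 4" "\<eta> \<le> \<epsilon> / 4" using \<epsilon> by (auto simp: \<eta>_def)
  have lipB: "\<bar>ln (bridge_mgf t a) / t - ln (bridge_mgf t b) / t\<bar> \<le> \<bar>a - b\<bar>" for t a b
  proof -
    have "ln (bridge_mgf t a) / t - ln (bridge_mgf t b) / t = ln (mgf (bridge_pmf t) a) / t - ln (mgf (bridge_pmf t) b) / t"
      by (simp add: mgf_bridge ln_div diff_divide_distrib less_imp_neq[OF bridge_mgf_pos, symmetric])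
    then show ?thesis using scaled_ln_mgf_lipschitz[OF bounded_bridge, of t a b] by simp
  qed
  have "\<forall>\<^sub>F L in sequentially. \<forall>\<theta>. \<bar>\<theta>\<bar> \<le> R \<longrightarrow> \<bar>ln (bridge_mgf L \<theta>) / L - \<beta> \<theta>\<bar> \<le> \<eta>"
    by (rule lipschitz_pointwise_limit_uniform[OF lipB ln_bridge_mgf_limit \<eta>(1)])
  then have "\<forall>\<^sub>F L in sequentially. L \<ge> 1 \<and> (\<forall>\<theta>. \<bar>\<theta>\<bar> \<le> R \<longrightarrow> \<bar>ln (bridge_mgf L \<theta>) / L - \<beta> \<theta>\<bar> \<le> \<eta>)"
    using eventually_ge_at_top[of 1] by eventually_elim simp
  then obtain L where L: "L \<ge> 1" "\<And>\<theta>. \<bar>\<theta>\<bar> \<le> R \<Longrightarrow> \<bar>ln (bridge_mgf L \<theta>) / L - \<beta> \<theta>\<bar> \<le> \<eta>"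
    by (metis (mono_tags, lifting) eventually_happens' sequentially_bot)
  define d where "d = Min {1, \<delta> / 2, \<epsilon> / (4 * R)}"
  have d: "0 < d" "d \<le> 1" "d \<le> \<delta> / 2" "d \<le> \<epsilon> / (4 * R)" using \<delta> \<epsilon> R(1) by (auto simp: d_def)
  have Rd: "R * d \<le> \<epsilon> / 4" using d(4) R(1) by (simp add: field_simps)
  \<comment> \<open>With n = T - \<rho> and \<rho> < L, the entries ensure in turn n >= L, the
    variance condition for the radius d n, room for the final run in the window, and absorption of
    1/2 and \<open>c ^ \<rho>\<close>.\<close>
  define K where "K = Max {2 * real L, L + 8 * real L / d\<^sup>2, 4 * real L / \<delta>, (1 + L * \<bar>ln c\<bar>) * 4 / \<epsilon>}"
  have K: "2 * real L \<le> K" "L + 8 * real L / d\<^sup>2 \<le> K" "4 * real L / \<delta> \<le> K" "(1 + L * \<bar>ln c\<bar>) * 4 / \<epsilon> \<le> K"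
    by (auto simp: K_def)
  have "\<forall>\<^sub>F T in sequentially. K \<le> real T"
    using filterlim_real_sequentially by (simp add: filterlim_at_top)
  then show ?thesis
  proof eventually_elim
    case (elim T)
    define N where "N = T div L"
    define \<rho> where "\<rho> = T mod L"
    define n where "n = real (N * L)"
    have T: "T = N * L + \<rho>" "\<rho> < L" using L(1) by (auto simp: N_def \<rho>_def)
    have Tr: "real T = n + \<rho>" by (simp add: n_def T(1))
    have nK: "n \<ge> L" "n \<ge> 8 * real L / d\<^sup>2" using elim K Tr T(2) by auto
    have n0: "n > 0" using nK(1) L(1) by linarith
    then have N1: "N \<ge> 1" by (cases N) (auto simp: n_def)
    have nT: "n \<le> T" using Tr by simp
    have "exp (- (J + \<eta>) * n - R * (d * n)) / 2
      \<le> bridge_mgf L 0 ^ N * window (conv_list (replicate N (bridge_pmf L))) (x * real (N * L)) (d * n)"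
      unfolding n_def
    proof (rule bridge_conv_lower_bound[OF L(1) x(1) J\<beta> R L(2) \<eta>(1,2) N1])
      have "8 * real L \<le> d\<^sup>2 * n" using nK(2) d(1) by (simp add: field_simps)
      then have "8 * real L * n \<le> (d\<^sup>2 * n) * n" using n0 by (intro mult_right_mono) auto
      then show "8 * real L * real (N * L) \<le> (d * real (N * L))\<^sup>2"
        unfolding n_def[symmetric] by (simp add: power2_eq_square mult_ac)
      have "d * n \<le> 2 * n" using d n0 by (intro mult_right_mono) auto
      then show "d * real (N * L) \<le> 2 * real (N * L)" unfolding n_def .
    qed (use d n0 in \<open>auto simp: n_def\<close>)
    then have "exp (- (J + \<eta>) * n - R * (d * n)) / 2 * c ^ \<rho>
      \<le> bridge_mgf L 0 ^ N * window (conv_list (replicate N (bridge_pmf L))) (x * real (N * L)) (d * n) * c ^ \<rho>"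
      using c_pos by (intro mult_right_mono) auto
    also have "\<dots> \<le> window (rw (N * L + \<rho>)) (x * real (N * L + \<rho>)) (\<delta> * real T)"
    proof (rule rw_prob_ge_bridge)
      have "4 * real L \<le> \<delta> * T" using mult_right_mono[OF order_trans[OF K(3) elim], of \<delta>] \<delta> by (simp add: field_simps)
      moreover have "d * n \<le> \<delta> / 2 * T" using d \<delta> nT n0 by (intro mult_mono) auto
      ultimately show "d * n + 2 * real \<rho> \<le> \<delta> * real T" using T(2) by linarith
    qed (use x in auto)
    finally have main: "exp (- (J + \<eta>) * n - R * (d * n)) / 2 * c ^ \<rho>
      \<le> window (rw T) (x * real T) (\<delta> * real T)"
      unfolding T(1)[symmetric] .
    have "exp (- (J + \<epsilon>) * T) \<le> exp (- (J + \<eta>) * n - R * (d * n) - 1 - L * \<bar>ln c\<bar>)"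
    proof -
      \<comment> \<open>One quarter of \<epsilon> each for \<eta>, for the tilt over the window, and
        for the constants; the last quarter is slack.\<close>
      have "(J + \<eta>) * n \<le> (J + \<epsilon> / 4) * T" using \<eta> J0 nT n0 by (intro mult_mono) auto
      moreover have "R * d * n \<le> \<epsilon> / 4 * T" using Rd \<epsilon> nT n0 by (intro mult_mono) auto
      moreover have "1 + L * \<bar>ln c\<bar> \<le> \<epsilon> / 4 * T" using order_trans[OF K(4) elim] \<epsilon> by (simp add: pos_divide_le_eq algebra_simps)
      moreover have "(J + \<epsilon>) * T = (J + \<epsilon> / 4) * T + \<epsilon> / 4 * T + \<epsilon> / 4 * T + \<epsilon> / 4 * T" by (simp add: algebra_simps)
      moreover have "0 \<le> \<epsilon> / 4 * T" using \<epsilon> by simp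
      ultimately have "(J + \<eta>) * n + R * (d * n) + 1 + L * \<bar>ln c\<bar> \<le> (J + \<epsilon>) * T" by (simp only: mult.assoc)
      then show ?thesis by (simp add: algebra_simps)
    qed
    also have "\<dots> = exp (- (J + \<eta>) * n - R * (d * n)) * exp (- 1) * exp (- (L * \<bar>ln c\<bar>))"
      by (simp add: algebra_simps flip: exp_add)
    also have "\<dots> \<le> exp (- (J + \<eta>) * n - R * (d * n)) * (1 / 2) * c ^ \<rho>"
    proof (intro mult_mono)
      have "2 \<le> exp (1::real)" using exp_ge_add_one_self[of 1] by simp
      then show "exp (- 1) \<le> (1 / 2 :: real)" by (simp add: exp_minus field_simps)
      have "real \<rho> * \<bar>ln c\<bar> \<le> L * \<bar>ln c\<bar>" using T(2) by (intro mult_right_mono) auto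
      moreover have "- (real \<rho> * \<bar>ln c\<bar>) \<le> real \<rho> * ln c"
        using mult_left_mono[OF abs_ge_minus_self[of "ln c"], of "real \<rho>"] by simp
      ultimately have "exp (- (L * \<bar>ln c\<bar>)) \<le> exp (\<rho> * ln c)" by simp
      also have "\<dots> = c ^ \<rho>" using c_pos by (simp add: exp_of_nat_mult)
      finally show "exp (- (L * \<bar>ln c\<bar>)) \<le> c ^ \<rho>" .
    qed auto
    finally show ?case using main by simp
  qed
qed

lemma rw_lower:
  fixes x J \<delta> \<epsilon> :: real
  assumes x: "0 < \<bar>x\<bar>" "\<bar>x\<bar> < 1" and J: "\<And>\<theta>. x * \<theta> - G \<theta> \<le> J" and \<delta>: "\<delta> > 0" and \<epsilon>: "\<epsilon> > 0"
  shows "\<forall>\<^sub>F T in sequentially. exp (- (J + \<epsilon>) * real T) \<le> window (rw T) (x * real T) (\<delta> * real T)"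
proof (cases "x > 0")
  case True
  then show ?thesis using assms by (intro rw_lower_pos) auto
next
  case False
  interpret R: elliptic_law \<alpha>' c by (rule reflected)
  have RG: "R.G \<theta> = G (- \<theta>)" for \<theta>
  proof (rule LIMSEQ_unique[OF R.rw_limit])
    show "(\<lambda>T. ln (mgf (R.rw T) \<theta>) / T) \<longlonglongrightarrow> G (- \<theta>)"
      using rw_limit[of "- \<theta>"] by (simp add: mgf_rw_reflect)
  qed
  have "\<forall>\<^sub>F T in sequentially. exp (- (J + \<epsilon>) * real T) \<le> window (R.rw T) ((- x) * real T) (\<delta> * real T)"
  proof (rule R.rw_lower_pos)
    show "- x * \<theta> - R.G \<theta> \<le> J" for \<theta> using J[of "- \<theta>"] by (simp add: RG)
  qed (use False x \<delta> \<epsilon> in auto)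
  moreover have "window (R.rw T) ((- x) * real T) (\<delta> * real T)
     = window (rw T) (x * real T) (\<delta> * real T)" for T
  proof -
    have "uminus -` {y. \<bar>of_int y - (- x) * real T\<bar> \<le> \<delta> * real T} = {y. \<bar>of_int y - x * real T\<bar> \<le> \<delta> * real T}"
      by (auto simp: abs_minus_commute abs_le_iff)
    then show ?thesis by (simp add: rw_reflect)
  qed
  ultimately show ?thesis by simp
qed

end

section \<open>The cooling walk\<close>

primrec time_kernel :: "(nat \<Rightarrow> int \<Rightarrow> real) \<Rightarrow> nat \<Rightarrow> nat \<Rightarrow> int \<Rightarrow> int \<Rightarrow> real" where
  "time_kernel p s 0 x y = of_bool (x = y)"
| "time_kernel p s (Suc n) x y = p s x * time_kernel p (Suc s) n (x + 1) y + (1 - p s x) * time_kernel p (Suc s) n (x - 1) y"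

lemma time_kernel_homogeneous:
  "(\<And>i. s \<le> i \<Longrightarrow> i < s + n \<Longrightarrow> p i = \<omega>) \<Longrightarrow> time_kernel p s n x y = kernel \<omega> n x y"
  by (induction n arbitrary: s x) auto

lemma time_kernel_cong:
  "(\<And>i. s \<le> i \<Longrightarrow> i < s + n \<Longrightarrow> p i = p' i) \<Longrightarrow> time_kernel p s n x y = time_kernel p' s n x y"
  by (induction n arbitrary: s x) auto

lemma time_kernel_Chapman_Kolmogorov:
  "finite A \<Longrightarrow> {x - int m..x + int m} \<subseteq> A \<Longrightarrow> time_kernel p s (m + n) x y = (\<Sum>z\<in>A. time_kernel p s m x z * time_kernel p (s + m) n z y)"
proof (induction m arbitrary: s x)
  case 0
  have "(\<Sum>z\<in>A. time_kernel p s 0 x z * time_kernel p (s + 0) n z y) = (\<Sum>z\<in>A. if x = z then time_kernel p s n z y else 0)"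
    by (intro sum.cong) auto
  also have "\<dots> = time_kernel p s n x y" using 0 by (subst sum.delta') auto
  finally show ?case by simp
next
  case (Suc m)
  have "{x + 1 - int m..x + 1 + int m} \<subseteq> A" "{x - 1 - int m..x - 1 + int m} \<subseteq> A"
    using Suc.prems(2) by (auto simp: subset_eq)
  then show ?case using Suc.IH[of "x + 1" "Suc s"] Suc.IH[of "x - 1" "Suc s"] Suc.prems(1)
    by (simp add: sum_distrib_left sum.distrib distrib_right mult.assoc)
qed

lemma time_kernel_far: "\<bar>x - y\<bar> > int n \<Longrightarrow> time_kernel p s n x y = 0"
  by (induction n arbitrary: x s) auto

lemma time_kernel_Suc_forward:
  "time_kernel p s (Suc n) x z = time_kernel p s n x (z - 1) * p (s + n) (z - 1) + time_kernel p s n x (z + 1) * (1 - p (s + n) (z + 1))"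
proof (induction n arbitrary: s x)
  case (Suc n)
  show ?case by (subst time_kernel.simps(2), subst (1 2) Suc) (simp add: algebra_simps)
qed auto

lemma time_kernel_bounds:
  assumes "\<And>i x. 0 \<le> p i x" "\<And>i x. p i x \<le> 1"
  shows "0 \<le> time_kernel p s n x y \<and> time_kernel p s n x y \<le> 1"
proof (induction n arbitrary: s x)
  case (Suc n)
  have "p s x * time_kernel p (Suc s) n (x + 1) y + (1 - p s x) * time_kernel p (Suc s) n (x - 1) y \<le> p s x * 1 + (1 - p s x) * 1"
    using Suc assms by (intro add_mono mult_left_mono) auto
  moreover have "0 \<le> p s x * time_kernel p (Suc s) n (x + 1) y + (1 - p s x) * time_kernel p (Suc s) n (x - 1) y"
    using Suc assms by (intro add_nonneg_nonneg mult_nonneg_nonneg) auto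
  ultimately show ?case by simp
qed auto

lemma sets_path_component: "{X. X n = y} \<in> sets path_space" for y :: int
proof -
  have "(\<lambda>X. X n) \<in> path_space \<rightarrow>\<^sub>M count_space (UNIV :: int set)" by (rule measurable_component_singleton) simp
  from measurable_sets[OF this, of "{y}"] show ?thesis by (simp add: space_PiM PiE_UNIV_domain vimage_def)
qed

text \<open>The Markov property at one time, from cylinder probabilities: there are countably many
  histories ending in \<open>y\<close>, and the last factor is the same for all of them.\<close>

lemma nn_chain_two_steps:
  "emeasure (nn_chain p x) {X. X n = y \<and> X (Suc n) = z}
    = emeasure (nn_chain p x) {X. X n = y} * ennreal (pmf (step_pmf (p n y) y) z)"
proof -
  let ?N = "nn_chain p x"
  define S where "S = {a \<in> PiE {..n} (\<lambda>_. UNIV :: int set). a n = y}"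
  have cS: "countable S" unfolding S_def by (rule countable_subset[OF _ countable_PiE[of "{..n}" "\<lambda>_. UNIV"]]) auto
  define cyl where "cyl m a = {h :: nat \<Rightarrow> int. \<forall>i\<le>m. h i = a i}" for m a
  have cyl_sets: "cyl m a \<in> sets ?N" for m a
  proof -
    have "cyl m a = (\<Inter>i\<in>{..m}. {h. h i = a i})" by (auto simp: cyl_def)
    also have "\<dots> \<in> sets path_space" by (intro sets.finite_INT sets_path_component) auto
    finally show ?thesis by simp
  qed
  have uniq: "a = b" if "a \<in> S" "b \<in> S" "h \<in> cyl n a" "h \<in> cyl n b" for a b h
    using that by (intro PiE_ext[of a "{..n}" "\<lambda>_. UNIV" b]) (auto simp: S_def cyl_def)
  have restr: "restrict h {..n} \<in> S" "h \<in> cyl n (restrict h {..n})" if "h n = y" for h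
    using that by (auto simp: S_def cyl_def)
  have 1: "{X. X n = y} = (\<Union>a\<in>S. cyl n a)"
  proof (intro set_eqI iffI)
    fix h assume "h \<in> {X. X n = y}"
    then show "h \<in> (\<Union>a\<in>S. cyl n a)" using restr[of h] by (intro UN_I[of "restrict h {..n}"]) auto
  next
    fix h assume "h \<in> (\<Union>a\<in>S. cyl n a)"
    then show "h \<in> {X. X n = y}" by (auto simp: S_def cyl_def)
  qed
  have 2: "{X. X n = y \<and> X (Suc n) = z} = (\<Union>a\<in>S. cyl (Suc n) (a(Suc n := z)))"
  proof (intro set_eqI iffI)
    fix h assume "h \<in> {X. X n = y \<and> X (Suc n) = z}"
    then show "h \<in> (\<Union>a\<in>S. cyl (Suc n) (a(Suc n := z)))"
      using restr[of h] by (intro UN_I[of "restrict h {..n}"]) (auto simp: cyl_def le_Suc_eq)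
  next
    fix h assume "h \<in> (\<Union>a\<in>S. cyl (Suc n) (a(Suc n := z)))"
    then show "h \<in> {X. X n = y \<and> X (Suc n) = z}" by (auto simp: S_def cyl_def)
  qed
  have sub: "cyl (Suc n) (a(Suc n := z)) \<subseteq> cyl n a" for a by (auto simp: cyl_def)
  have d1: "disjoint_family_on (cyl n) S"
    using uniq by (auto simp: disjoint_family_on_def)
  have d2: "disjoint_family_on (\<lambda>a. cyl (Suc n) (a(Suc n := z))) S"
    unfolding disjoint_family_on_def
  proof (intro ballI impI)
    fix a b assume "a \<in> S" "b \<in> S" "a \<noteq> b"
    then have "cyl n a \<inter> cyl n b = {}" using d1 by (simp add: disjoint_family_on_def)
    then show "cyl (Suc n) (a(Suc n := z)) \<inter> cyl (Suc n) (b(Suc n := z)) = {}" using sub by blast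
  qed
  have "emeasure ?N (cyl (Suc n) (a(Suc n := z))) = emeasure ?N (cyl n a) * ennreal (pmf (step_pmf (p n y) y) z)" if "a \<in> S" for a
  proof -
    have "(\<Prod>i<n. ennreal (pmf (step_pmf (p i ((a(Suc n := z)) i)) ((a(Suc n := z)) i)) ((a(Suc n := z)) (Suc i))))
      = (\<Prod>i<n. ennreal (pmf (step_pmf (p i (a i)) (a i)) (a (Suc i))))"
      by (intro prod.cong) auto
    then show ?thesis using that
      unfolding cyl_def nn_chain_cylinder by (simp add: S_def)
  qed
  then have "emeasure ?N {X. X n = y \<and> X (Suc n) = z}
     = (\<integral>\<^sup>+a. emeasure ?N (cyl n a) * ennreal (pmf (step_pmf (p n y) y) z) \<partial>count_space S)"
    unfolding 2 using cyl_sets cS d2 by (subst emeasure_UN_countable) (auto intro!: nn_integral_cong)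
  also have "\<dots> = (\<integral>\<^sup>+a. emeasure ?N (cyl n a) \<partial>count_space S) * ennreal (pmf (step_pmf (p n y) y) z)"
    by (rule nn_integral_multc) simp
  also have "(\<integral>\<^sup>+a. emeasure ?N (cyl n a) \<partial>count_space S) = emeasure ?N {X. X n = y}"
    unfolding 1 using cyl_sets cS d1 by (subst emeasure_UN_countable) auto
  finally show ?thesis .
qed

lemma nn_chain_marginal:
  assumes p: "\<And>i x. 0 \<le> p i x" "\<And>i x. p i x \<le> 1"
  shows "emeasure (nn_chain p x) {X. X n = y} = ennreal (time_kernel p 0 n x y)"
proof (induction n arbitrary: y)
  case 0
  have eq: "{X :: nat \<Rightarrow> int. X 0 = y} = {h. \<forall>i\<le>0. h i = (\<lambda>_. y) i}" by auto
  show ?case unfolding eq nn_chain_cylinder by auto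
next
  case (Suc n)
  let ?N = "nn_chain p x"
  let ?E = "\<lambda>y'. {X. X n = y' \<and> X (Suc n) = y}"
  have E: "?E y' \<in> sets ?N" for y'
  proof -
    have "?E y' = {X. X n = y'} \<inter> {X. X (Suc n) = y}" by auto
    then show ?thesis using sets_path_component by (auto intro: sets.Int)
  qed
  have "{X. X (Suc n) = y} = (\<Union>y'\<in>UNIV. ?E y')" by auto
  then have "emeasure ?N {X. X (Suc n) = y} = (\<integral>\<^sup>+y'. emeasure ?N (?E y') \<partial>count_space UNIV)"
    using E by (simp only:) (subst emeasure_UN_countable, auto simp: disjoint_family_on_def)
  also have "\<dots> = (\<integral>\<^sup>+y'. ennreal (time_kernel p 0 n x y') * ennreal (pmf (step_pmf (p n y') y') y) \<partial>count_space UNIV)"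
    by (simp add: nn_chain_two_steps Suc)
  also have "\<dots> = (\<Sum>y'\<in>{y - 1, y + 1}. ennreal (time_kernel p 0 n x y') * ennreal (pmf (step_pmf (p n y') y') y))"
    by (rule nn_integral_count_space') (auto simp: pmf_step_pmf p)
  also have "\<dots> = ennreal (time_kernel p 0 n x (y - 1) * p n (y - 1) + time_kernel p 0 n x (y + 1) * (1 - p n (y + 1)))"
    using time_kernel_bounds[of p 0 n x, OF p] p by (simp add: pmf_step_pmf ennreal_mult ennreal_plus flip: ennreal_mult ennreal_plus)
  also have "\<dots> = ennreal (time_kernel p 0 (Suc n) x y)"
    unfolding time_kernel_Suc_forward[of p 0 n x y] by simp
  finally show ?case .
qed

section \<open>Splitting the cooling walk into blocks\<close>

locale cooling_walk = elliptic_law +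
  fixes \<tau> :: "nat \<Rightarrow> enat"
  assumes \<tau>: "resampling_map \<tau>"
begin

abbreviation envs :: "(nat \<Rightarrow> environment) measure" where
  "envs \<equiv> \<Pi>\<^sub>M k\<in>{1..}. env_law \<alpha>"

abbreviation walk :: "(nat \<Rightarrow> int) measure" where
  "walk \<equiv> rwcre_annealed (env_law \<alpha>) \<tau> 0"

abbreviation site :: "(nat \<Rightarrow> environment) \<Rightarrow> nat \<Rightarrow> int \<Rightarrow> real" where
  "site \<omega>s \<equiv> \<lambda>n. \<omega>s (env_index \<tau> n)"

definition cool_prob :: "nat \<Rightarrow> int \<Rightarrow> real" where
  "cool_prob n y = (\<integral>\<omega>s. time_kernel (site \<omega>s) 0 n 0 y \<partial>envs)"

lemma prob_envs: "prob_space envs"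
  by (intro prob_space_PiM prob_env)

lemma sets_env: "sets (env_law \<alpha>) = sets env_space"
  by (rule sets_env_law[OF \<alpha>_sets])

lemma AE_envs: "AE \<omega>s in envs. \<forall>i x. 0 \<le> site \<omega>s i x \<and> site \<omega>s i x \<le> 1"
proof -
  have "AE \<omega>s in envs. \<forall>x. 0 \<le> site \<omega>s i x \<and> site \<omega>s i x \<le> 1" for i
  proof (rule AE_PiM_component[where P="\<lambda>\<omega>. \<forall>x. 0 \<le> \<omega> x \<and> \<omega> x \<le> 1"])
    show "AE \<omega> in env_law \<alpha>. \<forall>x. 0 \<le> \<omega> x \<and> \<omega> x \<le> 1"
      using AE_env_elliptic by eventually_elim auto
  qed (use prob_env env_index_props(1)[OF \<tau>] in auto)
  then show ?thesis unfolding AE_all_countable by blast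
qed

text \<open>Stated for any set \<open>K\<close> of environment indices, since independence of blocks
  needs measurability on the coordinates of each block alone.\<close>

lemma measurable_time_kernel:
  "(\<And>i. s \<le> i \<Longrightarrow> i < s + n \<Longrightarrow> env_index \<tau> i \<in> K) \<Longrightarrow>
    (\<lambda>\<omega>s. time_kernel (site \<omega>s) s n x y) \<in> borel_measurable (\<Pi>\<^sub>M k\<in>K. env_law \<alpha>)"
proof (induction n arbitrary: s x)
  case (Suc n)
  have "env_index \<tau> s \<in> K" using Suc.prems[of s] by simp
  then have "(\<lambda>\<omega>s. \<omega>s (env_index \<tau> s)) \<in> (\<Pi>\<^sub>M k\<in>K. env_law \<alpha>) \<rightarrow>\<^sub>M env_law \<alpha>"
    by (rule measurable_component_singleton)
  moreover have "(\<lambda>\<omega>. \<omega> x) \<in> borel_measurable (env_law \<alpha>)"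
    unfolding env_law_def by (rule measurable_component) simp
  ultimately have 1: "(\<lambda>\<omega>s. site \<omega>s s x) \<in> borel_measurable (\<Pi>\<^sub>M k\<in>K. env_law \<alpha>)"
    by (rule measurable_compose)
  have IH: "(\<lambda>\<omega>s. time_kernel (site \<omega>s) (Suc s) n x' y) \<in> borel_measurable (\<Pi>\<^sub>M k\<in>K. env_law \<alpha>)" for x'
    by (rule Suc.IH) (use Suc.prems in auto)
  show ?case unfolding time_kernel.simps
    by (intro borel_measurable_add borel_measurable_times borel_measurable_diff borel_measurable_const 1 IH)
qed simp

lemma AE_time_kernel_bounds: "AE \<omega>s in envs. 0 \<le> time_kernel (site \<omega>s) s n x y \<and> time_kernel (site \<omega>s) s n x y \<le> 1"
  using AE_envs by eventually_elim (rule time_kernel_bounds, auto)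

lemma integrable_time_kernel: "integrable envs (\<lambda>\<omega>s. time_kernel (site \<omega>s) s n x y)"
proof -
  interpret E: prob_space envs by (rule prob_envs)
  show ?thesis
  proof (rule E.integrable_const_bound[where B=1])
    show "AE \<omega>s in envs. norm (time_kernel (site \<omega>s) s n x y) \<le> 1"
      using AE_time_kernel_bounds[of s n x y] by eventually_elim auto
  qed (rule measurable_time_kernel, use env_index_props(1)[OF \<tau>] in auto)
qed

lemma emeasure_walk: "emeasure walk {X. X n = y} = ennreal (cool_prob n y)"
proof -
  have "emeasure walk {X. X n = y} = (\<integral>\<^sup>+\<omega>s. emeasure (rwcre_quenched \<omega>s \<tau> 0) {X. X n = y} \<partial>envs)"
    by (rule emeasure_rwcre_annealed[OF prob_env sets_env \<tau> sets_path_component])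
  also have "\<dots> = (\<integral>\<^sup>+\<omega>s. ennreal (time_kernel (site \<omega>s) 0 n 0 y) \<partial>envs)"
  proof (rule nn_integral_cong_AE)
    show "AE \<omega>s in envs. emeasure (rwcre_quenched \<omega>s \<tau> 0) {X. X n = y} = ennreal (time_kernel (site \<omega>s) 0 n 0 y)"
      using AE_envs unfolding rwcre_quenched_def by eventually_elim (rule nn_chain_marginal, auto)
  qed
  also have "\<dots> = ennreal (cool_prob n y)"
    unfolding cool_prob_def
  proof (rule nn_integral_eq_integral[OF integrable_time_kernel])
    show "AE \<omega>s in envs. 0 \<le> time_kernel (site \<omega>s) 0 n 0 y"
      using AE_time_kernel_bounds[of 0 n 0 y] by eventually_elim auto
  qed
  finally show ?thesis .
qed

lemma cool_prob_nonneg: "0 \<le> cool_prob n y"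
  unfolding cool_prob_def
  by (rule integral_nonneg_AE, use AE_time_kernel_bounds[of 0 n 0 y] in eventually_elim) auto

text \<open>\<open>s\<close> is the last resampling time before \<open>n\<close>, that is \<tau> (k
  - 1), and is finite even if \<tau> k is infinite. The block is cut at time \<open>n\<close>, so
  its length n - s may be less than the full period.\<close>

lemma block_structure:
  assumes "n > 0"
  obtains s k where "s < n" "1 \<le> k" "\<And>i. i < s \<Longrightarrow> env_index \<tau> i \<in> {1..<k}"
    "\<And>i. s \<le> i \<Longrightarrow> i < n \<Longrightarrow> env_index \<tau> i = k"
proof -
  define k where "k = env_index \<tau> (n - 1)"
  have mono: "mono \<tau>" using \<tau> by (intro mono_iff_le_Suc[THEN iffD2]) (simp add: resampling_map_def)
  have \<tau>0: "\<tau> 0 = 0" using \<tau> by (simp add: resampling_map_def)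
  have k: "1 \<le> k" "enat (n - 1) < \<tau> k" using env_index_props[OF \<tau>, of "n - 1"] by (auto simp: k_def)
  have least: "env_index \<tau> i \<le> j" if "1 \<le> j" "enat i < \<tau> j" for i j
    unfolding env_index_def using that by (intro cInf_lower) auto
  \<comment> \<open>By minimality of \<open>k\<close>. Index 0 lies outside the set defining
    \<open>env_index\<close>, so the case \<open>k = 1\<close> rests on \<tau> 0 = 0.\<close>
  have le: "\<tau> (k - 1) \<le> enat (n - 1)"
  proof (cases "k = 1")
    case True then show ?thesis by (simp add: \<tau>0)
  next
    case False
    show ?thesis
    proof (rule ccontr)
      assume "\<not> \<tau> (k - 1) \<le> enat (n - 1)"
      then have "k \<le> k - 1" unfolding k_def using False k(1) by (intro least) (auto simp: k_def not_le)
      then show False using k(1) by simp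
    qed
  qed
  then obtain s where s: "\<tau> (k - 1) = enat s" by (cases "\<tau> (k - 1)") auto
  show ?thesis
  proof (rule that[of s k])
    show "s < n" using le s assms by simp
    show "1 \<le> k" by (rule k)
    show "env_index \<tau> i \<in> {1..<k}" if "i < s" for i
    proof -
      have "1 \<le> k - 1" using that s \<tau>0 by (cases "k - 1") (auto simp: zero_enat_def)
      then have "env_index \<tau> i \<le> k - 1" using that s by (intro least) auto
      then show ?thesis using env_index_props(1)[OF \<tau>, of i] \<open>1 \<le> k - 1\<close> by auto
    qed
    show "env_index \<tau> i = k" if i: "s \<le> i" "i < n" for i
    proof (rule antisym)
      have "enat i \<le> enat (n - 1)" using i by simp
      from le_less_trans[OF this k(2)] show "env_index \<tau> i \<le> k" by (rule least[OF k(1)])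
      show "k \<le> env_index \<tau> i"
      proof (rule ccontr)
        assume "\<not> k \<le> env_index \<tau> i"
        then have "\<tau> (env_index \<tau> i) \<le> \<tau> (k - 1)" using mono by (intro monoD[OF mono]) auto
        from less_le_trans[OF env_index_props(2)[OF \<tau>, of i] this] have "enat i < enat s" using s by simp
        then show False using i by simp
      qed
    qed
  qed
qed

text \<open>Chapman-Kolmogorov at the last resampling time: the past reads environments 1 to k - 1,
  the future only environment \<open>k\<close>. Translation invariance of its law makes the second
  factor depend on the displacement alone.\<close>

lemma cool_prob_block:
  assumes "n > 0"
  shows "\<exists>s<n. \<forall>y. cool_prob n y = (\<Sum>z=- int s..int s. cool_prob s z * walk_prob (n - s) (y - z))"
proof -
  obtain s k where sk: "s < n" "1 \<le> k" "\<And>i. i < s \<Longrightarrow> env_index \<tau> i \<in> {1..<k}"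
    "\<And>i. s \<le> i \<Longrightarrow> i < n \<Longrightarrow> env_index \<tau> i = k"
    using block_structure[OF assms] by blast
  have hom: "time_kernel (site \<omega>s) s (n - s) z y = kernel (\<omega>s k) (n - s) z y" for \<omega>s z y
    using sk by (intro time_kernel_homogeneous) auto
  have prod: "(\<integral>\<omega>s. time_kernel (site \<omega>s) 0 s 0 z * time_kernel (site \<omega>s) s (n - s) z y \<partial>envs) = cool_prob s z * walk_prob (n - s) (y - z)" for z y
  proof -
    have "(\<integral>\<omega>s. time_kernel (site \<omega>s) 0 s 0 z * time_kernel (site \<omega>s) s (n - s) z y \<partial>envs)
       = (\<integral>\<omega>s. time_kernel (site \<omega>s) 0 s 0 z \<partial>envs) * (\<integral>\<omega>s. time_kernel (site \<omega>s) s (n - s) z y \<partial>envs)"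
    proof (rule integral_PiM_disjoint[where J="{1..<k}" and K="{k}"])
      show "(\<lambda>\<omega>s. time_kernel (site \<omega>s) 0 s 0 z) \<in> borel_measurable (\<Pi>\<^sub>M k\<in>{1..<k}. env_law \<alpha>)"
        by (rule measurable_time_kernel) (use sk in auto)
      show "(\<lambda>\<omega>s. time_kernel (site \<omega>s) s (n - s) z y) \<in> borel_measurable (\<Pi>\<^sub>M k\<in>{k}. env_law \<alpha>)"
        by (rule measurable_time_kernel) (use sk in auto)
      show "time_kernel (site (restrict \<omega>s {1..<k})) 0 s 0 z = time_kernel (site \<omega>s) 0 s 0 z" for \<omega>s
        by (rule time_kernel_cong) (use sk in auto)
      show "time_kernel (site (restrict \<omega>s {k})) s (n - s) z y = time_kernel (site \<omega>s) s (n - s) z y" for \<omega>s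
        by (rule time_kernel_cong) (use sk in auto)
    qed (use sk prob_env integrable_time_kernel in auto)
    also have "(\<integral>\<omega>s. time_kernel (site \<omega>s) s (n - s) z y \<partial>envs) = walk_prob (n - s) (y - z)"
    proof -
      have m: "(\<lambda>\<omega>s. \<omega>s k) \<in> envs \<rightarrow>\<^sub>M env_law \<alpha>" using sk by (intro measurable_component_singleton) simp
      have "(\<integral>\<omega>s. kernel (\<omega>s k) (n - s) z y \<partial>envs) = (\<integral>\<omega>. kernel \<omega> (n - s) z y \<partial>distr envs (env_law \<alpha>) (\<lambda>\<omega>s. \<omega>s k))"
        by (rule integral_distr[OF m measurable_kernel, symmetric])
      also have "distr envs (env_law \<alpha>) (\<lambda>\<omega>s. \<omega>s k) = env_law \<alpha>"
        using distr_PiM_component[of "{1..}" "\<lambda>_. env_law \<alpha>" k] sk prob_env by simp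
      finally show ?thesis by (simp add: hom walk_prob_shift)
    qed
    finally show ?thesis by (simp add: cool_prob_def)
  qed
  have int: "integrable envs (\<lambda>\<omega>s. time_kernel (site \<omega>s) 0 s 0 z * time_kernel (site \<omega>s) s (n - s) z y)" for z y
  proof -
    interpret E: prob_space envs by (rule prob_envs)
    show ?thesis
    proof (rule E.integrable_const_bound[where B=1])
      show "AE \<omega>s in envs. norm (time_kernel (site \<omega>s) 0 s 0 z * time_kernel (site \<omega>s) s (n - s) z y) \<le> 1"
        using AE_time_kernel_bounds[of 0 s 0 z] AE_time_kernel_bounds[of s "n - s" z y]
        by eventually_elim (auto simp: abs_mult intro!: mult_le_one)
    qed (intro borel_measurable_times measurable_time_kernel, use env_index_props(1)[OF \<tau>] in auto)
  qed
  have "cool_prob n y = (\<Sum>z=- int s..int s. cool_prob s z * walk_prob (n - s) (y - z))" for y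
  proof -
    have "cool_prob n y = (\<integral>\<omega>s. (\<Sum>z=- int s..int s. time_kernel (site \<omega>s) 0 s 0 z * time_kernel (site \<omega>s) s (n - s) z y) \<partial>envs)"
      unfolding cool_prob_def using sk(1) time_kernel_Chapman_Kolmogorov[of "{- int s..int s}" 0 s _ 0 "n - s" y] by simp
    also have "\<dots> = (\<Sum>z=- int s..int s. cool_prob s z * walk_prob (n - s) (y - z))"
      by (subst Bochner_Integration.integral_sum[OF int]) (simp add: prod del: One_nat_def)
    finally show ?thesis .
  qed
  then show ?thesis using sk(1) by blast
qed

definition X :: "nat \<Rightarrow> int pmf" where
  "X n = embed_pmf (cool_prob n)"

lemma cool_prob_far: "\<bar>y\<bar> > int n \<Longrightarrow> cool_prob n y = 0"
  by (simp add: cool_prob_def time_kernel_far)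

lemma measurable_position: "(\<lambda>h. h n) \<in> walk \<rightarrow>\<^sub>M count_space UNIV"
  unfolding measurable_cong_sets[OF sets_rwcre_annealed[OF prob_env sets_env \<tau>] refl]
  by (rule measurable_component_singleton) simp

lemma space_walk: "space walk = UNIV"
  using sets_eq_imp_space_eq[OF sets_rwcre_annealed[OF prob_env sets_env \<tau>, of 0]]
  by (simp add: space_PiM PiE_UNIV_domain)

text \<open>That the total mass is 1 is inherited from the path measure, by splitting path space
  according to the position at time \<open>n\<close>.\<close>

lemma pmf_X: "pmf (X n) y = cool_prob n y"
  unfolding X_def
proof (rule pmf_embed_pmf)
  interpret W: prob_space walk by (rule prob_space_rwcre_annealed[OF prob_env sets_env \<tau>])
  have "(\<integral>\<^sup>+ y. ennreal (cool_prob n y) \<partial>count_space UNIV) = (\<integral>\<^sup>+ y. emeasure walk {h. h n = y} \<partial>count_space UNIV)"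
    by (simp add: emeasure_walk)
  also have "\<dots> = emeasure walk (\<Union>y\<in>UNIV. {h. h n = y})"
    using sets_path_component[of n]
    by (subst emeasure_UN_countable) (auto simp: disjoint_family_on_def sets_rwcre_annealed[OF prob_env sets_env \<tau>])
  also have "(\<Union>y\<in>UNIV. {h. h n = y}) = space walk" by (auto simp: space_walk)
  finally show "(\<integral>\<^sup>+ y. ennreal (cool_prob n y) \<partial>count_space UNIV) = 1" by (simp add: W.emeasure_space_1)
qed (rule cool_prob_nonneg)

lemma distr_walk: "distr walk (count_space UNIV) (\<lambda>h. h n) = measure_pmf (X n)"
proof (rule measure_eqI_countable[of _ UNIV])
  fix y
  have "(\<lambda>h. h n) -` {y} \<inter> space walk = {h. h n = y}" by (auto simp: space_walk)
  then show "emeasure (distr walk (count_space UNIV) (\<lambda>h. h n)) {y} = emeasure (measure_pmf (X n)) {y}"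
    by (simp add: emeasure_distr[OF measurable_position] emeasure_walk emeasure_pmf_single pmf_X)
qed auto

lemma X_0: "X 0 = return_pmf 0"
proof -
  interpret E: prob_space envs by (rule prob_envs)
  show ?thesis by (rule pmf_eqI) (auto simp: pmf_X cool_prob_def E.prob_space indicator_def simp del: One_nat_def)
qed

lemma bounded_X: "bounded_by n (X n)"
  unfolding bounded_by_def
proof
  fix y assume "y \<in> set_pmf (X n)"
  then have "cool_prob n y \<noteq> 0" by (simp add: set_pmf_iff pmf_X)
  then have "\<not> \<bar>y\<bar> > int n" using cool_prob_far by blast
  then show "y \<in> {- int n..int n}" by auto
qed

lemma X_step: "n > 0 \<Longrightarrow> \<exists>s<n. X n = conv_pmf (X s) (rw (n - s))"
proof -
  assume "n > 0"
  then obtain s where s: "s < n" "\<And>y. cool_prob n y = (\<Sum>z=- int s..int s. cool_prob s z * walk_prob (n - s) (y - z))"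
    using cool_prob_block by blast
  have "X n = conv_pmf (X s) (rw (n - s))"
  proof (rule pmf_eqI)
    fix y
    have "pmf (conv_pmf (X s) (rw (n - s))) y = (\<Sum>z=- int s..int s. pmf (X s) z * pmf (rw (n - s)) (y - z))"
      using bounded_X[of s] by (intro pmf_conv_sum) (auto simp: bounded_by_def)
    then show "pmf (X n) y = pmf (conv_pmf (X s) (rw (n - s))) y" by (simp add: pmf_X pmf_rw s(2))
  qed
  then show ?thesis using s(1) by blast
qed

lemma mgf_X: "(\<integral>h. exp (\<theta> * real_of_int (h n)) \<partial>walk) = mgf (X n) \<theta>"
  unfolding mgf_def distr_walk[symmetric] by (rule integral_distr[OF measurable_position, symmetric]) simp

lemma distr_X: "distr walk borel (\<lambda>h. real_of_int (h n) / real n) = distr (measure_pmf (X n)) borel (\<lambda>y. real_of_int y / real n)"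
  unfolding distr_walk[symmetric] by (subst distr_distr[OF _ measurable_position]) (auto simp: comp_def)

theorem LDP:
  assumes "\<And>\<theta>. (\<lambda>n. 1 / real n * ln (\<integral>h. exp (\<theta> * real_of_int (h n)) \<partial>walk)) \<longlonglongrightarrow> \<Lambda> \<theta>"
  shows "satisfies_LDP (\<lambda>n. distr walk borel (\<lambda>h. real_of_int (h n) / real n)) (\<lambda>x. SUP \<theta>. ereal (x * \<theta> - \<Lambda> \<theta>))"
proof -
  interpret B: block_walk X rw c \<Lambda> G
  proof (rule block_walk.intro)
    show "(\<lambda>n. ln (mgf (X n) \<theta>) / n) \<longlonglongrightarrow> \<Lambda> \<theta>" for \<theta> using assms[of \<theta>] by (simp add: mgf_X)
  qed (use bounded_X bounded_rw X_step X_0 mgf_rw_elliptic rw_limit rw_lower in auto)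
  show ?thesis using B.satisfies_LDP_rate unfolding B.rate_def[abs_def] distr_X .
qed

end

theorem theorem5p1:
  fixes \<alpha> :: "real measure" and \<tau> :: "nat \<Rightarrow> enat" and \<Lambda> :: "real \<Rightarrow> real"
  assumes "prob_space \<alpha>" and "sets \<alpha> = sets borel" and "measure \<alpha> {0<..<1} = 1"
    and nondegenerate: "\<nexists>x. measure \<alpha> {x} = 1"
    and elliptic: "\<exists>\<cc>>0. measure \<alpha> {\<cc>..1 - \<cc>} = 1"
    and "resampling_map \<tau>"
    and "strictly_convex \<Lambda>"
    and lim_cooling: "\<And>\<theta>.
      (\<lambda>n. 1 / real n *
        ln (\<integral>X. exp (\<theta> * real_of_int (X n)) \<partial>rwcre_annealed (env_law \<alpha>) \<tau> 0)) \<longlonglongrightarrow> \<Lambda> \<theta>"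
    and lim_blocks: "\<And>\<theta>.
      (\<lambda>n. \<Sum>\<^sub>\<infinity>k\<in>{1..}. let T = block_length \<tau> k n in
         if T = 0 then 0
         else real T / real n *
           (1 / real T *
             ln (\<integral>Z. exp (\<theta> * real_of_int (Z T)) \<partial>rwre_annealed (env_law \<alpha>) 0))) \<longlonglongrightarrow> \<Lambda> \<theta>"
  shows "satisfies_LDP
    (\<lambda>n. distr (rwcre_annealed (env_law \<alpha>) \<tau> 0) borel (\<lambda>X. real_of_int (X n) / real n))
    (\<lambda>x. SUP \<theta>. ereal (x * \<theta> - \<Lambda> \<theta>))"
proof -
  obtain c where c: "c > 0" "measure \<alpha> {c..1 - c} = 1" using elliptic by blast
  interpret prob_space \<alpha> by fact
  have "AE p in \<alpha>. p \<in> {c..1 - c}"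
    using c(2) assms(2) by (intro prob_eq_1[THEN iffD1]) auto
  then interpret cooling_walk \<alpha> c \<tau>
    using assms c by (intro cooling_walk.intro elliptic_law.intro cooling_walk_axioms.intro) auto
  show ?thesis by (rule LDP[OF lim_cooling])
qed

end
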